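(* Let $A'=U\times\mathfrak h^*\times\mathfrak g'$ be the trivial Lie algebroid over $U$, and let $A(X)^*\simeq U\times\mathfrak h\times\mathfrak g^*$ be the dynamical Lie algebroid associated with the dynamical $r$-matrix $R$ and the coboundary dynamical Poisson groupoid $X=U\times G\times U$. Then the (bijective) bundle map $$\sigma:A'\to U\times\mathfrak h\times\mathfrak g^*,\qquad \sigma(q,\lambda,\xi)=\big(q,\ -C^\#(q)\lambda-\Pi_{\mathfrak h}\xi,\ \lambda+\psi(q)^{-1}(\Pi_{\mathfrak n}\xi)\big)$$ is an isomorphism of Lie algebroids. Its inverse is given by $$\tau(q,Z,\lambda+n)=\big(q,\lambda,-C^\#(q)\lambda-Z+\psi(q)n\big)\qquad(q\in U,\ Z\in\mathfrak h,\ \lambda\in\mathfrak h^*\simeq\mathfrak h,\ n\in\mathfrak n).$$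
   Context: Lie algebra data. $\mathfrak g$ is a complex simple Lie algebra with Killing form $(\,,\,)$, $\mathfrak h$ a Cartan subalgebra, $\mathfrak g=\mathfrak h\oplus\sum_{\alpha\in\Delta}\mathfrak g_\alpha$ the root decomposition, $\mathfrak n=\sum_{\alpha\in\Delta}\mathfrak g_\alpha$, with projections $\Pi_{\mathfrak h},\Pi_{\mathfrak n}$ for $\mathfrak g=\mathfrak h\oplus\mathfrak n$. $\Delta^s$ is a simple system, $\Delta^\pm$ the positive/negative roots; $e_\alpha\in\mathfrak g_\alpha$ are root vectors with $(e_\alpha,e_{-\alpha})=1$, $[e_\alpha,e_{-\alpha}]=h_\alpha$ for $\alpha\in\Delta^+$; $(x_i)$ is an orthonormal basis of $\mathfrak h$. For $\Gamma\subset\Delta^s$, $\langle\Gamma\rangle\subset\Delta$ is its root span, $\langle\Gamma\rangle^\pm=\langle\Gamma\rangle\cap\Delta^\pm$, $\overline\Gamma^\pm=\Delta^\pm\setminus\langle\Gamma\rangle^\pm$. We identify $\mathfrak g^*\simeq\mathfrak g$, $\mathfrak h^*\simeq\mathfrak h$ via $(\,,\,)$; $(\alpha,q)$ is the induced form on $\mathfrak h^*$. $\iota:\mathfrak h\to\mathfrak g$ is the inclusion; $\iota^*:\mathfrak g^*\to\mathfrak h^*$ becomes $\Pi_{\mathfrak h}$. The $r$-matrix. Fix $\Gamma\subset\Delta^s$, $\mu\in\mathfrak h^*$ and a closed meromorphic 2-form $\sum_{i,j}C_{ij}\,dq^i\otimes dq^j$ on $\mathfrak h^*$ ($C_{ij}=-C_{ji}$).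 Put $R(q)B=\sum_{i,j}C_{ij}(q)\langle x_j,B\rangle x_i+\sum_{\alpha\in\Delta}\phi_\alpha(q)\langle e_{-\alpha},B\rangle e_\alpha$, with $\phi_\alpha=\tfrac12$ for $\alpha\in\overline\Gamma^+$, $\phi_\alpha=-\tfrac12$ for $\alpha\in\overline\Gamma^-$, $\phi_\alpha(q)=\tfrac12\coth\big(\tfrac{(\alpha,q-\mu)}2\big)$ for $\alpha\in\langle\Gamma\rangle$. $U\subset\mathfrak h^*$ is the domain of analyticity of $R$. $C^\#(q):\mathfrak h^*\to\mathfrak h$, $C^\#(q)\lambda=\sum_{i,j}C_{ij}(q)\lambda(x_j)x_i$. The Poisson groupoid and $A(X)^*$. $G$ is the connected, simply connected group with Lie algebra $\mathfrak g$; $X=U\times G\times U$ is the trivial Lie groupoid with the coboundary Poisson bracket $\{f,g\}(p,x,q)=\langle p,[\delta_1f,\delta_1g]\rangle-\langle q,[\delta_2f,\delta_2g]\rangle-\langle\iota\delta_1f,Dg\rangle-\langle\iota\delta_2f,D'g\rangle+\langle\iota\delta_1g,Df\rangle+\langle\iota\delta_2g,D'f\rangle+\langle R(p)Df,Dg\rangle-\langle R(q)D'f,D'g\rangle$ ($\delta_1,\delta_2$: derivatives in the two $U$-variables; $\langle Df,Y\rangle=\frac{d}{dt}|_0f(p,e^{tY}x,q)$, $\langle D'f,Y\rangle=\frac{d}{dt}|_0f(p,xe^{tY},q)$). The induced Lie algebroid structure on $A(X)^*\simeq U\times\mathfrak h\times\mathfrak g^*$ (the conormal bundle of the unit submanifold)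 is, explicitly, the following: anchor $a_*(q,Z,B)=(q,\iota^*B)$, and for sections $Z,Z':U\to\mathfrak h$, $B,B':U\to\mathfrak g^*\simeq\mathfrak g$, $$[(Z,B),(Z',B')]_*(q)=\big(dZ'(q)\iota^*B-dZ(q)\iota^*B'-(dR(q)(\cdot)B,B'),\ -dB(q)\iota^*B'+dB'(q)\iota^*B-[R(q)B+Z,B']-[B,R(q)B'+Z']\big),$$ all sections on the right evaluated at $q$; $(dR(q)(\cdot)B,B')$ is viewed in $(\mathfrak h^* )^*=\mathfrak h$. The Lie algebra $\mathfrak g'$. $\mathfrak h_\Gamma=\mathrm{span}_{\mathbb C}(h_\gamma)_{\gamma\in\Gamma}$; $\mathfrak h_\Gamma^\perp$ is its orthogonal complement in $\mathfrak h$; $\mathfrak l_\Gamma=\mathfrak h_\Gamma\oplus\mathrm{span}(e_\alpha)_{\alpha\in\langle\Gamma\rangle}$; $\overline{\mathfrak n}^\pm_\Gamma=\mathrm{span}(e_\alpha)_{\alpha\in\overline\Gamma^\pm}$. $\mathfrak g_1\ominus\mathfrak g_2$ is $\mathfrak g_1\oplus\mathfrak g_2$ with bracket $[x_1+x_2,y_1+y_2]=[x_1,y_1]-[x_2,y_2]$. $\mathfrak I_\Gamma=\mathfrak h_\Gamma^\perp\ltimes(\overline{\mathfrak n}^+_\Gamma\ominus\overline{\mathfrak n}^-_\Gamma)$ and $\mathfrak g'=\mathfrak l_\Gamma\ltimes\mathfrak I_\Gamma$, all actions being by the adjoint action of $\mathfrak g$. As a vector space $\mathfrak g'=\mathfrak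 g=\mathfrak h\oplus\mathfrak n$. The map $\psi(q):\mathfrak n\to\mathfrak n$: $\psi(q)e_\alpha=\dfrac{-1}{2\sinh((\alpha,q-\mu)/2)}e_\alpha$ for $\alpha\in\langle\Gamma\rangle$, $\psi(q)e_\alpha=-e^{\mp\frac12(\alpha,q-\mu)}e_\alpha$ for $\alpha\in\overline\Gamma^\pm$. Trivial Lie algebroid $A'=U\times\mathfrak h^*\times\mathfrak g'$: anchor $(q,\lambda,\xi)\mapsto(q,\lambda)$; bracket of sections $[(\lambda,\xi),(\lambda',\xi')]=(d\lambda'\cdot\lambda-d\lambda\cdot\lambda',\ d\xi'\cdot\lambda-d\xi\cdot\lambda'+[\xi,\xi']_{\mathfrak g'})$. *)

theory Defs
  imports "HOL-Analysis.Analysis"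
begin

section \<open>Holomorphic maps on open subsets of a complex subspace\<close>

text \<open>
  A finite-dimensional complex vector space is modelled by \<^typ>\<open>complex ^ 'n\<close>; the Cartan subalgebra
  \<open>h\<close> is a complex subspace of it. Functions on an open subset of \<open>h\<close> are total functions of which only
  the values on \<open>h\<close> matter, so all derivatives are taken within \<open>h\<close>, and are only evaluated on
  directions in \<open>h\<close>, where a derivative within \<open>h\<close> is unique.
\<close>

definition scale2 :: "complex \<Rightarrow> (complex ^ 'n) \<times> (complex ^ 'm) \<Rightarrow> (complex ^ 'n) \<times> (complex ^ 'm)" where
  "scale2 c u = (c *s fst u, c *s snd u)"

interpretation pair: vector_space scale2
  by unfold_locales (auto simp: scale2_def vec.scale_right_distrib vec.scale_left_distrib)

text \<open>The argument \<open>sc\<close> is the complex scalar multiplication of the target space.\<close>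

definition holo ::
  "(complex ^ 'n) set \<Rightarrow> (complex \<Rightarrow> 'b \<Rightarrow> 'b) \<Rightarrow> (complex ^ 'n) set
    \<Rightarrow> (complex ^ 'n \<Rightarrow> 'b::real_normed_vector) \<Rightarrow> bool" where
  "holo h sc V f \<longleftrightarrow>
     (\<forall>q\<in>V. \<exists>D. (f has_derivative D) (at q within h) \<and> (\<forall>c v. D (c *s v) = sc c (D v)))"

definition dir_deriv ::
  "(complex ^ 'n) set \<Rightarrow> (complex ^ 'n \<Rightarrow> 'b::real_normed_vector)
    \<Rightarrow> complex ^ 'n \<Rightarrow> complex ^ 'n \<Rightarrow> 'b" where
  "dir_deriv h f q v = frechet_derivative f (at q within h) v"

text \<open>
  Meromorphic functions of several variables: local quotients of holomorphic functions whose
  denominator does not vanish identically. The values at the zeros of the denominator are unconstrained,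
  so a meromorphic function is represented by any total function with the right values off a thin set.
\<close>

definition meromorphic_fun ::
  "(complex ^ 'n) set \<Rightarrow> (complex ^ 'n \<Rightarrow> complex) \<Rightarrow> bool" where
  "meromorphic_fun h f \<longleftrightarrow>
     (\<forall>p\<in>h. \<exists>V a b. openin (top_of_set h) V \<and> connected V \<and> p \<in> V \<and>
        holo h (*) V a \<and> holo h (*) V b \<and> (\<exists>q\<in>V. b q \<noteq> 0) \<and>
        (\<forall>q\<in>V. b q \<noteq> 0 \<longrightarrow> f q = a q / b q))"


section \<open>Holomorphic Lie algebroids on trivial bundles\<close>

text \<open>
  The base \<open>base A\<close> is open in the complex vector space \<open>tangent A\<close>, the total space is
  \<open>base A \<times> fibre A\<close>, and a section over an open \<open>V \<subseteq> base A\<close> is given by its second component. The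
  bracket is a bracket on the sheaf of holomorphic sections.
\<close>

record 'n algebroid =
  tangent :: "(complex ^ 'n) set"
  base :: "(complex ^ 'n) set"
  fibre :: "((complex ^ 'n) \<times> (complex ^ 'n)) set"
  anchor :: "complex ^ 'n \<Rightarrow> (complex ^ 'n) \<times> (complex ^ 'n) \<Rightarrow> complex ^ 'n"
  bracket :: "(complex ^ 'n \<Rightarrow> (complex ^ 'n) \<times> (complex ^ 'n))
    \<Rightarrow> (complex ^ 'n \<Rightarrow> (complex ^ 'n) \<times> (complex ^ 'n))
    \<Rightarrow> complex ^ 'n \<Rightarrow> (complex ^ 'n) \<times> (complex ^ 'n)"

definition total_space :: "'n::finite algebroid \<Rightarrow> ((complex ^ 'n) \<times> (complex ^ 'n) \<times> (complex ^ 'n)) set" where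
  "total_space A = base A \<times> fibre A"

definition open_in_base :: "'n::finite algebroid \<Rightarrow> (complex ^ 'n) set \<Rightarrow> bool" where
  "open_in_base A V \<longleftrightarrow> V \<subseteq> base A \<and> openin (top_of_set (tangent A)) V"

definition sections ::
  "'n::finite algebroid \<Rightarrow> (complex ^ 'n) set \<Rightarrow> (complex ^ 'n \<Rightarrow> (complex ^ 'n) \<times> (complex ^ 'n)) set" where
  "sections A V = {s. (\<forall>q\<in>V. s q \<in> fibre A) \<and> holo (tangent A) scale2 V s}"

locale lie_algebroid =
  fixes A :: "'n::finite algebroid"
  assumes tangent_subspace: "vec.subspace (tangent A)"
    and base_open: "openin (top_of_set (tangent A)) (base A)"
    and fibre_subspace: "pair.subspace (fibre A)"
    and anchor_tangent: "\<And>q u. q \<in> base A \<Longrightarrow> u \<in> fibre A \<Longrightarrow> anchor A q u \<in> tangent A"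
    and anchor_add: "\<And>q u v. q \<in> base A \<Longrightarrow> u \<in> fibre A \<Longrightarrow> v \<in> fibre A \<Longrightarrow>
      anchor A q (u + v) = anchor A q u + anchor A q v"
    and anchor_scale: "\<And>q u c. q \<in> base A \<Longrightarrow> u \<in> fibre A \<Longrightarrow>
      anchor A q (scale2 c u) = c *s anchor A q u"
    and anchor_holo: "\<And>u. u \<in> fibre A \<Longrightarrow> holo (tangent A) (*s) (base A) (\<lambda>q. anchor A q u)"
    and bracket_local: "\<And>V s s' t t' q. open_in_base A V \<Longrightarrow>
      s \<in> sections A V \<Longrightarrow> s' \<in> sections A V \<Longrightarrow> t \<in> sections A V \<Longrightarrow> t' \<in> sections A V \<Longrightarrow>
      (\<forall>p\<in>V. s p = s' p \<and> t p = t' p) \<Longrightarrow> q \<in> V \<Longrightarrow> bracket A s t q = bracket A s' t' q"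
    and bracket_section: "\<And>V s t. open_in_base A V \<Longrightarrow>
      s \<in> sections A V \<Longrightarrow> t \<in> sections A V \<Longrightarrow> bracket A s t \<in> sections A V"
    and bracket_add: "\<And>V s t u q. open_in_base A V \<Longrightarrow>
      s \<in> sections A V \<Longrightarrow> t \<in> sections A V \<Longrightarrow> u \<in> sections A V \<Longrightarrow> q \<in> V \<Longrightarrow>
      bracket A s (\<lambda>p. t p + u p) q = bracket A s t q + bracket A s u q"
    and bracket_skew: "\<And>V s t q. open_in_base A V \<Longrightarrow>
      s \<in> sections A V \<Longrightarrow> t \<in> sections A V \<Longrightarrow> q \<in> V \<Longrightarrow>
      bracket A s t q = - bracket A t s q"
    and bracket_jacobi: "\<And>V s t u q. open_in_base A V \<Longrightarrow>
      s \<in> sections A V \<Longrightarrow> t \<in> sections A V \<Longrightarrow> u \<in> sections A V \<Longrightarrow> q \<in> V \<Longrightarrow>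
      bracket A s (bracket A t u) q + bracket A t (bracket A u s) q + bracket A u (bracket A s t) q = 0"
    and bracket_leibniz: "\<And>V s t f q. open_in_base A V \<Longrightarrow>
      s \<in> sections A V \<Longrightarrow> t \<in> sections A V \<Longrightarrow> holo (tangent A) (*) V f \<Longrightarrow> q \<in> V \<Longrightarrow>
      bracket A s (\<lambda>p. scale2 (f p) (t p)) q =
        scale2 (f q) (bracket A s t q) + scale2 (dir_deriv (tangent A) f q (anchor A q (s q))) (t q)"

text \<open>Morphisms over the identity of a common base.\<close>

definition lie_algebroid_morphism ::
  "'n::finite algebroid \<Rightarrow> 'n algebroid
    \<Rightarrow> ((complex ^ 'n) \<times> (complex ^ 'n) \<times> (complex ^ 'n) \<Rightarrow> (complex ^ 'n) \<times> (complex ^ 'n) \<times> (complex ^ 'n))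
    \<Rightarrow> bool" where
  "lie_algebroid_morphism A B F \<longleftrightarrow>
     tangent A = tangent B \<and> base A = base B \<and>
     (\<forall>q\<in>base A. \<forall>u\<in>fibre A. fst (F (q, u)) = q \<and> snd (F (q, u)) \<in> fibre B) \<and>
     (\<forall>q\<in>base A. \<forall>u\<in>fibre A. \<forall>v\<in>fibre A. snd (F (q, u + v)) = snd (F (q, u)) + snd (F (q, v))) \<and>
     (\<forall>q\<in>base A. \<forall>u\<in>fibre A. \<forall>c. snd (F (q, scale2 c u)) = scale2 c (snd (F (q, u)))) \<and>
     (\<forall>u\<in>fibre A. holo (tangent A) scale2 (base A) (\<lambda>q. snd (F (q, u)))) \<and>
     (\<forall>q\<in>base A. \<forall>u\<in>fibre A. anchor B q (snd (F (q, u))) = anchor A q u) \<and>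
     (\<forall>V s t q. open_in_base A V \<longrightarrow> s \<in> sections A V \<longrightarrow> t \<in> sections A V \<longrightarrow> q \<in> V \<longrightarrow>
        snd (F (q, bracket A s t q)) =
          bracket B (\<lambda>p. snd (F (p, s p))) (\<lambda>p. snd (F (p, t p))) q)"

definition lie_algebroid_iso ::
  "'n::finite algebroid \<Rightarrow> 'n algebroid
    \<Rightarrow> ((complex ^ 'n) \<times> (complex ^ 'n) \<times> (complex ^ 'n) \<Rightarrow> (complex ^ 'n) \<times> (complex ^ 'n) \<times> (complex ^ 'n))
    \<Rightarrow> bool" where
  "lie_algebroid_iso A B F \<longleftrightarrow>
     lie_algebroid A \<and> lie_algebroid B \<and> bij_betw F (total_space A) (total_space B) \<and>
     lie_algebroid_morphism A B F \<and> lie_algebroid_morphism B A (inv_into (total_space A) F)"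


section \<open>Complex simple Lie algebras\<close>

definition lie_algebra :: "(complex ^ 'n \<Rightarrow> complex ^ 'n \<Rightarrow> complex ^ 'n) \<Rightarrow> bool" where
  "lie_algebra br \<longleftrightarrow>
     (\<forall>x. Vector_Spaces.linear (*s) (*s) (br x)) \<and>
     (\<forall>y. Vector_Spaces.linear (*s) (*s) (\<lambda>x. br x y)) \<and>
     (\<forall>x. br x x = 0) \<and>
     (\<forall>x y z. br x (br y z) + br y (br z x) + br z (br x y) = 0)"

definition lie_ideal ::
  "(complex ^ 'n \<Rightarrow> complex ^ 'n \<Rightarrow> complex ^ 'n) \<Rightarrow> (complex ^ 'n) set \<Rightarrow> bool" where
  "lie_ideal br I \<longleftrightarrow> vec.subspace I \<and> (\<forall>x. \<forall>y\<in>I. br x y \<in> I)"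

definition simple_lie_algebra :: "(complex ^ 'n \<Rightarrow> complex ^ 'n \<Rightarrow> complex ^ 'n) \<Rightarrow> bool" where
  "simple_lie_algebra br \<longleftrightarrow>
     lie_algebra br \<and> (\<exists>x y. br x y \<noteq> 0) \<and> (\<forall>I. lie_ideal br I \<longrightarrow> I = {0} \<or> I = UNIV)"

definition killing ::
  "(complex ^ 'n \<Rightarrow> complex ^ 'n \<Rightarrow> complex ^ 'n) \<Rightarrow> complex ^ 'n \<Rightarrow> complex ^ 'n \<Rightarrow> complex" where
  "killing br x y = trace (matrix (\<lambda>z. br x (br y z)))"

definition abelian_subalgebra ::
  "(complex ^ 'n \<Rightarrow> complex ^ 'n \<Rightarrow> complex ^ 'n) \<Rightarrow> (complex ^ 'n) set \<Rightarrow> bool" where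
  "abelian_subalgebra br h \<longleftrightarrow> vec.subspace h \<and> (\<forall>x\<in>h. \<forall>y\<in>h. br x y = 0)"

text \<open>
  Cartan subalgebras of a complex semisimple Lie algebra: maximal abelian subalgebras all of whose
  elements are ad-semisimple (Helgason's definition).
\<close>

definition cartan_subalgebra ::
  "(complex ^ 'n \<Rightarrow> complex ^ 'n \<Rightarrow> complex ^ 'n) \<Rightarrow> (complex ^ 'n) set \<Rightarrow> bool" where
  "cartan_subalgebra br h \<longleftrightarrow>
     abelian_subalgebra br h \<and> (\<forall>k. abelian_subalgebra br k \<and> h \<subseteq> k \<longrightarrow> k = h) \<and>
     (\<forall>H\<in>h. vec.span {x. \<exists>c. br H x = c *s x} = UNIV)"

text \<open>
  Throughout, \<open>h\<^sup>*\<close> is identified with \<open>h\<close> (and \<open>g\<^sup>*\<close> with \<open>g\<close>) by the Killing form. In particular a root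
  is an element \<open>\<alpha>\<close> of \<open>h\<close>, its value on \<open>H\<close> is the Killing product of \<open>\<alpha>\<close> and \<open>H\<close>, the element
  \<open>h\<^sub>\<alpha>\<close> is \<open>\<alpha>\<close> itself, and the form induced on \<open>h\<^sup>*\<close> is the Killing form on \<open>h\<close>.
\<close>

definition root_space ::
  "(complex ^ 'n \<Rightarrow> complex ^ 'n \<Rightarrow> complex ^ 'n) \<Rightarrow> (complex ^ 'n) set \<Rightarrow> complex ^ 'n \<Rightarrow> (complex ^ 'n) set" where
  "root_space br h \<alpha> = {x. \<forall>H\<in>h. br H x = killing br \<alpha> H *s x}"

definition roots ::
  "(complex ^ 'n \<Rightarrow> complex ^ 'n \<Rightarrow> complex ^ 'n) \<Rightarrow> (complex ^ 'n) set \<Rightarrow> (complex ^ 'n) set" where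
  "roots br h = {\<alpha>\<in>h. \<alpha> \<noteq> 0 \<and> root_space br h \<alpha> \<noteq> {0}}"

definition nat_comb :: "(complex ^ 'n) set \<Rightarrow> (complex ^ 'n) set" where
  "nat_comb S = {\<Sum>\<beta>\<in>S. of_nat (c \<beta>) *s \<beta> |c :: complex ^ 'n \<Rightarrow> nat. True}"

definition simple_system ::
  "(complex ^ 'n \<Rightarrow> complex ^ 'n \<Rightarrow> complex ^ 'n) \<Rightarrow> (complex ^ 'n) set \<Rightarrow> (complex ^ 'n) set \<Rightarrow> bool" where
  "simple_system br h S \<longleftrightarrow>
     S \<subseteq> roots br h \<and> vec.independent S \<and>
     (\<forall>\<alpha>\<in>roots br h. \<alpha> \<in> nat_comb S \<or> - \<alpha> \<in> nat_comb S)"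

definition pos_roots where "pos_roots br h S = {\<alpha>\<in>roots br h. \<alpha> \<in> nat_comb S}"
definition neg_roots where "neg_roots br h S = {\<alpha>\<in>roots br h. - \<alpha> \<in> nat_comb S}"

text \<open>
  The root decomposition and the one-dimensionality of the root spaces are consequences of the first
  two assumptions; they are listed because they belong to the data (the root vectors form, together
  with a basis of \<open>h\<close>, a basis of \<open>g\<close>).
\<close>

locale simple_lie_data =
  fixes br :: "complex ^ 'n \<Rightarrow> complex ^ 'n \<Rightarrow> complex ^ 'n"
    and h :: "(complex ^ 'n) set"
    and S :: "(complex ^ 'n) set"
    and e :: "complex ^ 'n \<Rightarrow> complex ^ 'n"
    and x :: "'r::finite \<Rightarrow> complex ^ 'n"
  assumes simple: "simple_lie_algebra br"
    and cartan: "cartan_subalgebra br h"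
    and root_decomposition: "vec.span (h \<union> (\<Union>\<alpha>\<in>roots br h. root_space br h \<alpha>)) = UNIV"
    and simple_roots: "simple_system br h S"
    and root_vector: "\<And>\<alpha>. \<alpha> \<in> roots br h \<Longrightarrow> root_space br h \<alpha> = vec.span {e \<alpha>}"
    and root_vector_normalized: "\<And>\<alpha>. \<alpha> \<in> roots br h \<Longrightarrow> killing br (e \<alpha>) (e (- \<alpha>)) = 1"
    and root_vector_bracket: "\<And>\<alpha>. \<alpha> \<in> pos_roots br h S \<Longrightarrow> br (e \<alpha>) (e (- \<alpha>)) = \<alpha>"
    and orthonormal: "\<And>i j. killing br (x i) (x j) = (if i = j then 1 else 0)"
    and basis: "vec.span (range x) = h"


section \<open>The dynamical r-matrix and the two Lie algebroids\<close>

text \<open>The projection of \<open>X + Y\<close> onto \<open>X\<close> for subspaces \<open>X\<close>, \<open>Y\<close> with zero intersection.\<close>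

definition proj :: "(complex ^ 'n) set \<Rightarrow> (complex ^ 'n) set \<Rightarrow> complex ^ 'n \<Rightarrow> complex ^ 'n" where
  "proj X Y u = (THE a. a \<in> X \<and> u - a \<in> Y)"

text \<open>
  The brackets of \<open>X \<ominus> Y\<close> and of \<open>X \<ltimes> Y\<close> on the internal direct sum of \<open>X\<close> and \<open>Y\<close>; in the latter, \<open>X\<close>
  carries the bracket \<open>br\<close> and acts on \<open>Y\<close> by \<open>br\<close>, while \<open>Y\<close> carries its own bracket \<open>brY\<close>.
\<close>

definition ominus_bracket ::
  "(complex ^ 'n \<Rightarrow> complex ^ 'n \<Rightarrow> complex ^ 'n) \<Rightarrow> (complex ^ 'n) set \<Rightarrow> (complex ^ 'n) set
    \<Rightarrow> complex ^ 'n \<Rightarrow> complex ^ 'n \<Rightarrow> complex ^ 'n" where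
  "ominus_bracket br X Y u v = br (proj X Y u) (proj X Y v) - br (proj Y X u) (proj Y X v)"

definition semidirect_bracket ::
  "(complex ^ 'n \<Rightarrow> complex ^ 'n \<Rightarrow> complex ^ 'n) \<Rightarrow> (complex ^ 'n) set \<Rightarrow> (complex ^ 'n) set
    \<Rightarrow> (complex ^ 'n \<Rightarrow> complex ^ 'n \<Rightarrow> complex ^ 'n)
    \<Rightarrow> complex ^ 'n \<Rightarrow> complex ^ 'n \<Rightarrow> complex ^ 'n" where
  "semidirect_bracket br X Y brY u v =
     br (proj X Y u) (proj X Y v) + br (proj X Y u) (proj Y X v) - br (proj X Y v) (proj Y X u)
     + brY (proj Y X u) (proj Y X v)"

locale dynamical_r_matrix = simple_lie_data br h S e x
  for br :: "complex ^ 'n \<Rightarrow> complex ^ 'n \<Rightarrow> complex ^ 'n"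
    and h S e and x :: "'r::finite \<Rightarrow> complex ^ 'n" +
  fixes \<Gamma> :: "(complex ^ 'n) set"
    and \<mu> :: "complex ^ 'n"
    and C :: "'r \<Rightarrow> 'r \<Rightarrow> complex ^ 'n \<Rightarrow> complex"
  assumes \<Gamma>_simple: "\<Gamma> \<subseteq> S"
    and \<mu>_in: "\<mu> \<in> h"
    and C_meromorphic: "\<And>i j. meromorphic_fun h (C i j)"
    and C_skew: "\<And>i j q. q \<in> h \<Longrightarrow> C i j q = - C j i q"
    and C_closed: "\<And>V q i j k. openin (top_of_set h) V \<Longrightarrow> (\<And>i j. holo h (*) V (C i j)) \<Longrightarrow> q \<in> V \<Longrightarrow>
      dir_deriv h (C i j) q (x k) + dir_deriv h (C j k) q (x i) + dir_deriv h (C k i) q (x j) = 0"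
begin

abbreviation K where "K \<equiv> killing br"

abbreviation \<Delta> where "\<Delta> \<equiv> roots br h"

definition n where "n = vec.span (e ` \<Delta>)"

definition proj_h where "proj_h = proj h n"

definition proj_n where "proj_n = proj n h"

text \<open>For roots, the complex span and the integer span of the set \<open>\<Gamma>\<close> of simple roots agree.\<close>

definition root_span where "root_span = \<Delta> \<inter> vec.span \<Gamma>"

definition pos_compl where "pos_compl = pos_roots br h S - root_span"

definition neg_compl where "neg_compl = neg_roots br h S - root_span"

definition \<phi> :: "complex ^ 'n \<Rightarrow> complex ^ 'n \<Rightarrow> complex" where
  "\<phi> \<alpha> q = (if \<alpha> \<in> root_span then cosh (K \<alpha> (q - \<mu>) / 2) / sinh (K \<alpha> (q - \<mu>) / 2) / 2
    else if \<alpha> \<in> pos_compl then 1 / 2 else - 1 / 2)"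

definition C_sharp :: "complex ^ 'n \<Rightarrow> complex ^ 'n \<Rightarrow> complex ^ 'n" where
  "C_sharp q v = (\<Sum>i\<in>UNIV. \<Sum>j\<in>UNIV. (C i j q * K v (x j)) *s x i)"

definition R :: "complex ^ 'n \<Rightarrow> complex ^ 'n \<Rightarrow> complex ^ 'n" where
  "R q B = (\<Sum>i\<in>UNIV. \<Sum>j\<in>UNIV. (C i j q * K (x j) B) *s x i)
    + (\<Sum>\<alpha>\<in>\<Delta>. (\<phi> \<alpha> q * K (e (- \<alpha>)) B) *s e \<alpha>)"

text \<open>
  The domain of analyticity. The value \<open>x / 0 = 0\<close> does not matter here: a pole remains a point of
  discontinuity.
\<close>

definition U where
  "U = {q\<in>h. \<exists>V. openin (top_of_set h) V \<and> q \<in> V \<and> (\<forall>B. holo h (*s) V (\<lambda>p. R p B))}"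

definition \<psi>_coeff :: "complex ^ 'n \<Rightarrow> complex ^ 'n \<Rightarrow> complex" where
  "\<psi>_coeff \<alpha> q = (if \<alpha> \<in> root_span then - 1 / (2 * sinh (K \<alpha> (q - \<mu>) / 2))
    else if \<alpha> \<in> pos_compl then - exp (- (K \<alpha> (q - \<mu>) / 2))
    else - exp (K \<alpha> (q - \<mu>) / 2))"

text \<open>The coefficient of \<open>e \<alpha>\<close> in \<open>u\<close> is \<open>K (e (- \<alpha>)) u\<close>.\<close>

definition \<psi> :: "complex ^ 'n \<Rightarrow> complex ^ 'n \<Rightarrow> complex ^ 'n" where
  "\<psi> q u = (\<Sum>\<alpha>\<in>\<Delta>. (\<psi>_coeff \<alpha> q * K (e (- \<alpha>)) u) *s e \<alpha>)"

definition h\<Gamma> where "h\<Gamma> = vec.span \<Gamma>"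

definition h\<Gamma>_perp where "h\<Gamma>_perp = {y\<in>h. \<forall>z\<in>h\<Gamma>. K z y = 0}"

definition l\<Gamma> where "l\<Gamma> = vec.span (h\<Gamma> \<union> e ` root_span)"

definition n_pos where "n_pos = vec.span (e ` pos_compl)"

definition n_neg where "n_neg = vec.span (e ` neg_compl)"

definition I_bracket where
  "I_bracket = semidirect_bracket br h\<Gamma>_perp (vec.span (n_pos \<union> n_neg)) (ominus_bracket br n_pos n_neg)"

text \<open>The bracket of \<open>g'\<close>, whose underlying space is that of \<open>g\<close>.\<close>

definition g'_bracket where
  "g'_bracket = semidirect_bracket br l\<Gamma> (vec.span (h\<Gamma>_perp \<union> n_pos \<union> n_neg)) I_bracket"

definition trivial_bracket where
  "trivial_bracket s s' q =
     (let l = fst \<circ> s; \<xi> = snd \<circ> s; l' = fst \<circ> s'; \<xi>' = snd \<circ> s'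
      in (dir_deriv h l' q (l q) - dir_deriv h l q (l' q),
          dir_deriv h \<xi>' q (l q) - dir_deriv h \<xi> q (l' q) + g'_bracket (\<xi> q) (\<xi>' q)))"

text \<open>The trivial Lie algebroid \<open>A'\<close>.\<close>

definition A_trivial :: "'n algebroid" where
  "A_trivial = \<lparr>tangent = h, base = U, fibre = h \<times> UNIV,
     anchor = (\<lambda>q u. fst u), bracket = trivial_bracket\<rparr>"

text \<open>\<open>(dR(q)(\<cdot>)B, B')\<close>, a linear form on \<open>h\<^sup>*\<close>, as an element of \<open>h\<close>.\<close>

definition dR_form where
  "dR_form q B B' = (THE w. w \<in> h \<and> (\<forall>v\<in>h. K v w = K (dir_deriv h (\<lambda>p. R p B) q v) B'))"

definition dynamical_bracket where
  "dynamical_bracket s s' q =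
     (let Z = fst \<circ> s; B = snd \<circ> s; Z' = fst \<circ> s'; B' = snd \<circ> s'
      in (dir_deriv h Z' q (proj_h (B q)) - dir_deriv h Z q (proj_h (B' q)) - dR_form q (B q) (B' q),
          - dir_deriv h B q (proj_h (B' q)) + dir_deriv h B' q (proj_h (B q))
          - br (R q (B q) + Z q) (B' q) - br (B q) (R q (B' q) + Z' q)))"

text \<open>
  The Lie algebroid \<open>A(X)\<^sup>*\<close> of the coboundary dynamical Poisson groupoid \<open>X = U \<times> G \<times> U\<close>, in the
  trivialization \<open>U \<times> h \<times> g\<^sup>*\<close> of the conormal bundle of the units. The structure induced by the
  Poisson bracket is taken in its explicit form; the dual of the inclusion of \<open>h\<close> in \<open>g\<close> is \<open>proj_h\<close>.
\<close>

definition A_dynamical :: "'n algebroid" where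
  "A_dynamical = \<lparr>tangent = h, base = U, fibre = h \<times> UNIV,
     anchor = (\<lambda>q u. proj_h (snd u)), bracket = dynamical_bracket\<rparr>"

definition \<sigma> ::
  "(complex ^ 'n) \<times> (complex ^ 'n) \<times> (complex ^ 'n) \<Rightarrow> (complex ^ 'n) \<times> (complex ^ 'n) \<times> (complex ^ 'n)" where
  "\<sigma> = (\<lambda>(q, l, \<xi>). (q, - C_sharp q l - proj_h \<xi>, l + inv_into n (\<psi> q) (proj_n \<xi>)))"

end

end

theory Submission
  imports Defs "HOL-Complex_Analysis.Cauchy_Integral_Formula"
begin

text \<open>
  In the coordinates \<open>(\<lambda>, \<xi>)\<close> of the trivial algebroid the claim is that \<open>\<tau>\<close> carries the dynamical
  bracket to the trivial one. Write sections of the dynamical algebroid as \<open>(Z, \<lambda> + n)\<close> and expand in root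
  vectors. Besides derivatives of the sections, the \<open>e \<alpha>\<close>-component of the dynamical bracket contains three
  kinds of terms. The element \<open>C_sharp \<lambda> + Z\<close> of \<open>h\<close> acts through \<open>\<alpha>\<close>; it is minus the \<open>h\<close>-component of \<open>\<xi>\<close>.
  The terms in which \<open>\<phi> \<alpha>\<close> multiplies \<open>\<alpha>(\<lambda>)\<close> account, after multiplication by \<open>\<psi>_coeff \<alpha>\<close>, for the
  derivative of this factor, because the logarithmic derivative of \<open>\<psi>_coeff \<alpha>\<close> in the direction \<open>\<lambda>\<close> is
  \<open>-\<phi> \<alpha>\<close> times \<open>\<alpha>(\<lambda>)\<close> (\<open>\<psi>_coeff_deriv\<close>). The terms that bracket a \<open>\<beta>\<close>- with a \<open>\<gamma>\<close>-component, \<open>\<beta> + \<gamma> = \<alpha>\<close>, carry the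
  weight \<open>\<phi> \<beta> + \<phi> \<gamma>\<close>; the addition theorem for \<open>coth\<close> and its degenerate forms for exponentials turn
  \<open>-\<psi>_coeff \<alpha>\<close> times this weight into \<open>\<psi>_coeff \<beta> \<psi>_coeff \<gamma>\<close> times \<open>1\<close>, \<open>-1\<close> or \<open>0\<close>
  (\<open>\<phi>_\<psi>_addition\<close>), and these three signs are exactly what distinguishes the bracket of \<open>g'\<close> from that of \<open>g\<close>
  (\<open>g'_bracket_coordinates\<close>). In the \<open>h\<close>-component the derivative of \<open>\<phi>\<close> supplies the Cartan part of the
  bracket of \<open>g'\<close>, the derivative of the two-form cancels by closedness, and oddness of \<open>\<phi>\<close> keeps the
  \<open>\<lambda>\<close>-component free of algebraic terms. All this is assembled in \<open>\<tau>_bracket\<close>.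

  Once the brackets correspond, the dynamical algebroid inherits its axioms from the trivial one
  (\<open>algebroid_transport\<close>), so that the Jacobi identity is only needed for the trivial bracket. It
  reduces to two facts. The algebra \<open>g'\<close> satisfies it because it embeds into \<open>g \<oplus> g\<close> (\<open>g'_jacobi\<close>). The
  differential part needs that derivatives of holomorphic sections are again holomorphic and that mixed
  derivatives commute (\<open>holo_dir_deriv\<close>, \<open>dir_deriv_commute\<close>); holomorphy means complex differentiability
  at each point, so this is a theorem, proved by Cauchy's estimates on complex lines.

  Three further points are hidden in the definitions. The semidirect products in \<open>g'\<close> make sense because
  the Killing form is nondegenerate on the span of \<open>\<Gamma>\<close>: it is real and definite on real combinations of
  roots (\<open>kf_nondegenerate_root_span\<close>). The roots fall into three kinds according to the sign of an
  additive degree, the number of simple roots outside \<open>\<Gamma>\<close> (\<open>grading_exists\<close>). And \<open>\<psi>\<close> is finite and invertible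
  on \<open>U\<close>, since at a zero of \<open>sinh\<close> the function \<open>\<phi>\<close> cannot be continuous (\<open>sinh_nonzero\<close>).
\<close>

section \<open>Derivatives of holomorphic functions along a complex subspace\<close>

lemma norm_vector_scale: "norm (c *s v) = cmod c * norm (v :: complex ^ 'n)"
  by (simp add: norm_vec_def norm_mult L2_set_right_distrib)

lemma scaleR_vector_scale: "r *\<^sub>R v = complex_of_real r *s (v :: complex ^ 'n)"
  by (simp add: vec_eq_iff) (simp add: scaleR_conv_of_real)

text \<open>The derivative within \<open>h\<close> chosen by \<open>frechet_derivative\<close> is arbitrary in directions that leave \<open>h\<close>. In
  directions of \<open>h\<close> it is determined: restriction to a real line gives an ordinary derivative.\<close>

lemma dir_deriv_eq:
  fixes f :: "complex ^ 'n \<Rightarrow> 'b::real_normed_vector"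
  assumes h: "vec.subspace h" and q: "q \<in> h" and v: "v \<in> h"
    and D: "(f has_derivative D) (at q within h)"
  shows "dir_deriv h f q v = D v"
proof -
  have eq: "((\<lambda>r. f (q + r *\<^sub>R v)) has_derivative (\<lambda>r. E (r *\<^sub>R v))) (at (0::real))"
    if E: "(f has_derivative E) (at q within h)" for E
  proof -
    have 1: "((\<lambda>r. q + r *\<^sub>R v) has_derivative (\<lambda>r. r *\<^sub>R v)) (at (0::real))"
      by (auto intro!: derivative_eq_intros)
    have sub: "range (\<lambda>r. q + r *\<^sub>R v) \<subseteq> h"
      using h q v by (auto simp: scaleR_vector_scale vec.subspace_add vec.subspace_scale)
    have 2: "(f has_derivative E) (at (q + 0 *\<^sub>R v) within (range (\<lambda>r. q + r *\<^sub>R v)))"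
      using has_derivative_subset[OF E sub] by simp
    show ?thesis by (rule has_derivative_in_compose[OF 1 2])
  qed
  have F: "(f has_derivative frechet_derivative f (at q within h)) (at q within h)"
    using D frechet_derivative_works differentiable_def by blast
  have "(\<lambda>r::real. frechet_derivative f (at q within h) (r *\<^sub>R v)) = (\<lambda>r. D (r *\<^sub>R v))"
    using eq[OF D] eq[OF F] has_derivative_unique by blast
  then have "frechet_derivative f (at q within h) (1 *\<^sub>R v) = D (1 *\<^sub>R v)"
    by (rule fun_cong)
  then show ?thesis by (simp add: dir_deriv_def)
qed

lemma holoD:
  assumes "vec.subspace h" "V \<subseteq> h" "holo h sc V f" "q \<in> V"
  obtains D where "(f has_derivative D) (at q within h)" "\<And>c v. D (c *s v) = sc c (D v)"
    "\<And>v. v \<in> h \<Longrightarrow> dir_deriv h f q v = D v"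
  using assms dir_deriv_eq unfolding holo_def by (metis subset_iff)

lemma holo_line:
  fixes f :: "complex ^ 'n \<Rightarrow> complex"
  assumes h: "vec.subspace h" and V: "V \<subseteq> h" and f: "holo h (*) V f"
    and q: "q \<in> h" and v: "v \<in> h" and t: "q + t *s v \<in> V"
  shows "((\<lambda>t. f (q + t *s v)) has_field_derivative dir_deriv h f (q + t *s v) v) (at t)"
proof -
  obtain D where D: "(f has_derivative D) (at (q + t *s v) within h)"
    and lin: "\<And>c v. D (c *s v) = c * D v" and eq: "dir_deriv h f (q + t *s v) v = D v"
    using holoD[OF h V f t] v by metis
  have bl: "bounded_linear (\<lambda>s. s *s v)"
    by (rule bounded_linear_intro[where K="norm v"])
       (auto simp: vec.scale_left_distrib norm_vector_scale vec_eq_iff)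
  have 1: "((\<lambda>t. q + t *s v) has_derivative (\<lambda>s. s *s v)) (at t)"
    using has_derivative_add[OF has_derivative_const bounded_linear_imp_has_derivative[OF bl]] by simp
  have sub: "range (\<lambda>t. q + t *s v) \<subseteq> h"
    using h q v by (auto simp: vec.subspace_add vec.subspace_scale)
  have "((\<lambda>t. f (q + t *s v)) has_derivative (\<lambda>s. D (s *s v))) (at t)"
    by (rule has_derivative_in_compose[OF 1 has_derivative_subset[OF D sub]])
  then show ?thesis
    by (simp add: has_field_derivative_def lin eq mult_commute_abs)
qed

text \<open>Cauchy's estimate for the second derivative turns a bound for the function into a bound for the
  remainder of the first Taylor polynomial whose constant depends on the function only through its bound.\<close>

lemma taylor_remainder_cauchy:
  fixes \<phi> :: "complex \<Rightarrow> complex"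
  assumes hol: "\<phi> holomorphic_on ball 0 r" and r: "0 < r"
    and M: "\<And>t. t \<in> ball 0 r \<Longrightarrow> cmod (\<phi> t) \<le> M" and t: "cmod t \<le> r / 4"
  shows "cmod (\<phi> t - \<phi> 0 - t * deriv \<phi> 0) \<le> 32 * M / r\<^sup>2 * (cmod t)\<^sup>2"
proof -
  \<comment> \<open>Discs of radius \<open>r / 4\<close> around these points stay in the domain, whence the constant \<open>2 * 4\<^sup>2\<close>.\<close>
  have bound: "cmod ((deriv ^^ 2) \<phi> z) \<le> 32 * M / r\<^sup>2" if z: "z \<in> cball 0 (r / 4)" for z
  proof -
    have sub: "cball z (r / 4) \<subseteq> ball 0 r"
    proof
      fix y assume "y \<in> cball z (r / 4)"
      then have "cmod (z - y) \<le> r / 4" "cmod z \<le> r / 4" using z by (auto simp: dist_norm)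
      then show "y \<in> ball 0 r"
        using r norm_triangle_ineq2[of y z] by (simp add: norm_minus_commute)
    qed
    have "cmod ((deriv ^^ 2) \<phi> z) \<le> fact 2 * M / (r / 4) ^ 2"
    proof (rule Cauchy_inequality)
      show "\<phi> holomorphic_on ball z (r / 4)"
        using hol sub ball_subset_cball holomorphic_on_subset by blast
      show "continuous_on (cball z (r / 4)) \<phi>"
        using hol sub holomorphic_on_imp_continuous_on holomorphic_on_subset by blast
      show "cmod (\<phi> y) \<le> M" if "cmod (z - y) = r / 4" for y
        using that sub M[of y] by (auto simp: dist_norm)
    qed (use r in auto)
    then show ?thesis by (simp add: power2_eq_square field_simps)
  qed
  have sub: "cball 0 (r / 4) \<subseteq> ball 0 r" using r by auto
  have "cmod ((\<lambda>i. (deriv ^^ i) \<phi>) 0 t - (\<Sum>i\<le>1. (\<lambda>i. (deriv ^^ i) \<phi>) i 0 * (t - 0) ^ i / fact i))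
      \<le> 32 * M / r\<^sup>2 * cmod (t - 0) ^ Suc 1 / fact 1"
  proof (rule complex_Taylor)
    show "convex (cball 0 (r / 4) :: complex set)" by simp
    fix i :: nat and z :: complex assume z: "z \<in> cball 0 (r / 4)"
    have "(deriv ^^ i) \<phi> holomorphic_on ball 0 r"
      by (rule holomorphic_higher_deriv[OF hol open_ball])
    then have "((deriv ^^ i) \<phi> has_field_derivative (deriv ^^ Suc i) \<phi> z) (at z)"
      using holomorphic_derivI[OF _ open_ball, of _ 0 r z UNIV] z sub by (simp only: funpow.simps o_apply) blast
    then show "((deriv ^^ i) \<phi> has_field_derivative (deriv ^^ Suc i) \<phi> z) (at z within cball 0 (r / 4))"
      by (rule has_field_derivative_at_within)
  next
    fix z :: complex assume "z \<in> cball 0 (r / 4)"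
    then show "cmod ((deriv ^^ Suc 1) \<phi> z) \<le> 32 * M / r\<^sup>2"
      using bound by (simp add: numeral_2_eq_2)
  qed (use r t in auto)
  moreover have "(\<lambda>i. (deriv ^^ i) \<phi>) 0 t - (\<Sum>i\<le>1. (\<lambda>i. (deriv ^^ i) \<phi>) i 0 * (t - 0) ^ i / fact i)
    = \<phi> t - \<phi> 0 - t * deriv \<phi> 0" by (simp add: algebra_simps)
  ultimately show ?thesis by (simp add: power2_eq_square algebra_simps)
qed

lemma holo_locally_bounded:
  assumes h: "vec.subspace h" and V: "openin (top_of_set h) V" and f: "holo h (*) V f" and q: "q \<in> V"
  obtains r M where "0 < r" "ball q r \<inter> h \<subseteq> V" "\<And>p. p \<in> ball q r \<inter> h \<Longrightarrow> cmod (f p) \<le> M" "0 \<le> M"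
proof -
  have "continuous (at q within h) f"
    using f q has_derivative_continuous unfolding holo_def by blast
  then obtain d where d: "0 < d" "\<And>p. p \<in> h \<Longrightarrow> dist p q < d \<Longrightarrow> dist (f p) (f q) < 1"
    unfolding continuous_within_eps_delta by (metis zero_less_one)
  obtain r0 where r0: "0 < r0" "ball q r0 \<inter> h \<subseteq> V"
    using V q unfolding openin_contains_ball by (auto simp: Int_commute)
  show ?thesis
  proof
    show "0 < min d r0" using d r0 by simp
    show "ball q (min d r0) \<inter> h \<subseteq> V" using r0 by auto
    show "cmod (f p) \<le> cmod (f q) + 1" if "p \<in> ball q (min d r0) \<inter> h" for p
      using d(2)[of p] that norm_triangle_ineq2[of "f p" "f q"] by (auto simp: dist_norm norm_minus_commute)
    show "0 \<le> cmod (f q) + 1" by simp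
  qed
qed

lemma line_in_ball:
  fixes v :: "complex ^ 'n"
  assumes h: "vec.subspace h" and p: "p \<in> ball q (r / 2) \<inter> h" and v: "v \<in> h"
    and t: "t \<in> ball 0 (r / (2 * (1 + norm v)))"
  shows "p + t *s v \<in> ball q r \<inter> h"
proof
  have "cmod t * norm v \<le> cmod t * (1 + norm v)" by (simp add: distrib_left)
  also have "\<dots> < r / 2"
    using t by (simp add: field_simps add_pos_nonneg)
  finally have "norm (t *s v) < r / 2" by (simp add: norm_vector_scale)
  then show "p + t *s v \<in> ball q r"
    using p norm_triangle_ineq[of "p - q" "t *s v"] by (simp add: dist_norm norm_minus_commute algebra_simps)
  show "p + t *s v \<in> h" using h p v by (auto simp: vec.subspace_add vec.subspace_scale)
qed

text \<open>Lines through points near \<open>q\<close> stay, for small parameters, in one ball on which \<open>f\<close> is bounded, so the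
  one-variable estimates on them hold with common constants. The last one makes difference quotients
  converge uniformly near \<open>q\<close>.\<close>

lemma difference_quotient_estimate:
  fixes f :: "complex ^ 'n \<Rightarrow> complex"
  assumes h: "vec.subspace h" and V: "openin (top_of_set h) V" and f: "holo h (*) V f" and q: "q \<in> V"
    and v: "v \<in> h"
  obtains r \<rho> c where "0 < r" "0 < \<rho>" "0 \<le> c" "ball q r \<inter> h \<subseteq> V"
    "\<And>p. p \<in> ball q (r / 2) \<inter> h \<Longrightarrow> cmod (dir_deriv h f p v) \<le> c"
    "\<And>p t. p \<in> ball q (r / 2) \<inter> h \<Longrightarrow> cmod t \<le> \<rho> \<Longrightarrow> p + t *s v \<in> V"
    "\<And>p t. p \<in> ball q (r / 2) \<inter> h \<Longrightarrow> cmod t \<le> \<rho> \<Longrightarrow>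
       cmod (f (p + t *s v) - f p - t * dir_deriv h f p v) \<le> c * (cmod t)\<^sup>2"
proof -
  have Vh: "V \<subseteq> h" using V openin_imp_subset by blast
  obtain r M where r: "0 < r" "ball q r \<inter> h \<subseteq> V" and M: "\<And>p. p \<in> ball q r \<inter> h \<Longrightarrow> cmod (f p) \<le> M" "0 \<le> M"
    using holo_locally_bounded[OF h V f q] by metis
  define R where "R = r / (2 * (1 + norm v))"
  have R: "0 < R" unfolding R_def using r by (simp add: add_pos_nonneg)
  define c where "c = max (M / (R / 2)) (32 * M / R\<^sup>2)"
  have main: "cmod (dir_deriv h f p v) \<le> M / (R / 2)"
    "cmod t \<le> R / 4 \<Longrightarrow> p + t *s v \<in> V"
    "cmod t \<le> R / 4 \<Longrightarrow> cmod (f (p + t *s v) - f p - t * dir_deriv h f p v) \<le> 32 * M / R\<^sup>2 * (cmod t)\<^sup>2"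
    if p: "p \<in> ball q (r / 2) \<inter> h" for p t
  proof -
    let ?\<phi> = "\<lambda>t. f (p + t *s v)"
    have inb: "p + t *s v \<in> ball q r \<inter> h" if "t \<in> ball 0 R" for t
      using line_in_ball[OF h p v] that unfolding R_def by blast
    have der: "(?\<phi> has_field_derivative dir_deriv h f (p + t *s v) v) (at t)" if "t \<in> ball 0 R" for t
      using holo_line[OF h Vh f _ v, of p t] p inb[OF that] r(2) by blast
    have hol: "?\<phi> holomorphic_on ball 0 R"
    proof (rule holomorphic_onI)
      show "?\<phi> field_differentiable at t within ball 0 R" if "t \<in> ball 0 R" for t
        using der[OF that] field_differentiable_at_within field_differentiable_def by blast
    qed
    have d0: "deriv ?\<phi> 0 = dir_deriv h f p v"
      using DERIV_imp_deriv[OF der[of 0]] R by simp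
    have bd: "cmod (?\<phi> t) \<le> M" if "t \<in> ball 0 R" for t using inb[OF that] M(1) by blast
    have "cmod ((deriv ^^ 1) ?\<phi> 0) \<le> fact 1 * M / (R / 2) ^ 1"
    proof (rule Cauchy_inequality)
      show "?\<phi> holomorphic_on ball 0 (R / 2)"
        using hol R by (auto intro: holomorphic_on_subset)
      have "cball 0 (R / 2) \<subseteq> ball (0::complex) R" using R by auto
      then show "continuous_on (cball 0 (R / 2)) ?\<phi>"
        using hol holomorphic_on_imp_continuous_on holomorphic_on_subset by blast
      show "cmod (?\<phi> t) \<le> M" if "cmod (0 - t) = R / 2" for t using bd[of t] that R by simp
    qed (use R in auto)
    then show "cmod (dir_deriv h f p v) \<le> M / (R / 2)" using d0 by simp
    show "p + t *s v \<in> V" if "cmod t \<le> R / 4" using inb[of t] that R r(2) by auto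
    show "cmod (f (p + t *s v) - f p - t * dir_deriv h f p v) \<le> 32 * M / R\<^sup>2 * (cmod t)\<^sup>2"
      if "cmod t \<le> R / 4"
      using taylor_remainder_cauchy[OF hol R bd that] d0 by simp
  qed
  show ?thesis
  proof
    show "0 < r" "0 < R / 4" "ball q r \<inter> h \<subseteq> V" using r R by auto
    show "0 \<le> c" unfolding c_def using M R by (simp add: le_max_iff_disj)
    show "cmod (dir_deriv h f p v) \<le> c" if "p \<in> ball q (r / 2) \<inter> h" for p
      using main(1)[OF that] unfolding c_def by simp
    show "p + t *s v \<in> V" if "p \<in> ball q (r / 2) \<inter> h" "cmod t \<le> R / 4" for p t
      using main(2)[OF that] .
    show "cmod (f (p + t *s v) - f p - t * dir_deriv h f p v) \<le> c * (cmod t)\<^sup>2"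
      if "p \<in> ball q (r / 2) \<inter> h" "cmod t \<le> R / 4" for p t
      using main(3)[OF that] mult_right_mono[of "32 * M / R\<^sup>2" c "(cmod t)\<^sup>2"] unfolding c_def by auto
  qed
qed

text \<open>A locally uniform limit of holomorphic functions is holomorphic, with the limit of the derivatives
  as its derivative. For the difference quotients of \<open>f\<close> in the direction \<open>v\<close>, restricted to a line in
  the direction \<open>w\<close>, the derivatives are difference quotients of \<open>dir_deriv h f _ w\<close> in the direction \<open>v\<close>.\<close>

lemma mixed_derivative_exists:
  fixes f :: "complex ^ 'n \<Rightarrow> complex"
  assumes h: "vec.subspace h" and V: "openin (top_of_set h) V" and f: "holo h (*) V f" and q: "q \<in> V"
    and v: "v \<in> h" and w: "w \<in> h"
  obtains H \<kappa> where "((\<lambda>t. dir_deriv h f (q + t *s w) v) has_field_derivative H) (at 0)"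
    "filterlim \<kappa> (at 0) sequentially"
    "(\<lambda>m. (dir_deriv h f (q + \<kappa> m *s v) w - dir_deriv h f q w) / \<kappa> m) \<longlonglongrightarrow> H"
proof -
  have Vh: "V \<subseteq> h" using V openin_imp_subset by blast
  have qh: "q \<in> h" using q Vh by blast
  obtain r \<rho> c where r: "0 < r" "0 < \<rho>" "0 \<le> c" "ball q r \<inter> h \<subseteq> V"
    and inV: "\<And>p t. p \<in> ball q (r / 2) \<inter> h \<Longrightarrow> cmod t \<le> \<rho> \<Longrightarrow> p + t *s v \<in> V"
    and est: "\<And>p t. p \<in> ball q (r / 2) \<inter> h \<Longrightarrow> cmod t \<le> \<rho> \<Longrightarrow>
       cmod (f (p + t *s v) - f p - t * dir_deriv h f p v) \<le> c * (cmod t)\<^sup>2"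
    using difference_quotient_estimate[OF h V f q v] by metis
  \<comment> \<open>The steps of the difference quotients are \<open>1 / (m + N)\<close>, so that none of them leaves \<open>V\<close>.\<close>
  obtain N where N: "0 < N" "inverse (real N) < \<rho>"
    using r(2) ex_inverse_of_nat_less by blast
  define \<kappa> :: "nat \<Rightarrow> complex" where "\<kappa> m = of_real (inverse (real (m + N)))" for m
  have \<kappa>0: "\<kappa> m \<noteq> 0" for m using N by (simp only: \<kappa>_def of_real_eq_0_iff) simp
  have \<kappa>n: "cmod (\<kappa> m) \<le> \<rho>" for m
  proof -
    have "inverse (real (m + N)) \<le> inverse (real N)" using N by (intro le_imp_inverse_le) auto
    then show ?thesis using N by (simp only: \<kappa>_def norm_of_real abs_of_nonneg inverse_nonnegative_iff_nonnegative of_nat_0_le_iff)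
  qed
  have "(\<lambda>m. inverse (real (m + N))) \<longlonglongrightarrow> 0"
    by (rule LIMSEQ_ignore_initial_segment[OF lim_inverse_n])
  then have "(\<lambda>m. complex_of_real (inverse (real (m + N)))) \<longlonglongrightarrow> complex_of_real 0"
    by (rule tendsto_of_real)
  then have \<kappa>lim: "\<kappa> \<longlonglongrightarrow> 0" unfolding \<kappa>_def by (simp only: of_real_0)
  define \<delta> where "\<delta> = r / 2 / (2 * (1 + norm w))"
  have \<delta>: "0 < \<delta>" unfolding \<delta>_def using r by (simp add: add_pos_nonneg)
  have pin: "q + t *s w \<in> ball q (r / 2) \<inter> h" if "t \<in> ball 0 \<delta>" for t
    using line_in_ball[OF h, of q q "r / 2" w t] qh w r that unfolding \<delta>_def by auto
  define F where "F = (\<lambda>m t. (f (q + t *s w + \<kappa> m *s v) - f (q + t *s w)) / \<kappa> m)"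
  define F' where "F' = (\<lambda>m t. (dir_deriv h f (q + t *s w + \<kappa> m *s v) w - dir_deriv h f (q + t *s w) w) / \<kappa> m)"
  have der: "(F m has_field_derivative F' m t) (at t)" if t: "t \<in> ball 0 \<delta>" for m t
  proof -
    have 1: "((\<lambda>t. f (q + t *s w)) has_field_derivative dir_deriv h f (q + t *s w) w) (at t)"
      using holo_line[OF h Vh f qh w, of t] inV[OF pin[OF t], of 0] r by simp
    have "q + \<kappa> m *s v \<in> h" using h qh v by (auto simp: vec.subspace_add vec.subspace_scale)
    moreover have "q + \<kappa> m *s v + t *s w \<in> V" using inV[OF pin[OF t] \<kappa>n[of m]] by (simp add: algebra_simps)
    ultimately have 2: "((\<lambda>t. f (q + \<kappa> m *s v + t *s w)) has_field_derivative
        dir_deriv h f (q + \<kappa> m *s v + t *s w) w) (at t)"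
      using holo_line[OF h Vh f _ w] by blast
    show ?thesis unfolding F_def F'_def
      using DERIV_cdivide[OF DERIV_diff[OF 2 1], of "\<kappa> m"] by (simp add: algebra_simps)
  qed
  have Fest: "dist (F m t) (dir_deriv h f (q + t *s w) v) \<le> c * cmod (\<kappa> m)" if t: "t \<in> ball 0 \<delta>" for m t
  proof -
    have "F m t - dir_deriv h f (q + t *s w) v
      = (f (q + t *s w + \<kappa> m *s v) - f (q + t *s w) - \<kappa> m * dir_deriv h f (q + t *s w) v) / \<kappa> m"
      using \<kappa>0 by (simp add: F_def diff_divide_distrib)
    then have "dist (F m t) (dir_deriv h f (q + t *s w) v) \<le> c * (cmod (\<kappa> m))\<^sup>2 / cmod (\<kappa> m)"
      using est[OF pin[OF t] \<kappa>n[of m]] by (simp add: dist_norm norm_divide divide_right_mono)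
    then show ?thesis using \<kappa>0[of m] by (simp add: power2_eq_square)
  qed
  have unif: "uniform_limit (ball 0 \<delta>) F (\<lambda>t. dir_deriv h f (q + t *s w) v) sequentially"
  proof (rule uniform_limitI)
    fix e :: real assume e: "0 < e"
    have "(\<lambda>m. c * cmod (\<kappa> m)) \<longlonglongrightarrow> c * 0"
      using \<kappa>lim by (intro tendsto_mult tendsto_const) (simp add: tendsto_norm_zero)
    then have "\<forall>\<^sub>F m in sequentially. c * cmod (\<kappa> m) < e"
      using e by (intro order_tendstoD(2)) auto
    then show "\<forall>\<^sub>F m in sequentially. \<forall>t\<in>ball 0 \<delta>. dist (F m t) (dir_deriv h f (q + t *s w) v) < e"
      by eventually_elim (use Fest le_less_trans in blast)
  qed
  have "\<exists>g'. \<forall>t\<in>ball 0 \<delta>. ((\<lambda>t. dir_deriv h f (q + t *s w) v) has_field_derivative g' t) (at t)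
      \<and> (\<lambda>m. F' m t) \<longlonglongrightarrow> g' t"
  proof (rule has_complex_derivative_uniform_sequence[OF open_ball der])
    fix t :: complex assume "t \<in> ball 0 \<delta>"
    then obtain d where "0 < d" "cball t d \<subseteq> ball 0 \<delta>"
      using open_contains_cball open_ball by blast
    then show "\<exists>d>0. cball t d \<subseteq> ball 0 \<delta> \<and>
        uniform_limit (cball t d) F (\<lambda>t. dir_deriv h f (q + t *s w) v) sequentially"
      using uniform_limit_on_subset[OF unif] by blast
  qed
  then obtain g' where g': "\<forall>t\<in>ball 0 \<delta>. ((\<lambda>t. dir_deriv h f (q + t *s w) v) has_field_derivative g' t) (at t)
      \<and> (\<lambda>m. F' m t) \<longlonglongrightarrow> g' t" by blast
  have "((\<lambda>t. dir_deriv h f (q + t *s w) v) has_field_derivative g' 0) (at 0)"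
    "(\<lambda>m. F' m 0) \<longlonglongrightarrow> g' 0" using bspec[OF g', of 0] \<delta> by simp_all
  moreover have "filterlim \<kappa> (at 0) sequentially" using \<kappa>0 \<kappa>lim by (simp add: filterlim_at)
  ultimately show ?thesis using that[of "g' 0" \<kappa>] by (simp add: F'_def)
qed

text \<open>The limit of difference quotients found above is itself a derivative, with the two directions exchanged.\<close>

lemma mixed_derivative_symmetric:
  fixes f :: "complex ^ 'n \<Rightarrow> complex"
  assumes h: "vec.subspace h" and V: "openin (top_of_set h) V" and f: "holo h (*) V f" and q: "q \<in> V"
    and v: "v \<in> h" and w: "w \<in> h"
  obtains H where "((\<lambda>t. dir_deriv h f (q + t *s w) v) has_field_derivative H) (at 0)"
    "((\<lambda>t. dir_deriv h f (q + t *s v) w) has_field_derivative H) (at 0)"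
proof -
  obtain H \<kappa> where H: "((\<lambda>t. dir_deriv h f (q + t *s w) v) has_field_derivative H) (at 0)"
    and \<kappa>: "filterlim \<kappa> (at 0) sequentially"
    and lim: "(\<lambda>m. (dir_deriv h f (q + \<kappa> m *s v) w - dir_deriv h f q w) / \<kappa> m) \<longlonglongrightarrow> H"
    by (rule mixed_derivative_exists[OF h V f q v w])
  obtain H' where H': "((\<lambda>t. dir_deriv h f (q + t *s v) w) has_field_derivative H') (at 0)"
    by (rule mixed_derivative_exists[OF h V f q w v])
  have "((\<lambda>t. (dir_deriv h f (q + t *s v) w - dir_deriv h f q w) / t) \<longlongrightarrow> H') (at 0)"
    using H' by (simp add: DERIV_def)
  then have "(\<lambda>m. (dir_deriv h f (q + \<kappa> m *s v) w - dir_deriv h f q w) / \<kappa> m) \<longlonglongrightarrow> H'"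
    using \<kappa> by (rule filterlim_compose)
  then have "H' = H" using lim LIMSEQ_unique by blast
  then show ?thesis using that H H' by blast
qed

lemma linear_imp_bounded_linear:
  fixes L :: "complex ^ 'n \<Rightarrow> 'b::real_normed_vector"
  assumes "\<And>u v. L (u + v) = L u + L v" "\<And>r v. L (complex_of_real r *s v) = r *\<^sub>R L v"
  shows "bounded_linear L"
proof -
  have "linear L" by (rule linearI) (simp_all add: assms scaleR_vector_scale)
  then show ?thesis by (simp add: linear_conv_bounded_linear)
qed

text \<open>Complex differentiability once implies complex differentiability of all directional derivatives:
  a directional derivative is locally bounded and holomorphic on lines, and its derivative depends linearly
  on the direction because mixed derivatives commute.\<close>

theorem holo_dir_deriv:
  fixes f :: "complex ^ 'n \<Rightarrow> complex"
  assumes h: "vec.subspace h" and V: "openin (top_of_set h) V" and f: "holo h (*) V f" and v: "v \<in> h"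
  shows "holo h (*) V (\<lambda>p. dir_deriv h f p v)"
  unfolding holo_def
proof
  fix q assume q: "q \<in> V"
  have Vh: "V \<subseteq> h" using V openin_imp_subset by blast
  have qh: "q \<in> h" using q Vh by blast
  let ?g = "\<lambda>p. dir_deriv h f p v"
  obtain P where P: "range P \<subseteq> h" "Vector_Spaces.linear (*s) (*s) P" "\<And>u. u \<in> h \<Longrightarrow> P u = u"
    using vec.linear_exists_left_inverse_on[OF vec.linear_id h] by auto
  interpret P: Vector_Spaces.linear "(*s)" "(*s)" P by fact
  define H where "H w = deriv (\<lambda>t. ?g (q + t *s w)) 0" for w
  have H: "((\<lambda>t. ?g (q + t *s w)) has_field_derivative H w) (at 0)"
    "((\<lambda>t. dir_deriv h f (q + t *s v) w) has_field_derivative H w) (at 0)" if w: "w \<in> h" for w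
    proof -
    obtain H' where "((\<lambda>t. ?g (q + t *s w)) has_field_derivative H') (at 0)"
      "((\<lambda>t. dir_deriv h f (q + t *s v) w) has_field_derivative H') (at 0)"
      by (rule mixed_derivative_symmetric[OF h V f q v w])
    moreover from this(1) have "H w = H'" unfolding H_def by (rule DERIV_imp_deriv)
    ultimately show "((\<lambda>t. ?g (q + t *s w)) has_field_derivative H w) (at 0)"
      "((\<lambda>t. dir_deriv h f (q + t *s v) w) has_field_derivative H w) (at 0)" by simp_all
  qed
  obtain \<rho> where \<rho>: "0 < \<rho>" "\<And>t. cmod t \<le> \<rho> \<Longrightarrow> q + t *s v \<in> V"
  proof (rule difference_quotient_estimate[OF h V f q v])
    fix r \<rho> c assume a: "(0::real) < r" "0 < \<rho>" "\<And>p t. p \<in> ball q (r / 2) \<inter> h \<Longrightarrow> cmod t \<le> \<rho> \<Longrightarrow> p + t *s v \<in> V"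
    show ?thesis by (rule that[OF a(2)], rule a(3)) (use a qh in auto)
  qed
  have ev: "\<forall>\<^sub>F t in nhds (0::complex). q + t *s v \<in> V"
    unfolding eventually_nhds_metric using \<rho> by (intro exI[of _ \<rho>]) auto
  have addH: "H (a *s u + b *s w) = a * H u + b * H w" if u: "u \<in> h" and w: "w \<in> h" for a b u w
  proof -
    have uw: "a *s u + b *s w \<in> h" using h u w by (simp add: vec.subspace_add vec.subspace_scale)
    have lin: "dir_deriv h f p (a *s u + b *s w) = a * dir_deriv h f p u + b * dir_deriv h f p w" if pV: "p \<in> V" for p
    proof -
      obtain D where D: "(f has_derivative D) (at p within h)" "\<And>c v. D (c *s v) = c * D v"
        "\<And>v. v \<in> h \<Longrightarrow> dir_deriv h f p v = D v"
        using holoD[OF h Vh f pV] by metis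
      interpret D: bounded_linear D using D(1) has_derivative_bounded_linear by blast
      show ?thesis using D uw u w by (simp add: D.add)
    qed
    have "((\<lambda>t. a * dir_deriv h f (q + t *s v) u + b * dir_deriv h f (q + t *s v) w)
        has_field_derivative a * H u + b * H w) (at 0)"
      by (intro DERIV_add DERIV_cmult H(2) u w)
    moreover have "\<forall>\<^sub>F t in nhds 0. dir_deriv h f (q + t *s v) (a *s u + b *s w)
        = a * dir_deriv h f (q + t *s v) u + b * dir_deriv h f (q + t *s v) w"
      using ev by eventually_elim (rule lin)
    ultimately have "((\<lambda>t. dir_deriv h f (q + t *s v) (a *s u + b *s w))
        has_field_derivative a * H u + b * H w) (at 0)"
      using DERIV_cong_ev[OF refl _ refl] by fastforce
    then show ?thesis using H(2)[OF uw] DERIV_unique by blast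
  qed
  define D where "D w = H (P w)" for w
  have D1: "D (u + w) = D u + D w" for u w
    using addH[of "P u" "P w" 1 1] P(1) by (auto simp: D_def P.add)
  have D2: "D (c *s w) = c * D w" for c w
    using addH[of "P w" "P w" c 0] P(1) by (auto simp: D_def P.scale)
  have bl: "bounded_linear D"
    by (rule linear_imp_bounded_linear) (auto simp: D1 D2 scaleR_conv_of_real)
  obtain r c where r: "0 < r" "0 \<le> c" "ball q r \<inter> h \<subseteq> V"
    and bd: "\<And>p. p \<in> ball q r \<inter> h \<Longrightarrow> cmod (?g p) \<le> c"
  proof (rule difference_quotient_estimate[OF h V f q v])
    fix r \<rho> c assume a: "(0::real) < r" "0 \<le> c" "ball q r \<inter> h \<subseteq> V"
      "\<And>p. p \<in> ball q (r / 2) \<inter> h \<Longrightarrow> cmod (dir_deriv h f p v) \<le> c"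
    show ?thesis
      by (rule that[of "r / 2" c]) (use a in auto)
  qed
  have rem: "cmod (?g (q + w) - ?g q - D w) \<le> 32 * c / r\<^sup>2 * (norm w)\<^sup>2" if w: "w \<in> h" and small: "norm w \<le> r / 4" for w
  proof (cases "w = 0")
    case True then show ?thesis using D2[of 0 0] by simp
  next
    case False
    define R where "R = r / norm w"
    have R: "0 < R" "1 \<le> R / 4" using r False small by (auto simp: R_def field_simps)
    have inb: "q + t *s w \<in> ball q r \<inter> h" if "t \<in> ball 0 R" for t
      using that False h qh w
      by (auto simp: dist_norm norm_vector_scale R_def field_simps vec.subspace_add vec.subspace_scale)
    have "(\<lambda>t. ?g (q + t *s w)) holomorphic_on ball 0 R"
    proof (rule holomorphic_onI)
      fix t :: complex assume t: "t \<in> ball 0 R"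
      obtain H' where "((\<lambda>s. ?g ((q + t *s w) + s *s w)) has_field_derivative H') (at 0)"
        using mixed_derivative_symmetric[OF h V f _ v w, of "q + t *s w"] inb[OF t] r by blast
      then have "((\<lambda>s. ?g (q + s *s w)) has_field_derivative H') (at (0 + t))"
        by (subst DERIV_shift) (simp add: algebra_simps vec.scale_left_distrib)
      then have "(\<lambda>t. ?g (q + t *s w)) field_differentiable at t"
        by (auto simp: field_differentiable_def)
      then show "(\<lambda>t. ?g (q + t *s w)) field_differentiable at t within ball 0 R"
        by (rule field_differentiable_at_within)
    qed
    from taylor_remainder_cauchy[OF this R(1), of c 1] bd inb R(2)
    have "cmod (?g (q + w) - ?g q - H w) \<le> 32 * c / R\<^sup>2" by (simp add: H_def)
    moreover have "D w = H w" using P(3)[OF w] by (simp add: D_def)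
    ultimately show ?thesis using False r by (simp add: R_def field_simps)
  qed
  have "(?g has_derivative D) (at q within h)"
    unfolding has_derivative_within_alt2
  proof (intro conjI allI impI bl)
    fix e :: real assume e: "0 < e"
    define k where "k = 32 * c / r\<^sup>2"
    have k: "0 \<le> k" using r by (simp add: k_def)
    define d where "d = min (r / 4) (e / (k + 1))"
    have d: "0 < d" using r e k by (simp add: d_def)
    have "cmod (?g y - ?g q - D (y - q)) \<le> e * norm (y - q)" if y: "y \<in> h" "dist y q < d" for y
    proof -
      have yq: "y - q \<in> h" using h y qh by (simp add: vec.subspace_diff)
      have n: "norm (y - q) \<le> r / 4" "norm (y - q) \<le> e / (k + 1)"
        using y(2) by (auto simp: d_def dist_norm)
      have "cmod (?g y - ?g q - D (y - q)) \<le> k * (norm (y - q))\<^sup>2"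
        using rem[OF yq n(1)] by (simp add: k_def)
      also have "\<dots> = (k * norm (y - q)) * norm (y - q)" by (simp add: power2_eq_square)
      also have "k * norm (y - q) \<le> k * (e / (k + 1))" using n k by (intro mult_left_mono)
      also have "k * (e / (k + 1)) \<le> e" using k e by (simp add: field_simps)
      finally show ?thesis by (simp add: mult_right_mono)
    qed
    then show "\<forall>\<^sub>F y in at q within h. cmod (?g y - ?g q - D (y - q)) \<le> e * norm (y - q)"
      unfolding eventually_at using d by blast
  qed
  then show "\<exists>D. (?g has_derivative D) (at q within h) \<and> (\<forall>c v. D (c *s v) = c * D v)"
    using D2 by blast
qed

theorem dir_deriv_commute:
  fixes f :: "complex ^ 'n \<Rightarrow> complex"
  assumes h: "vec.subspace h" and V: "openin (top_of_set h) V" and f: "holo h (*) V f" and q: "q \<in> V"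
    and v: "v \<in> h" and w: "w \<in> h"
  shows "dir_deriv h (\<lambda>p. dir_deriv h f p v) q w = dir_deriv h (\<lambda>p. dir_deriv h f p w) q v"
proof -
  have Vh: "V \<subseteq> h" using V openin_imp_subset by blast
  have 1: "((\<lambda>t. dir_deriv h f (q + t *s w) v) has_field_derivative
      dir_deriv h (\<lambda>p. dir_deriv h f p v) q w) (at 0)"
    using holo_line[OF h Vh holo_dir_deriv[OF h V f v] _ w, of q 0] q Vh by auto
  have 2: "((\<lambda>t. dir_deriv h f (q + t *s v) w) has_field_derivative
      dir_deriv h (\<lambda>p. dir_deriv h f p w) q v) (at 0)"
    using holo_line[OF h Vh holo_dir_deriv[OF h V f w] _ v, of q 0] q Vh by auto
  obtain H where "((\<lambda>t. dir_deriv h f (q + t *s w) v) has_field_derivative H) (at 0)"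
    "((\<lambda>t. dir_deriv h f (q + t *s v) w) has_field_derivative H) (at 0)"
    by (rule mixed_derivative_symmetric[OF h V f q v w])
  with 1 2 show ?thesis using DERIV_unique by blast
qed

section \<open>Differential calculus for holomorphic maps\<close>

lemma has_derivative_cong_openin:
  assumes V: "openin (top_of_set h) V" and q: "q \<in> V" and eq: "\<And>p. p \<in> V \<Longrightarrow> f p = g p"
  shows "(f has_derivative D) (at q within h) \<longleftrightarrow> (g has_derivative D) (at q within h)"
proof -
  obtain T where T: "open T" "V = h \<inter> T" using V by (auto simp: openin_open)
  have ev: "\<forall>\<^sub>F p in at q within h. f p = g p"
    unfolding eventually_at_topological using T q eq by auto
  then have ev': "\<forall>\<^sub>F p in at q within h. g p = f p" by (simp add: eq_commute)
  have "f q = g q" "q \<in> h" using q T eq by auto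
  then show ?thesis
    using has_derivative_transform_eventually[OF _ ev] has_derivative_transform_eventually[OF _ ev'] by metis
qed

lemma dir_deriv_cong:
  assumes "openin (top_of_set h) V" "q \<in> V" "\<And>p. p \<in> V \<Longrightarrow> f p = g p"
  shows "dir_deriv h f q v = dir_deriv h g q v"
  using has_derivative_cong_openin[OF assms] by (simp add: dir_deriv_def frechet_derivative_def)

lemma holo_cong:
  assumes "openin (top_of_set h) V" "\<And>p. p \<in> V \<Longrightarrow> f p = g p"
  shows "holo h sc V f \<longleftrightarrow> holo h sc V g"
  using has_derivative_cong_openin[where f=f and g=g, OF assms(1) _ assms(2)] by (simp add: holo_def)

text \<open>The scalar multiplications are arguments so that the same product rule serves scalar functions, vector
  fields and brackets.\<close>

lemma holo_bilinear:
  assumes h: "vec.subspace h" and V: "V \<subseteq> h" and b: "bounded_bilinear b"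
    and sc: "\<And>c u v. b (sc1 c u) v = sc3 c (b u v)" "\<And>c u v. b u (sc2 c v) = sc3 c (b u v)"
      "\<And>c u v. sc3 c (u + v) = sc3 c u + sc3 c v"
    and f: "holo h sc1 V f" and g: "holo h sc2 V g"
  shows "holo h sc3 V (\<lambda>p. b (f p) (g p))" (is ?A)
    and "\<And>q v. q \<in> V \<Longrightarrow> v \<in> h \<Longrightarrow> dir_deriv h (\<lambda>p. b (f p) (g p)) q v
      = b (f q) (dir_deriv h g q v) + b (dir_deriv h f q v) (g q)" (is "\<And>q v. _ \<Longrightarrow> _ \<Longrightarrow> ?B q v")
proof -
  have *: "\<exists>D. ((\<lambda>p. b (f p) (g p)) has_derivative D) (at q within h) \<and> (\<forall>c v. D (c *s v) = sc3 c (D v))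
    \<and> (\<forall>v\<in>h. ?B q v)" if q: "q \<in> V" for q
  proof -
    obtain F where F: "(f has_derivative F) (at q within h)" "\<And>c v. F (c *s v) = sc1 c (F v)"
      "\<And>v. v \<in> h \<Longrightarrow> dir_deriv h f q v = F v" by (rule holoD[OF h V f q]) blast
    obtain G where G: "(g has_derivative G) (at q within h)" "\<And>c v. G (c *s v) = sc2 c (G v)"
      "\<And>v. v \<in> h \<Longrightarrow> dir_deriv h g q v = G v" by (rule holoD[OF h V g q]) blast
    have D: "((\<lambda>p. b (f p) (g p)) has_derivative (\<lambda>v. b (f q) (G v) + b (F v) (g q))) (at q within h)"
      by (rule bounded_bilinear.FDERIV[OF b F(1) G(1)])
    have "?B q v" if "v \<in> h" for v
      using dir_deriv_eq[OF h _ that D] q V F(3)[OF that] G(3)[OF that] by auto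
    then show ?thesis using D F(2) G(2) sc by (intro exI[of _ "\<lambda>v. b (f q) (G v) + b (F v) (g q)"]) simp
  qed
  show ?A unfolding holo_def using * by blast
  show "?B q v" if "q \<in> V" "v \<in> h" for q v using * that by blast
qed

lemma holo_linear:
  assumes h: "vec.subspace h" and V: "V \<subseteq> h" and L: "bounded_linear L"
    and sc: "\<And>c u. L (sc1 c u) = sc2 c (L u)" and f: "holo h sc1 V f"
  shows "holo h sc2 V (\<lambda>p. L (f p))" (is ?A)
    and "\<And>q v. q \<in> V \<Longrightarrow> v \<in> h \<Longrightarrow> dir_deriv h (\<lambda>p. L (f p)) q v = L (dir_deriv h f q v)"
      (is "\<And>q v. _ \<Longrightarrow> _ \<Longrightarrow> ?B q v")
proof -
  have *: "\<exists>D. ((\<lambda>p. L (f p)) has_derivative D) (at q within h) \<and> (\<forall>c v. D (c *s v) = sc2 c (D v))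
    \<and> (\<forall>v\<in>h. ?B q v)" if q: "q \<in> V" for q
  proof -
    obtain F where F: "(f has_derivative F) (at q within h)" "\<And>c v. F (c *s v) = sc1 c (F v)"
      "\<And>v. v \<in> h \<Longrightarrow> dir_deriv h f q v = F v" by (rule holoD[OF h V f q]) blast
    have D: "((\<lambda>p. L (f p)) has_derivative (\<lambda>v. L (F v))) (at q within h)"
      by (rule bounded_linear.has_derivative[OF L F(1)])
    have "?B q v" if "v \<in> h" for v
      using dir_deriv_eq[OF h _ that D] q V F(3)[OF that] by auto
    then show ?thesis using D F(2) sc by (intro exI[of _ "\<lambda>v. L (F v)"]) simp
  qed
  show ?A unfolding holo_def using * by blast
  show "?B q v" if "q \<in> V" "v \<in> h" for q v using * that by blast
qed

lemma holo_add:
  assumes h: "vec.subspace h" and V: "V \<subseteq> h"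
    and sc: "\<And>c u v. sc c (u + v) = sc c u + sc c v" and f: "holo h sc V f" and g: "holo h sc V g"
  shows "holo h sc V (\<lambda>p. f p + g p)" (is ?A)
    and "\<And>q v. q \<in> V \<Longrightarrow> v \<in> h \<Longrightarrow> dir_deriv h (\<lambda>p. f p + g p) q v = dir_deriv h f q v + dir_deriv h g q v"
      (is "\<And>q v. _ \<Longrightarrow> _ \<Longrightarrow> ?B q v")
proof -
  have *: "\<exists>D. ((\<lambda>p. f p + g p) has_derivative D) (at q within h) \<and> (\<forall>c v. D (c *s v) = sc c (D v))
    \<and> (\<forall>v\<in>h. ?B q v)" if q: "q \<in> V" for q
  proof -
    obtain F where F: "(f has_derivative F) (at q within h)" "\<And>c v. F (c *s v) = sc c (F v)"
      "\<And>v. v \<in> h \<Longrightarrow> dir_deriv h f q v = F v" by (rule holoD[OF h V f q]) blast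
    obtain G where G: "(g has_derivative G) (at q within h)" "\<And>c v. G (c *s v) = sc c (G v)"
      "\<And>v. v \<in> h \<Longrightarrow> dir_deriv h g q v = G v" by (rule holoD[OF h V g q]) blast
    have D: "((\<lambda>p. f p + g p) has_derivative (\<lambda>v. F v + G v)) (at q within h)"
      by (rule has_derivative_add[OF F(1) G(1)])
    have "?B q v" if "v \<in> h" for v
      using dir_deriv_eq[OF h _ that D] q V F(3)[OF that] G(3)[OF that] by auto
    then show ?thesis using D F(2) G(2) sc by (intro exI[of _ "\<lambda>v. F v + G v"]) simp
  qed
  show ?A unfolding holo_def using * by blast
  show "?B q v" if "q \<in> V" "v \<in> h" for q v using * that by blast
qed

lemma holo_const:
  assumes h: "vec.subspace h" and V: "V \<subseteq> h" and sc: "\<And>c. sc c 0 = 0"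
  shows "holo h sc V (\<lambda>p. k)"
    and "\<And>q v. q \<in> V \<Longrightarrow> v \<in> h \<Longrightarrow> dir_deriv h (\<lambda>p. k) q v = 0"
proof -
  show "holo h sc V (\<lambda>p. k)"
    unfolding holo_def by (intro ballI exI[of _ "\<lambda>v. 0"]) (simp add: sc)
  show "dir_deriv h (\<lambda>p. k) q v = 0" if "q \<in> V" "v \<in> h" for q v
    using dir_deriv_eq[OF h _ that(2) has_derivative_const, of q k] that V by auto
qed

lemma holo_sum:
  assumes h: "vec.subspace h" and V: "V \<subseteq> h" and sc: "\<And>c u v. sc c (u + v) = sc c u + sc c v"
    and f: "\<And>i. i \<in> I \<Longrightarrow> holo h sc V (f i)"
  shows "holo h sc V (\<lambda>p. \<Sum>i\<in>I. f i p)
    \<and> (\<forall>q\<in>V. \<forall>v\<in>h. dir_deriv h (\<lambda>p. \<Sum>i\<in>I. f i p) q v = (\<Sum>i\<in>I. dir_deriv h (f i) q v))"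
proof -
  have 0: "sc c 0 = 0" for c using sc[of c 0 0] by simp
  show ?thesis using f
  proof (induction I rule: infinite_finite_induct)
    case (insert i I)
    then show ?case using holo_add[where sc=sc, OF h V sc, where f="f i" and g="\<lambda>p. \<Sum>i\<in>I. f i p"] by simp
  qed (simp_all add: holo_const[where sc=sc, OF h V 0])
qed

lemmas vec_distrib = vec.scale_right_distrib vec.scale_left_distrib

lemma dir_deriv_direction:
  assumes h: "vec.subspace h" and V: "V \<subseteq> h" and f: "holo h sc V f" and q: "q \<in> V"
  shows "u \<in> h \<Longrightarrow> v \<in> h \<Longrightarrow> dir_deriv h f q (u + v) = dir_deriv h f q u + dir_deriv h f q v"
    and "v \<in> h \<Longrightarrow> dir_deriv h f q (c *s v) = sc c (dir_deriv h f q v)"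
proof -
  obtain F where F: "(f has_derivative F) (at q within h)" "\<And>c v. F (c *s v) = sc c (F v)"
      "\<And>v. v \<in> h \<Longrightarrow> dir_deriv h f q v = F v" by (rule holoD[OF h V f q]) blast
  interpret F: bounded_linear F using F(1) by (rule has_derivative_bounded_linear)
  show "u \<in> h \<Longrightarrow> v \<in> h \<Longrightarrow> dir_deriv h f q (u + v) = dir_deriv h f q u + dir_deriv h f q v"
    using F(3) F.add h by (simp add: vec.subspace_add)
  show "v \<in> h \<Longrightarrow> dir_deriv h f q (c *s v) = sc c (dir_deriv h f q v)"
    using F(2,3) h by (simp add: vec.subspace_scale)
qed

lemma bounded_bilinear_vector_scale: "bounded_bilinear ((*s) :: complex \<Rightarrow> complex ^ 'n \<Rightarrow> complex ^ 'n)"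
proof (rule bounded_bilinear.intro)
  show "\<exists>K. \<forall>a b. norm (a *s b :: complex ^ 'n) \<le> norm a * norm b * K"
    by (rule exI[of _ 1]) (simp add: norm_vector_scale)
qed (simp_all add: vec_distrib scaleR_vector_scale scaleR_conv_of_real vec.scale_left_commute)

lemma holo_scale:
  fixes f :: "complex ^ 'n \<Rightarrow> complex ^ 'm"
  assumes h: "vec.subspace h" and V: "V \<subseteq> h" and c: "holo h (*) V c" and f: "holo h (*s) V f"
  shows "holo h (*s) V (\<lambda>p. c p *s f p)"
    and "\<And>q v. q \<in> V \<Longrightarrow> v \<in> h \<Longrightarrow>
      dir_deriv h (\<lambda>p. c p *s f p) q v = c q *s dir_deriv h f q v + dir_deriv h c q v *s f q"
  by (rule holo_bilinear[where ?sc1.0="(*)" and ?sc2.0="(*s)" and ?sc3.0="(*s)",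
        OF h V bounded_bilinear_vector_scale _ _ _ c f];
      simp add: vec_distrib vec.scale_left_commute)+

lemma clinear_imp_bounded_linear:
  fixes L :: "complex ^ 'n \<Rightarrow> complex ^ 'm"
  assumes "Vector_Spaces.linear (*s) (*s) L"
  shows "bounded_linear L"
proof -
  interpret Vector_Spaces.linear "(*s)" "(*s)" L by fact
  show ?thesis by (rule linear_imp_bounded_linear) (simp_all add: add scale scaleR_vector_scale)
qed

lemma axis_expansion: "u = (\<Sum>i\<in>UNIV. u $ i *s axis i (1::complex))"
  by (simp add: vec_eq_iff axis_def if_distrib[of "\<lambda>z. _ * z"] cong: if_cong)

lemma holo_componentwise:
  fixes f :: "complex ^ 'n \<Rightarrow> complex ^ 'm"
  assumes h: "vec.subspace h" and V: "V \<subseteq> h"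
  shows "holo h (*s) V f \<longleftrightarrow> (\<forall>i. holo h (*) V (\<lambda>p. f p $ i))"
proof
  assume "holo h (*s) V f"
  then show "\<forall>i. holo h (*) V (\<lambda>p. f p $ i)"
    by (intro allI holo_linear(1)[OF h V bounded_linear_vec_nth]) auto
next
  assume f: "\<forall>i. holo h (*) V (\<lambda>p. f p $ i)"
  have "holo h (*s) V (\<lambda>p. \<Sum>i\<in>UNIV. f p $ i *s axis i 1)"
    using f by (intro holo_sum[OF h V, THEN conjunct1] holo_scale(1)[OF h V] holo_const(1)[OF h V])
      (auto simp: vec_distrib)
  then show "holo h (*s) V f" by (simp add: axis_expansion[symmetric])
qed

lemma dir_deriv_component:
  fixes f :: "complex ^ 'n \<Rightarrow> complex ^ 'm"
  assumes h: "vec.subspace h" and V: "V \<subseteq> h" and f: "holo h (*s) V f" and "q \<in> V" "v \<in> h"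
  shows "dir_deriv h f q v $ i = dir_deriv h (\<lambda>p. f p $ i) q v"
  using holo_linear(2)[OF h V bounded_linear_vec_nth _ f] assms by simp

text \<open>The vector-valued forms follow from the scalar ones by taking coordinates.\<close>

lemma holo_dir_deriv_vector:
  fixes f :: "complex ^ 'n \<Rightarrow> complex ^ 'm"
  assumes h: "vec.subspace h" and V: "openin (top_of_set h) V" and f: "holo h (*s) V f" and v: "v \<in> h"
  shows "holo h (*s) V (\<lambda>p. dir_deriv h f p v)"
proof -
  have Vh: "V \<subseteq> h" using V openin_imp_subset by blast
  have "holo h (*) V (\<lambda>p. dir_deriv h f p v $ i)" for i
  proof (rule iffD2[OF holo_cong[OF V dir_deriv_component[OF h Vh f _ v]]])
    have "holo h (*) V (\<lambda>p. f p $ i)" using f holo_componentwise[OF h Vh] by blast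
    then show "holo h (*) V (\<lambda>p. dir_deriv h (\<lambda>p. f p $ i) p v)" by (rule holo_dir_deriv[OF h V _ v])
  qed
  then show ?thesis using holo_componentwise[OF h Vh] by blast
qed

lemma dir_deriv_commute_vector:
  fixes f :: "complex ^ 'n \<Rightarrow> complex ^ 'm"
  assumes h: "vec.subspace h" and V: "openin (top_of_set h) V" and f: "holo h (*s) V f" and q: "q \<in> V"
    and v: "v \<in> h" and w: "w \<in> h"
  shows "dir_deriv h (\<lambda>p. dir_deriv h f p v) q w = dir_deriv h (\<lambda>p. dir_deriv h f p w) q v"
proof -
  have Vh: "V \<subseteq> h" using V openin_imp_subset by blast
  have fi: "holo h (*) V (\<lambda>p. f p $ i)" for i using f holo_componentwise[OF h Vh] by blast
  have *: "dir_deriv h (\<lambda>p. dir_deriv h f p u) q u' $ i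
      = dir_deriv h (\<lambda>p. dir_deriv h (\<lambda>p. f p $ i) p u) q u'" if "u \<in> h" "u' \<in> h" for u u' i
    by (rule trans[OF dir_deriv_component[OF h Vh holo_dir_deriv_vector[OF h V f that(1)] q that(2)]
          dir_deriv_cong[OF V q dir_deriv_component[OF h Vh f _ that(1)]]])
  have "dir_deriv h (\<lambda>p. dir_deriv h f p v) q w $ i = dir_deriv h (\<lambda>p. dir_deriv h f p w) q v $ i" for i
    using dir_deriv_commute[OF h V fi[of i] q v w] *[OF v w, of i] *[OF w v, of i] by (simp only:)
  then show ?thesis by (simp only: vec_eq_iff) blast
qed

text \<open>A linear projection onto \<open>W\<close> fixes \<open>l\<close> and commutes with differentiation.\<close>

lemma dir_deriv_in_subspace:
  fixes l :: "complex ^ 'n \<Rightarrow> complex ^ 'm"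
  assumes h: "vec.subspace h" and V: "openin (top_of_set h) V" and l: "holo h (*s) V l"
    and W: "vec.subspace W" and lW: "\<And>p. p \<in> V \<Longrightarrow> l p \<in> W" and q: "q \<in> V" and v: "v \<in> h"
  shows "dir_deriv h l q v \<in> W"
proof -
  have Vh: "V \<subseteq> h" using V openin_imp_subset by blast
  obtain P where P: "range P \<subseteq> W" "Vector_Spaces.linear (*s) (*s) P" "\<And>u. u \<in> W \<Longrightarrow> P u = u"
    using vec.linear_exists_left_inverse_on[OF vec.linear_id W] by auto
  interpret P: Vector_Spaces.linear "(*s)" "(*s)" P by fact
  have "dir_deriv h l q v = dir_deriv h (\<lambda>p. P (l p)) q v"
    using P(3) lW by (intro dir_deriv_cong[OF V q]) simp
  also have "\<dots> = P (dir_deriv h l q v)"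
    using holo_linear(2)[OF h Vh clinear_imp_bounded_linear[OF P(2)] _ l q v] P.scale by blast
  finally show ?thesis using P(1) by (metis rangeI subsetD)
qed

text \<open>The chain rule for a derivative in a variable direction. A projection onto \<open>h\<close> replaces the standard
  basis by a generating system of \<open>h\<close>, and the direction is expanded in it.\<close>

lemma dir_deriv_along:
  fixes f :: "complex ^ 'n \<Rightarrow> complex ^ 'm"
  assumes h: "vec.subspace h" and V: "openin (top_of_set h) V" and f: "holo h (*s) V f"
    and l: "holo h (*s) V l" and lh: "\<And>p. p \<in> V \<Longrightarrow> l p \<in> h"
  shows "holo h (*s) V (\<lambda>p. dir_deriv h f p (l p))"
    and "\<And>q v. q \<in> V \<Longrightarrow> v \<in> h \<Longrightarrow> dir_deriv h (\<lambda>p. dir_deriv h f p (l p)) q v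
      = dir_deriv h (\<lambda>p. dir_deriv h f p (l q)) q v + dir_deriv h f q (dir_deriv h l q v)"
proof -
  have Vh: "V \<subseteq> h" using V openin_imp_subset by blast
  obtain P where P: "range P \<subseteq> h" "Vector_Spaces.linear (*s) (*s) P" "\<And>u. u \<in> h \<Longrightarrow> P u = u"
    using vec.linear_exists_left_inverse_on[OF vec.linear_id h] by auto
  interpret P: Vector_Spaces.linear "(*s)" "(*s)" P by fact
  define b where "b i = P (axis i 1)" for i
  have bh: "b i \<in> h" for i using P(1) by (auto simp: b_def)
  have expand: "u = (\<Sum>i\<in>UNIV. u $ i *s b i)" if "u \<in> h" for u
  proof -
    have "u = P (\<Sum>i\<in>UNIV. u $ i *s axis i 1)" using P(3)[OF that] by (simp add: axis_expansion[symmetric])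
    then show ?thesis by (simp add: P.sum P.scale b_def)
  qed
  have along: "dir_deriv h f p u = (\<Sum>i\<in>UNIV. u $ i *s dir_deriv h f p (b i))" if p: "p \<in> V" and u: "u \<in> h" for p u
  proof -
    have "dir_deriv h f p (\<Sum>i\<in>I. u $ i *s b i) = (\<Sum>i\<in>I. u $ i *s dir_deriv h f p (b i))" for I
    proof (induction I rule: infinite_finite_induct)
      case (insert i I)
      have "(\<Sum>i\<in>I. u $ i *s b i) \<in> h" using h bh by (auto intro!: vec.subspace_sum vec.subspace_scale)
      then show ?case
        using insert dir_deriv_direction[OF h Vh f p] bh h by (simp add: vec.subspace_scale)
    qed (use dir_deriv_direction(2)[OF h Vh f p, of 0 0] h in \<open>auto simp: vec.subspace_0\<close>)
    then show ?thesis using expand[OF u] by metis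
  qed
  have li: "holo h (*) V (\<lambda>p. l p $ i)" for i using l holo_componentwise[OF h Vh] by blast
  have fb: "holo h (*s) V (\<lambda>p. dir_deriv h f p (b i))" for i by (rule holo_dir_deriv_vector[OF h V f bh])
  have prod: "holo h (*s) V (\<lambda>p. c p *s dir_deriv h f p (b i))"
    "q \<in> V \<Longrightarrow> v \<in> h \<Longrightarrow> dir_deriv h (\<lambda>p. c p *s dir_deriv h f p (b i)) q v =
      c q *s dir_deriv h (\<lambda>p. dir_deriv h f p (b i)) q v + dir_deriv h c q v *s dir_deriv h f q (b i)"
    if "holo h (*) V c" for c i q v
    using holo_scale[OF h Vh that fb] by blast+
  have sum: "holo h (*s) V (\<lambda>p. \<Sum>i\<in>UNIV. c i p *s dir_deriv h f p (b i))"
    "q \<in> V \<Longrightarrow> v \<in> h \<Longrightarrow> dir_deriv h (\<lambda>p. \<Sum>i\<in>UNIV. c i p *s dir_deriv h f p (b i)) q v =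
      (\<Sum>i\<in>UNIV. c i q *s dir_deriv h (\<lambda>p. dir_deriv h f p (b i)) q v
        + dir_deriv h (c i) q v *s dir_deriv h f q (b i))"
    if c: "\<And>i. holo h (*) V (c i)" for c q v
    using holo_sum[OF h Vh, where sc="(*s)" and I=UNIV and f="\<lambda>i p. c i p *s dir_deriv h f p (b i)",
        OF vec.scale_right_distrib prod(1)[OF c]] prod(2)[OF c] by simp_all
  have "holo h (*s) V (\<lambda>p. \<Sum>i\<in>UNIV. l p $ i *s dir_deriv h f p (b i))"
    by (rule sum(1)[OF li])
  then show "holo h (*s) V (\<lambda>p. dir_deriv h f p (l p))"
    by (intro iffD2[OF holo_cong[OF V along[OF _ lh]]])
  fix q v assume q: "q \<in> V" and v: "v \<in> h"
  have dl: "dir_deriv h l q v \<in> h" by (rule dir_deriv_in_subspace[OF h V l h lh q v])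
  have "dir_deriv h (\<lambda>p. dir_deriv h f p (l p)) q v
      = dir_deriv h (\<lambda>p. \<Sum>i\<in>UNIV. l p $ i *s dir_deriv h f p (b i)) q v"
    by (rule dir_deriv_cong[OF V q along[OF _ lh]])
  also have "\<dots> = (\<Sum>i\<in>UNIV. l q $ i *s dir_deriv h (\<lambda>p. dir_deriv h f p (b i)) q v
      + dir_deriv h (\<lambda>p. l p $ i) q v *s dir_deriv h f q (b i))"
    by (rule sum(2)[OF li q v])
  also have "\<dots> = (\<Sum>i\<in>UNIV. l q $ i *s dir_deriv h (\<lambda>p. dir_deriv h f p (b i)) q v)
      + dir_deriv h f q (dir_deriv h l q v)"
    using along[OF q dl] dir_deriv_component[OF h Vh l q v] by (simp add: sum.distrib)
  also have "(\<Sum>i\<in>UNIV. l q $ i *s dir_deriv h (\<lambda>p. dir_deriv h f p (b i)) q v)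
      = dir_deriv h (\<lambda>p. \<Sum>i\<in>UNIV. l q $ i *s dir_deriv h f p (b i)) q v"
    using sum(2)[of "\<lambda>i p. l q $ i", OF holo_const(1)[OF h Vh] q v]
      holo_const(2)[where sc="(*)" and 'b=complex, OF h Vh _ q v] by simp
  also have "\<dots> = dir_deriv h (\<lambda>p. dir_deriv h f p (l q)) q v"
    by (rule dir_deriv_cong[OF V q along[OF _ lh[OF q], symmetric]])
  finally show "dir_deriv h (\<lambda>p. dir_deriv h f p (l p)) q v
      = dir_deriv h (\<lambda>p. dir_deriv h f p (l q)) q v + dir_deriv h f q (dir_deriv h l q v)" .
qed

lemma holo_pair:
  fixes s :: "complex ^ 'n \<Rightarrow> (complex ^ 'm) \<times> (complex ^ 'k)"
  assumes h: "vec.subspace h" and V: "V \<subseteq> h"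
  shows "holo h scale2 V s \<longleftrightarrow> holo h (*s) V (fst \<circ> s) \<and> holo h (*s) V (snd \<circ> s)"
proof
  assume s: "holo h scale2 V s"
  show "holo h (*s) V (fst \<circ> s) \<and> holo h (*s) V (snd \<circ> s)"
    using holo_linear(1)[OF h V bounded_linear_fst _ s] holo_linear(1)[OF h V bounded_linear_snd _ s]
    by (simp add: scale2_def comp_def)
next
  assume s: "holo h (*s) V (fst \<circ> s) \<and> holo h (*s) V (snd \<circ> s)"
  have bl: "bounded_linear (\<lambda>u. (u, 0))" "bounded_linear (\<lambda>v. (0, v))"
    by (auto intro!: bounded_linear_intros)
  have "holo h scale2 V (\<lambda>p. ((fst \<circ> s) p, 0) + (0, (snd \<circ> s) p))"
    by (rule holo_add(1)[OF h V])
       (use s in \<open>auto intro!: holo_linear(1)[OF h V bl(1), of "(*s)"] holo_linear(1)[OF h V bl(2), of "(*s)"]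
          simp: scale2_def vec_distrib o_def\<close>)
  then show "holo h scale2 V s" by simp
qed

section \<open>Root space structure\<close>

lemma sum_cong_zero: "(\<And>i. i \<in> A \<Longrightarrow> f i = 0) \<Longrightarrow> sum f A = 0"
  by simp

context simple_lie_data
begin

abbreviation kf where "kf \<equiv> killing br"
abbreviation \<Phi> where "\<Phi> \<equiv> roots br h"

lemma lie_br: "lie_algebra br"
  using simple by (simp add: simple_lie_algebra_def)

lemma linear_br_right: "Vector_Spaces.linear (*s) (*s) (br u)"
  and linear_br_left: "Vector_Spaces.linear (*s) (*s) (\<lambda>u. br u v)"
  using lie_br by (simp_all add: lie_algebra_def)

lemma br_add_right: "br u (v + w) = br u v + br u w"
  and br_scale_right: "br u (c *s v) = c *s br u v"
  using linear_br_right[of u] by (simp_all add: vec.linear_add vec.linear_scale)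

lemma br_add_left: "br (u + v) w = br u w + br v w"
  and br_scale_left: "br (c *s u) v = c *s br u v"
  using vec.linear_add[OF linear_br_left] vec.linear_scale[OF linear_br_left] by blast+

lemma br_zero: "br 0 v = 0" "br v 0 = 0"
  using br_scale_left[of 0 v v] br_scale_right[of v 0 v] by simp_all

lemma br_minus: "br (- u) v = - br u v" "br u (- v) = - br u v"
  using br_scale_left[of "-1" u v] br_scale_right[of u "-1" v] by simp_all

lemma br_diff: "br (u - v) w = br u w - br v w" "br u (v - w) = br u v - br u w"
  using br_add_left[of u "- v" w] br_add_right[of u v "- w"] by (simp_all add: br_minus)

lemma br_sum_left: "br (\<Sum>i\<in>I. f i) v = (\<Sum>i\<in>I. br (f i) v)"
  and br_sum_right: "br v (\<Sum>i\<in>I. f i) = (\<Sum>i\<in>I. br v (f i))"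
  using vec.linear_sum[OF linear_br_left] vec.linear_sum[OF linear_br_right] by blast+

lemma br_self: "br u u = 0"
  using lie_br by (simp add: lie_algebra_def)

lemma br_skew: "br u v = - br v u"
proof -
  have "br u (u + v) + br v (u + v) = 0" using br_self[of "u + v"] by (simp only: br_add_left)
  then have "br u v + br v u = 0" by (simp add: br_add_right br_self)
  then show ?thesis by (simp only: eq_neg_iff_add_eq_0)
qed

lemma jacobi: "br u (br v w) = br (br u v) w + br v (br u w)"
proof -
  have "br u (br v w) + br v (br w u) + br w (br u v) = 0"
    using lie_br by (simp add: lie_algebra_def)
  moreover have "br v (br w u) = - br v (br u w)" by (subst br_skew[of w u]) (simp add: br_minus)
  moreover have "br w (br u v) = - br (br u v) w" by (rule br_skew)
  ultimately show ?thesis by (simp add: algebra_simps add_eq_0_iff)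
qed

text \<open>Traces of linear maps on the underlying space; cyclicity makes the Killing form symmetric and
  invariant.\<close>

abbreviation tr :: "(complex ^ 'n \<Rightarrow> complex ^ 'n) \<Rightarrow> complex" where
  "tr f \<equiv> trace (matrix f)"

lemma tr_eq: "tr f = (\<Sum>i\<in>UNIV. f (axis i 1) $ i)"
  by (simp add: trace_def matrix_def)

lemma tr_comp:
  fixes f g :: "complex ^ 'n \<Rightarrow> complex ^ 'n"
  assumes "Vector_Spaces.linear (*s) (*s) f" "Vector_Spaces.linear (*s) (*s) g"
  shows "tr (\<lambda>z. f (g z)) = tr (\<lambda>z. g (f z))"
  using matrix_compose_gen[OF assms] matrix_compose_gen[OF assms(2,1)] trace_mul_sym[of "matrix f" "matrix g"]
  by (simp add: comp_def)

lemma kf_eq: "kf u v = tr (\<lambda>z. br u (br v z))"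
  by (simp add: killing_def)

lemma kf_sym: "kf u v = kf v u"
  unfolding kf_eq by (rule tr_comp) (rule linear_br_right)+

lemma kf_add_left: "kf (u + v) w = kf u w + kf v w"
  and kf_scale_left: "kf (c *s u) w = c * kf u w"
  by (simp_all add: kf_eq tr_eq br_add_left br_scale_left sum.distrib sum_distrib_left)

lemma kf_add_right: "kf w (u + v) = kf w u + kf w v"
  and kf_scale_right: "kf w (c *s u) = c * kf w u"
  by (simp_all add: kf_sym[of w] kf_add_left kf_scale_left)

lemma kf_zero: "kf 0 v = 0" "kf v 0 = 0"
  using kf_scale_left[of 0 v v] kf_scale_right[of v 0 v] by simp_all

lemma kf_minus: "kf (- u) v = - kf u v" "kf u (- v) = - kf u v"
  using kf_scale_left[of "-1" u v] kf_scale_right[of u "-1" v] by simp_all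

lemma kf_diff: "kf (u - v) w = kf u w - kf v w" "kf w (u - v) = kf w u - kf w v"
  using kf_add_left[of u "- v" w] kf_add_right[of w u "- v"] by (simp_all add: kf_minus)

lemma kf_sum_right: "kf v (\<Sum>i\<in>I. f i) = (\<Sum>i\<in>I. kf v (f i))"
  by (induction I rule: infinite_finite_induct) (simp_all add: kf_add_right kf_zero)

lemma kf_sum_left: "kf (\<Sum>i\<in>I. f i) v = (\<Sum>i\<in>I. kf (f i) v)"
  by (induction I rule: infinite_finite_induct) (simp_all add: kf_add_left kf_zero)

lemmas kf_linear = kf_add_left kf_add_right kf_scale_left kf_scale_right kf_zero kf_minus kf_diff
  kf_sum_left kf_sum_right

lemma kf_invariant: "kf (br u v) w = kf u (br v w)"
proof -
  have 1: "br (br u v) (br w z) = br u (br v (br w z)) - br v (br u (br w z))" for z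
    using jacobi[of u v "br w z"] by simp
  have 2: "br u (br (br v w) z) = br u (br v (br w z)) - br u (br w (br v z))" for z
    using jacobi[of v w z] by (simp add: br_diff[symmetric])
  have lin: "Vector_Spaces.linear (*s) (*s) (\<lambda>z. br u (br w z))"
    using Vector_Spaces.linear_compose[OF linear_br_right[of w] linear_br_right[of u]] by (simp add: comp_def)
  have "kf (br u v) w = tr (\<lambda>z. br u (br v (br w z))) - tr (\<lambda>z. br v (br u (br w z)))"
    by (simp add: kf_eq 1 tr_eq sum_subtractf)
  also have "tr (\<lambda>z. br v (br u (br w z))) = tr (\<lambda>z. br u (br w (br v z)))"
    by (rule tr_comp[OF linear_br_right lin])
  finally show ?thesis by (simp add: kf_eq 2 tr_eq sum_subtractf)
qed

lemma h_subspace: "vec.subspace h" and h_abelian: "H \<in> h \<Longrightarrow> H' \<in> h \<Longrightarrow> br H H' = 0"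
  using cartan by (auto simp: cartan_subalgebra_def abelian_subalgebra_def)

lemma x_in_h: "x i \<in> h"
  using vec.span_base[of "x i" "range x"] basis by simp

text \<open>The projection onto \<open>h\<close> along the root spaces, written in the orthonormal basis of \<open>h\<close>.\<close>

definition hp :: "complex ^ 'n \<Rightarrow> complex ^ 'n" where
  "hp u = (\<Sum>i\<in>UNIV. kf (x i) u *s x i)"

lemma hp_linear: "hp (u + v) = hp u + hp v" "hp (c *s u) = c *s hp u"
  by (simp_all add: hp_def kf_linear vec.scale_left_distrib sum.distrib vec.scale_sum_right)

lemma hp_in_h: "hp u \<in> h"
  unfolding hp_def using h_subspace x_in_h by (auto intro!: vec.subspace_sum vec.subspace_scale)

lemma hp_h: assumes "u \<in> h" shows "hp u = u"
proof -
  have "u \<in> vec.span (range x)" using assms basis by simp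
  then show ?thesis
  proof (induction u rule: vec.span_induct)
    case base
    show ?case by (rule vec.subspaceI) (simp_all add: hp_linear, simp add: hp_def kf_linear)
  next
    case (step a)
    then obtain i where "a = x i" by blast
    then have "hp a = (\<Sum>j\<in>UNIV. if j = i then x j else 0)"
      unfolding hp_def by (intro sum.cong) (simp_all add: orthonormal)
    then show ?case using \<open>a = x i\<close> by simp
  qed
qed

lemma kf_nondegenerate_h: assumes "u \<in> h" "\<And>H. H \<in> h \<Longrightarrow> kf u H = 0" shows "u = 0"
  using hp_h[OF assms(1)] assms(2)[OF x_in_h] by (simp add: hp_def kf_sym[of _ u])

lemma root_in_h: "\<alpha> \<in> \<Phi> \<Longrightarrow> \<alpha> \<in> h" and root_nonzero: "\<alpha> \<in> \<Phi> \<Longrightarrow> \<alpha> \<noteq> 0"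
  by (simp_all add: roots_def)

lemma root_vector_in: "\<alpha> \<in> \<Phi> \<Longrightarrow> e \<alpha> \<in> root_space br h \<alpha>"
  by (simp add: root_vector vec.span_base)

lemma br_h_e: "\<alpha> \<in> \<Phi> \<Longrightarrow> H \<in> h \<Longrightarrow> br H (e \<alpha>) = kf \<alpha> H *s e \<alpha>"
  using root_vector_in by (simp add: root_space_def)

lemma h_separates: assumes "\<alpha> \<in> h" "\<alpha> \<noteq> 0" obtains H where "H \<in> h" "kf \<alpha> H \<noteq> 0"
  using assms kf_nondegenerate_h by blast

text \<open>Choose \<open>H'\<close> with \<open>\<alpha>(H') \<noteq> 0\<close>; invariance under \<open>ad H'\<close> multiplies the product by \<open>\<alpha>(H')\<close> on one side
  and kills it on the other. The same argument with \<open>\<alpha> + \<beta>\<close> gives the orthogonality of root vectors.\<close>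

lemma kf_e_h: assumes \<alpha>: "\<alpha> \<in> \<Phi>" and H: "H \<in> h" shows "kf (e \<alpha>) H = 0"
proof -
  obtain H' where H': "H' \<in> h" "kf \<alpha> H' \<noteq> 0" using h_separates root_in_h root_nonzero \<alpha> by metis
  have "kf \<alpha> H' * kf (e \<alpha>) H = kf (br H' (e \<alpha>)) H" using br_h_e[OF \<alpha> H'(1)] by (simp add: kf_linear)
  also have "\<dots> = - kf (e \<alpha>) (br H' H)" by (subst br_skew) (simp add: kf_linear kf_invariant)
  finally show ?thesis using h_abelian[OF H'(1) H] H'(2) by (simp add: kf_linear)
qed

lemma kf_e_e_zero: assumes \<alpha>: "\<alpha> \<in> \<Phi>" and \<beta>: "\<beta> \<in> \<Phi>" and ne: "\<alpha> + \<beta> \<noteq> 0" shows "kf (e \<alpha>) (e \<beta>) = 0"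
proof -
  have "\<alpha> + \<beta> \<in> h" using root_in_h \<alpha> \<beta> h_subspace by (simp add: vec.subspace_add)
  then obtain H where H: "H \<in> h" "kf (\<alpha> + \<beta>) H \<noteq> 0" using h_separates ne by metis
  have "kf \<alpha> H * kf (e \<alpha>) (e \<beta>) = kf (br H (e \<alpha>)) (e \<beta>)" using br_h_e[OF \<alpha> H(1)] by (simp add: kf_linear)
  also have "\<dots> = - kf (e \<alpha>) (br H (e \<beta>))" by (subst br_skew) (simp add: kf_linear kf_invariant)
  also have "\<dots> = - kf \<beta> H * kf (e \<alpha>) (e \<beta>)" using br_h_e[OF \<beta> H(1)] by (simp add: kf_linear)
  finally have "kf (\<alpha> + \<beta>) H * kf (e \<alpha>) (e \<beta>) = 0" by (simp add: kf_linear distrib_right)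
  then show ?thesis using H(2) by simp
qed

lemma span_induct_roots:
  assumes sub: "vec.subspace {u. P u}" and hP: "\<And>u. u \<in> h \<Longrightarrow> P u" and eP: "\<And>\<alpha>. \<alpha> \<in> \<Phi> \<Longrightarrow> P (e \<alpha>)"
  shows "P u"
proof -
  have "u \<in> vec.span (h \<union> (\<Union>\<alpha>\<in>\<Phi>. root_space br h \<alpha>))" using root_decomposition by simp
  then show ?thesis
  proof (induction u rule: vec.span_induct)
    case base show ?case using sub by simp
  next
    case (step a)
    then consider "a \<in> h" | \<alpha> where "\<alpha> \<in> \<Phi>" "a \<in> vec.span {e \<alpha>}" using root_vector by blast
    then show ?case
    proof cases
      case (2 \<alpha>)
      then obtain c where "a = c *s e \<alpha>" by (auto simp: vec.span_singleton)
      then show ?thesis using vec.subspace_scale[OF sub, of "e \<alpha>" c] eP[OF 2(1)] by simp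
    qed (rule hP)
  qed
qed

text \<open>A root vector pairs trivially with everything but the opposite root space, so the latter is nonzero.\<close>

lemma neg_root: assumes \<alpha>: "\<alpha> \<in> \<Phi>" shows "- \<alpha> \<in> \<Phi>"
proof (rule ccontr)
  assume n: "- \<alpha> \<notin> \<Phi>"
  have "kf (e \<alpha>) u = 0" for u
  proof (induction u rule: span_induct_roots)
    case 1 show ?case by (rule vec.subspaceI) (simp_all add: kf_linear)
  next
    case (2 u) then show ?case using kf_e_h[OF \<alpha>] by simp
  next
    case (3 \<beta>)
    then have "\<alpha> + \<beta> \<noteq> 0" using n by (metis add.commute add_eq_0_iff)
    then show ?case using kf_e_e_zero[OF \<alpha> 3] by simp
  qed
  then show False using root_vector_normalized[OF \<alpha>] by simp
qed

lemma kf_dual_e: assumes "\<alpha> \<in> \<Phi>" "\<beta> \<in> \<Phi>" shows "kf (e (- \<alpha>)) (e \<beta>) = (if \<beta> = \<alpha> then 1 else 0)"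
  using kf_e_e_zero[of "- \<alpha>" \<beta>] root_vector_normalized[of "- \<alpha>"] neg_root assms by (auto simp: add_eq_0_iff)

lemma kf_dual_h: assumes "\<alpha> \<in> \<Phi>" "H \<in> h" shows "kf (e (- \<alpha>)) H = 0"
  using kf_e_h neg_root assms by blast

lemma inj_e: "inj_on e \<Phi>"
  by (rule inj_onI) (metis kf_dual_e zero_neq_one)

text \<open>The opposite root vectors form a dual system, so root vectors are linearly independent.\<close>

lemma finite_roots: "finite \<Phi>"
proof -
  have "vec.independent (e ` \<Phi>)"
    unfolding vec.independent_explicit_module
  proof (intro allI impI)
    fix t u v assume t: "finite t" "t \<subseteq> e ` \<Phi>" "(\<Sum>v\<in>t. u v *s v) = 0" "v \<in> t"
    then obtain \<alpha> where \<alpha>: "\<alpha> \<in> \<Phi>" "v = e \<alpha>" by blast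
    have "kf (e (- \<alpha>)) w = (if w = v then 1 else 0)" if w: "w \<in> t" for w
    proof -
      obtain \<beta> where \<beta>: "\<beta> \<in> \<Phi>" "w = e \<beta>" using w t(2) by blast
      show ?thesis
        using kf_dual_e[OF \<alpha>(1) \<beta>(1)] kf_dual_e[OF \<alpha>(1) \<alpha>(1)] \<alpha>(2) \<beta>(2) inj_onD[OF inj_e, of \<alpha> \<beta>] \<alpha>(1) \<beta>(1) by auto
    qed
    then have "kf (e (- \<alpha>)) (\<Sum>v\<in>t. u v *s v) = (\<Sum>w\<in>t. if w = v then u v else 0)"
      by (simp add: kf_linear) (intro sum.cong, auto)
    then show "u v = 0" using t by (simp add: kf_linear)
  qed
  then have "finite (e ` \<Phi>)" by (rule vec.finiteI_independent)
  then show ?thesis using inj_e finite_imageD by blast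
qed

text \<open>The coefficient of \<open>e \<alpha>\<close> in the root decomposition.\<close>

definition cf :: "complex ^ 'n \<Rightarrow> complex ^ 'n \<Rightarrow> complex" where
  "cf \<alpha> u = kf (e (- \<alpha>)) u"

lemma cf_linear: "cf \<alpha> (u + v) = cf \<alpha> u + cf \<alpha> v" "cf \<alpha> (c *s u) = c * cf \<alpha> u" "cf \<alpha> 0 = 0"
  "cf \<alpha> (- u) = - cf \<alpha> u" "cf \<alpha> (u - v) = cf \<alpha> u - cf \<alpha> v" "cf \<alpha> (\<Sum>i\<in>I. f i) = (\<Sum>i\<in>I. cf \<alpha> (f i))"
  by (simp_all add: cf_def kf_linear)

lemma cf_e: "\<alpha> \<in> \<Phi> \<Longrightarrow> \<beta> \<in> \<Phi> \<Longrightarrow> cf \<alpha> (e \<beta>) = (if \<beta> = \<alpha> then 1 else 0)"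
  by (simp add: cf_def kf_dual_e)

lemma cf_h: "\<alpha> \<in> \<Phi> \<Longrightarrow> H \<in> h \<Longrightarrow> cf \<alpha> H = 0"
  by (simp add: cf_def kf_dual_h)

lemma hp_e: "\<alpha> \<in> \<Phi> \<Longrightarrow> hp (e \<alpha>) = 0"
  by (simp add: hp_def kf_sym[of "x _"] kf_e_h x_in_h)

lemma hp_more: "hp 0 = 0" "hp (- u) = - hp u" "hp (u - v) = hp u - hp v" "hp (\<Sum>i\<in>I. f i) = (\<Sum>i\<in>I. hp (f i))"
proof -
  show 0: "hp 0 = 0" using hp_linear(2)[of 0 0] by simp
  show 1: "hp (- u) = - hp u" for u using hp_linear(2)[of "-1" u] by simp
  show "hp (u - v) = hp u - hp v" using hp_linear(1)[of u "- v"] 1 by simp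
  show "hp (\<Sum>i\<in>I. f i) = (\<Sum>i\<in>I. hp (f i))"
    by (induction I rule: infinite_finite_induct) (simp_all add: 0 hp_linear)
qed

lemma hp_root_sum: "hp (\<Sum>\<alpha>\<in>\<Phi>. c \<alpha> *s e \<alpha>) = 0"
  by (simp add: hp_more hp_linear hp_e)

lemma cf_root_sum: assumes "\<alpha> \<in> \<Phi>" shows "cf \<alpha> (\<Sum>\<beta>\<in>\<Phi>. c \<beta> *s e \<beta>) = c \<alpha>"
proof -
  have "cf \<alpha> (\<Sum>\<beta>\<in>\<Phi>. c \<beta> *s e \<beta>) = (\<Sum>\<beta>\<in>\<Phi>. if \<beta> = \<alpha> then c \<beta> else 0)"
    unfolding cf_linear using assms by (intro sum.cong) (auto simp: cf_e)
  then show ?thesis using finite_roots assms by simp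
qed

lemma expansion: "u = hp u + (\<Sum>\<alpha>\<in>\<Phi>. cf \<alpha> u *s e \<alpha>)"
proof (induction u rule: span_induct_roots)
  case 1
  define E where "E u = hp u + (\<Sum>\<alpha>\<in>\<Phi>. cf \<alpha> u *s e \<alpha>)" for u
  have "E 0 = 0" "E (u + v) = E u + E v" "E (c *s u) = c *s E u" for u v c
    by (simp_all add: E_def hp_more hp_linear cf_linear vec_distrib sum.distrib vec.scale_sum_right)
  then have "vec.subspace {u. u = E u}" by (intro vec.subspaceI) simp_all
  then show ?case by (simp only: E_def)
next
  case (2 u) then show ?case by (simp add: hp_h cf_h)
next
  case (3 \<alpha>)
  have "(\<Sum>\<beta>\<in>\<Phi>. cf \<beta> (e \<alpha>) *s e \<beta>) = (\<Sum>\<beta>\<in>\<Phi>. if \<beta> = \<alpha> then e \<beta> else 0)"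
    using 3 by (intro sum.cong) (auto simp: cf_e)
  then show ?case using 3 finite_roots by (simp add: hp_e)
qed

lemma eqI_cf: assumes "hp u = hp v" "\<And>\<alpha>. \<alpha> \<in> \<Phi> \<Longrightarrow> cf \<alpha> u = cf \<alpha> v" shows "u = v"
proof -
  have "(\<Sum>\<alpha>\<in>\<Phi>. cf \<alpha> u *s e \<alpha>) = (\<Sum>\<alpha>\<in>\<Phi>. cf \<alpha> v *s e \<alpha>)"
    by (rule sum.cong) (simp_all add: assms(2))
  then show ?thesis using expansion[of u] expansion[of v] assms(1) by simp
qed

lemma br_e_neg: assumes \<alpha>: "\<alpha> \<in> \<Phi>" shows "br (e \<alpha>) (e (- \<alpha>)) = \<alpha>"
proof (cases "\<alpha> \<in> nat_comb S")
  case True then show ?thesis using root_vector_bracket \<alpha> by (simp add: pos_roots_def)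
next
  case False
  then have "- \<alpha> \<in> pos_roots br h S"
    using \<alpha> simple_roots neg_root by (auto simp: pos_roots_def simple_system_def)
  then have "br (e (- \<alpha>)) (e \<alpha>) = - \<alpha>" using root_vector_bracket by fastforce
  then show ?thesis using br_skew[of "e \<alpha>"] by simp
qed

lemma br_e_e_in: assumes "\<alpha> \<in> \<Phi>" "\<beta> \<in> \<Phi>" shows "br (e \<alpha>) (e \<beta>) \<in> root_space br h (\<alpha> + \<beta>)"
  using assms by (simp add: root_space_def jacobi[of _ "e \<alpha>"] br_h_e br_scale_left br_scale_right
      kf_linear vec.scale_left_distrib)

lemma br_e_e_zero: assumes "\<alpha> \<in> \<Phi>" "\<beta> \<in> \<Phi>" "\<alpha> + \<beta> \<noteq> 0" "\<alpha> + \<beta> \<notin> \<Phi>" shows "br (e \<alpha>) (e \<beta>) = 0"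
proof -
  have "\<alpha> + \<beta> \<in> h" using root_in_h assms h_subspace by (simp add: vec.subspace_add)
  then have "root_space br h (\<alpha> + \<beta>) = {0}" using assms by (simp add: roots_def)
  then show ?thesis using br_e_e_in[OF assms(1,2)] by simp
qed

lemma br_e_e: assumes "\<alpha> \<in> \<Phi>" "\<beta> \<in> \<Phi>" "\<alpha> + \<beta> \<in> \<Phi>"
  shows "br (e \<alpha>) (e \<beta>) = cf (\<alpha> + \<beta>) (br (e \<alpha>) (e \<beta>)) *s e (\<alpha> + \<beta>)"
proof -
  obtain c where "br (e \<alpha>) (e \<beta>) = c *s e (\<alpha> + \<beta>)"
    using br_e_e_in[OF assms(1,2)] root_vector[OF assms(3)] by (auto simp: vec.span_singleton)
  then show ?thesis using assms(3) by (simp add: cf_linear cf_e)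
qed

section \<open>Nondegeneracy of the Killing form on spans of roots\<close>

text \<open>The root decomposition writes \<open>f\<close> as a sum of maps of rank one, whose traces are evaluations.\<close>

lemma tr_expansion:
  assumes f: "Vector_Spaces.linear (*s) (*s) f"
  shows "tr f = (\<Sum>i\<in>UNIV. kf (x i) (f (x i))) + (\<Sum>\<alpha>\<in>\<Phi>. cf \<alpha> (f (e \<alpha>)))"
proof -
  have rank1: "(\<Sum>j\<in>UNIV. kf b (axis j 1) * w $ j) = kf b w" for b w
  proof -
    have "kf b w = kf b (\<Sum>j\<in>UNIV. w $ j *s axis j 1)" by (simp add: axis_expansion[symmetric])
    then show ?thesis by (simp add: kf_linear mult.commute)
  qed
  have f_eq: "f u = (\<Sum>i\<in>UNIV. kf (x i) u *s f (x i)) + (\<Sum>\<alpha>\<in>\<Phi>. cf \<alpha> u *s f (e \<alpha>))" for u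
  proof -
    have "f u = f (hp u + (\<Sum>\<alpha>\<in>\<Phi>. cf \<alpha> u *s e \<alpha>))" using expansion[of u] by simp
    then show ?thesis by (simp add: hp_def vec.linear_add[OF f] vec.linear_sum[OF f] vec.linear_scale[OF f])
  qed
  have "tr f = (\<Sum>j\<in>UNIV. (\<Sum>i\<in>UNIV. kf (x i) (axis j 1) * f (x i) $ j)
      + (\<Sum>\<alpha>\<in>\<Phi>. kf (e (- \<alpha>)) (axis j 1) * f (e \<alpha>) $ j))"
    unfolding tr_eq by (rule sum.cong[OF refl], subst f_eq) (simp add: cf_def)
  also have "\<dots> = (\<Sum>i\<in>UNIV. \<Sum>j\<in>UNIV. kf (x i) (axis j 1) * f (x i) $ j)
      + (\<Sum>\<alpha>\<in>\<Phi>. \<Sum>j\<in>UNIV. kf (e (- \<alpha>)) (axis j 1) * f (e \<alpha>) $ j)"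
    unfolding sum.distrib by (intro arg_cong2[where f="(+)"] sum.swap)
  finally show ?thesis by (simp add: rank1 cf_def)
qed

lemma kf_h_h: assumes H: "H \<in> h" "H' \<in> h" shows "kf H H' = (\<Sum>\<gamma>\<in>\<Phi>. kf \<gamma> H * kf \<gamma> H')"
proof -
  have lin: "Vector_Spaces.linear (*s) (*s) (\<lambda>z. br H (br H' z))"
    using Vector_Spaces.linear_compose[OF linear_br_right[of H'] linear_br_right[of H]] by (simp add: comp_def)
  show ?thesis
    unfolding kf_eq[of H H'] tr_expansion[OF lin]
    using H by (simp add: h_abelian x_in_h br_zero kf_linear br_h_e br_scale_right cf_linear cf_e mult.commute)
qed

text \<open>The trace of \<open>ad \<alpha> = [ad e\<^sub>\<alpha>, ad e\<^sub>-\<^sub>\<alpha>]\<close> on a root string vanishes, which makes the Cartan numbers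
  rational. The string is cut out by hand: the diagonal entries of the two products telescope.\<close>

lemma cartan_number_real:
  assumes \<alpha>: "\<alpha> \<in> \<Phi>" and \<beta>: "\<beta> \<in> \<Phi>"
  obtains r :: real where "kf \<beta> \<alpha> = of_real r * kf \<alpha> \<alpha>"
proof (cases "\<exists>k::int. \<beta> + of_int k *s \<alpha> = 0")
  case True
  then obtain k :: int where "\<beta> + of_int k *s \<alpha> = 0" by blast
  then have "\<beta> = of_int (- k) *s \<alpha>" by (simp add: add_eq_0_iff2)
  then have "kf \<beta> \<alpha> = of_real (of_int (- k)) * kf \<alpha> \<alpha>" by (simp add: kf_linear)
  then show ?thesis by (rule that)
next
  case False
  define Str where "Str = {\<gamma>\<in>\<Phi>. \<exists>k::int. \<gamma> = \<beta> + of_int k *s \<alpha>}"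
  have fin: "finite Str" and sub: "Str \<subseteq> \<Phi>" using finite_roots by (auto simp: Str_def)
  have \<beta>S: "\<beta> \<in> Str" using \<beta> by (auto simp: Str_def intro: exI[of _ 0])
  have up: "\<gamma> + \<alpha> \<in> Str" if "\<gamma> \<in> Str" "\<gamma> + \<alpha> \<in> \<Phi>" for \<gamma>
  proof -
    obtain k :: int where "\<gamma> = \<beta> + of_int k *s \<alpha>" using \<open>\<gamma> \<in> Str\<close> by (auto simp: Str_def)
    then have "\<gamma> + \<alpha> = \<beta> + of_int (k + 1) *s \<alpha>" by (simp add: vec.scale_left_distrib)
    then show ?thesis using that(2) unfolding Str_def by blast
  qed
  have down: "\<gamma> - \<alpha> \<in> Str" if "\<gamma> \<in> Str" "\<gamma> - \<alpha> \<in> \<Phi>" for \<gamma>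
  proof -
    obtain k :: int where "\<gamma> = \<beta> + of_int k *s \<alpha>" using \<open>\<gamma> \<in> Str\<close> by (auto simp: Str_def)
    then have "\<gamma> - \<alpha> = \<beta> + of_int (k - 1) *s \<alpha>" by (simp add: vec.scale_left_diff_distrib)
    then show ?thesis using that(2) unfolding Str_def by blast
  qed
  have nz: "\<gamma> + \<alpha> \<noteq> 0" "\<gamma> - \<alpha> \<noteq> 0" if \<gamma>: "\<gamma> \<in> Str" for \<gamma>
  proof -
    obtain k :: int where k: "\<gamma> = \<beta> + of_int k *s \<alpha>" using \<gamma> by (auto simp: Str_def)
    then have "\<gamma> + \<alpha> = \<beta> + of_int (k + 1) *s \<alpha>" "\<gamma> - \<alpha> = \<beta> + of_int (k - 1) *s \<alpha>"
      by (simp_all add: vec.scale_left_distrib vec.scale_left_diff_distrib)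
    then show "\<gamma> + \<alpha> \<noteq> 0" "\<gamma> - \<alpha> \<noteq> 0" using False by metis+
  qed
  define a where "a \<gamma> = cf \<gamma> (br (e \<alpha>) (br (e (- \<alpha>)) (e \<gamma>)))" for \<gamma>
  define b where "b \<gamma> = cf \<gamma> (br (e (- \<alpha>)) (br (e \<alpha>) (e \<gamma>)))" for \<gamma>
  have diff: "kf \<gamma> \<alpha> = a \<gamma> - b \<gamma>" if "\<gamma> \<in> \<Phi>" for \<gamma>
  proof -
    have "a \<gamma> - b \<gamma> = cf \<gamma> (br (br (e \<alpha>) (e (- \<alpha>))) (e \<gamma>))"
      using jacobi[of "e \<alpha>" "e (- \<alpha>)" "e \<gamma>"] by (simp add: a_def b_def cf_linear)
    then show ?thesis using that \<alpha> by (simp add: br_e_neg br_h_e root_in_h cf_linear cf_e)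
  qed
  have a0: "a \<gamma> = 0" if "\<gamma> \<in> Str" "\<gamma> - \<alpha> \<notin> \<Phi>" for \<gamma>
    using br_e_e_zero[of "- \<alpha>" \<gamma>] that nz[OF that(1)] neg_root[OF \<alpha>] sub
    by (auto simp: a_def br_zero cf_linear)
  have b0: "b \<gamma> = 0" if "\<gamma> \<in> Str" "\<gamma> + \<alpha> \<notin> \<Phi>" for \<gamma>
    using br_e_e_zero[of "\<alpha>" \<gamma>] that nz[OF that(1)] \<alpha> sub
    by (auto simp: b_def br_zero cf_linear add.commute)
  have shift: "a (\<gamma> + \<alpha>) = b \<gamma>" if S: "\<gamma> \<in> Str" "\<gamma> + \<alpha> \<in> \<Phi>" for \<gamma>
  proof -
    have \<gamma>: "\<gamma> \<in> \<Phi>" using S sub by blast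
    obtain c where c: "br (e (- \<alpha>)) (e (\<gamma> + \<alpha>)) = c *s e \<gamma>"
      using br_e_e[OF neg_root[OF \<alpha>] S(2)] \<gamma> by auto
    obtain d where d: "br (e \<alpha>) (e \<gamma>) = d *s e (\<gamma> + \<alpha>)"
      using br_e_e[OF \<alpha> \<gamma>] S(2) by (auto simp: add.commute)
    show ?thesis using \<gamma> S(2) by (simp add: a_def b_def c d br_scale_right cf_linear cf_e)
  qed
  have "(\<Sum>\<gamma>\<in>Str. a \<gamma>) = (\<Sum>\<gamma>\<in>{\<gamma>\<in>Str. \<gamma> - \<alpha> \<in> \<Phi>}. a \<gamma>)"
    using fin a0 by (intro sum.mono_neutral_right) auto
  also have "\<dots> = (\<Sum>\<gamma>\<in>{\<gamma>\<in>Str. \<gamma> + \<alpha> \<in> \<Phi>}. b \<gamma>)"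
    by (rule sum.reindex_bij_witness[of _ "\<lambda>\<gamma>. \<gamma> + \<alpha>" "\<lambda>\<gamma>. \<gamma> - \<alpha>"])
       (use up down shift[of "_ - \<alpha>"] sub in auto)
  also have "\<dots> = (\<Sum>\<gamma>\<in>Str. b \<gamma>)"
    using fin b0 by (intro sum.mono_neutral_left) auto
  finally have "(\<Sum>\<gamma>\<in>Str. kf \<gamma> \<alpha>) = 0"
    using diff sub by (simp add: sum_subtractf subset_iff)
  moreover have "\<forall>\<gamma>\<in>Str. \<exists>k::int. \<gamma> = \<beta> + of_int k *s \<alpha>" by (simp add: Str_def)
  then obtain k :: "complex ^ 'n \<Rightarrow> int" where k: "\<forall>\<gamma>\<in>Str. \<gamma> = \<beta> + of_int (k \<gamma>) *s \<alpha>" by metis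
  have "(\<Sum>\<gamma>\<in>Str. kf \<gamma> \<alpha>) = (\<Sum>\<gamma>\<in>Str. kf \<beta> \<alpha> + of_int (k \<gamma>) * kf \<alpha> \<alpha>)"
  proof (rule sum.cong)
    fix \<gamma> assume "\<gamma> \<in> Str"
    then have "kf \<gamma> \<alpha> = kf (\<beta> + of_int (k \<gamma>) *s \<alpha>) \<alpha>" using k by metis
    then show "kf \<gamma> \<alpha> = kf \<beta> \<alpha> + of_int (k \<gamma>) * kf \<alpha> \<alpha>" by (simp add: kf_linear)
  qed simp
  ultimately have sum0: "of_nat (card Str) * kf \<beta> \<alpha> + of_int (\<Sum>\<gamma>\<in>Str. k \<gamma>) * kf \<alpha> \<alpha> = 0"
    by (simp add: sum.distrib sum_distrib_right)
  have card: "card Str \<noteq> 0" using fin \<beta>S by auto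
  have "kf \<beta> \<alpha> = of_real (- of_int (\<Sum>\<gamma>\<in>Str. k \<gamma>) / of_nat (card Str)) * kf \<alpha> \<alpha>"
    using sum0 card by (simp add: field_simps add_eq_0_iff2)
  then show ?thesis by (rule that)
qed

text \<open>By rationality of the Cartan numbers an isotropic root would be orthogonal to all roots, and then, by the
  trace formula, to all of \<open>h\<close>.\<close>

lemma kf_root_nonzero: assumes \<alpha>: "\<alpha> \<in> \<Phi>" shows "kf \<alpha> \<alpha> \<noteq> 0"
proof
  assume 0: "kf \<alpha> \<alpha> = 0"
  have "kf \<beta> \<alpha> = 0" if "\<beta> \<in> \<Phi>" for \<beta>
    by (rule cartan_number_real[OF \<alpha> that]) (simp add: 0)
  then have "kf \<alpha> H = 0" if "H \<in> h" for H
    using kf_h_h[OF root_in_h[OF \<alpha>] that] by simp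
  then show False using kf_nondegenerate_h root_in_h root_nonzero \<alpha> by blast
qed

text \<open>With \<open>(\<gamma>, \<alpha>) = r\<^sub>\<gamma> (\<alpha>, \<alpha>)\<close> the trace formula reads \<open>(\<alpha>, \<alpha>) = (\<alpha>, \<alpha>)\<^sup>2 \<Sum> r\<^sub>\<gamma>\<^sup>2\<close>, so \<open>(\<alpha>, \<alpha>)\<close> is the
  inverse of a real number.\<close>

lemma kf_roots_real: assumes \<alpha>: "\<alpha> \<in> \<Phi>" and \<beta>: "\<beta> \<in> \<Phi>" shows "kf \<beta> \<alpha> \<in> \<real>"
proof -
  obtain r where r: "\<And>\<gamma>. \<gamma> \<in> \<Phi> \<Longrightarrow> kf \<gamma> \<alpha> = of_real (r \<gamma>) * kf \<alpha> \<alpha>"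
  proof -
    have "\<forall>\<gamma>. \<exists>r. \<gamma> \<in> \<Phi> \<longrightarrow> kf \<gamma> \<alpha> = complex_of_real r * kf \<alpha> \<alpha>"
      using cartan_number_real[OF \<alpha>] by blast
    then have "\<exists>r. \<forall>\<gamma>. \<gamma> \<in> \<Phi> \<longrightarrow> kf \<gamma> \<alpha> = complex_of_real (r \<gamma>) * kf \<alpha> \<alpha>" by (rule choice)
    then show ?thesis using that by blast
  qed
  have "kf \<alpha> \<alpha> = (\<Sum>\<gamma>\<in>\<Phi>. kf \<gamma> \<alpha> * kf \<gamma> \<alpha>)" using kf_h_h root_in_h \<alpha> by blast
  also have "\<dots> = (\<Sum>\<gamma>\<in>\<Phi>. of_real ((r \<gamma>)\<^sup>2) * (kf \<alpha> \<alpha> * kf \<alpha> \<alpha>))"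
    using r by (intro sum.cong) (auto simp: power2_eq_square)
  also have "\<dots> = of_real (\<Sum>\<gamma>\<in>\<Phi>. (r \<gamma>)\<^sup>2) * (kf \<alpha> \<alpha> * kf \<alpha> \<alpha>)"
    by (simp add: sum_distrib_right)
  finally have "of_real (\<Sum>\<gamma>\<in>\<Phi>. (r \<gamma>)\<^sup>2) * kf \<alpha> \<alpha> = 1"
    using kf_root_nonzero[OF \<alpha>] by (simp only: mult.assoc[symmetric] mult_cancel_right1) simp
  then have "kf \<alpha> \<alpha> = inverse (of_real (\<Sum>\<gamma>\<in>\<Phi>. (r \<gamma>)\<^sup>2))"
    by (metis inverse_unique)
  then have "kf \<alpha> \<alpha> \<in> \<real>" by simp
  then show ?thesis using r[OF \<beta>] by simp
qed

text \<open>On real combinations of roots the Killing form is a sum of squares of real numbers, hence definite.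
  Real and imaginary parts reduce a complex combination to this case.\<close>

lemma kf_nondegenerate_root_span:
  assumes \<Gamma>: "\<Gamma> \<subseteq> \<Phi>" and z: "z \<in> vec.span \<Gamma>" and orth: "\<And>\<gamma>. \<gamma> \<in> \<Gamma> \<Longrightarrow> kf \<gamma> z = 0"
  shows "z = 0"
proof -
  have fin: "finite \<Gamma>" using \<Gamma> finite_roots finite_subset by blast
  obtain c where c: "z = (\<Sum>\<gamma>\<in>\<Gamma>. c \<gamma> *s \<gamma>)"
    using z vec.span_finite[OF fin] by auto
  define y where "y r = (\<Sum>\<gamma>\<in>\<Gamma>. complex_of_real (r \<gamma>) *s \<gamma>)" for r :: "complex ^ 'n \<Rightarrow> real"
  have real: "kf \<delta> (y r) \<in> \<real>" if "\<delta> \<in> \<Phi>" for \<delta> r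
    unfolding y_def kf_linear using kf_roots_real \<Gamma> that by (auto intro!: sum_in_Reals Reals_mult)
  have definite: "y r = 0" if o: "\<And>\<gamma>. \<gamma> \<in> \<Gamma> \<Longrightarrow> kf \<gamma> (y r) = 0" for r
  proof -
    have yh: "y r \<in> h" unfolding y_def
      using h_subspace \<Gamma> root_in_h by (auto intro!: vec.subspace_sum vec.subspace_scale)
    have "kf (y r) (y r) = 0" using o by (subst y_def) (simp add: kf_linear)
    then have "(\<Sum>\<delta>\<in>\<Phi>. kf \<delta> (y r) * kf \<delta> (y r)) = 0" using kf_h_h[OF yh yh] by simp
    moreover have "kf \<delta> (y r) * kf \<delta> (y r) = of_real ((Re (kf \<delta> (y r)))\<^sup>2)" if "\<delta> \<in> \<Phi>" for \<delta>
      using real[OF that, of r] by (auto simp: power2_eq_square elim!: Reals_cases)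
    ultimately have "complex_of_real (\<Sum>\<delta>\<in>\<Phi>. (Re (kf \<delta> (y r)))\<^sup>2) = 0" by simp
    then have "(\<Sum>\<delta>\<in>\<Phi>. (Re (kf \<delta> (y r)))\<^sup>2) = 0" by (simp only: of_real_eq_0_iff)
    then have "\<forall>\<delta>\<in>\<Phi>. (Re (kf \<delta> (y r)))\<^sup>2 = 0" using finite_roots by (subst (asm) sum_nonneg_eq_0_iff) auto
    then have "kf \<delta> (y r) = 0" if "\<delta> \<in> \<Phi>" for \<delta>
      using real[OF that, of r] that by (auto elim!: Reals_cases)
    then have "kf (y r) H = 0" if "H \<in> h" for H using kf_h_h[OF yh that] by simp
    then show ?thesis using kf_nondegenerate_h yh by blast
  qed
  define zr where "zr = y (\<lambda>\<gamma>. Re (c \<gamma>))"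
  define zi where "zi = y (\<lambda>\<gamma>. Im (c \<gamma>))"
  have split: "z = zr + \<i> *s zi"
  proof -
    have "c \<gamma> *s \<gamma> = complex_of_real (Re (c \<gamma>)) *s \<gamma> + \<i> *s (complex_of_real (Im (c \<gamma>)) *s \<gamma>)" for \<gamma>
      by (subst complex_eq[of "c \<gamma>"]) (simp only: vec.scale_left_distrib vec.scale_scale)
    then show ?thesis by (simp add: c zr_def zi_def y_def sum.distrib vec.scale_sum_right)
  qed
  have both: "kf \<gamma> zr = 0 \<and> kf \<gamma> zi = 0" if "\<gamma> \<in> \<Gamma>" for \<gamma>
  proof -
    have "kf \<gamma> zr + \<i> * kf \<gamma> zi = 0" using orth[OF that] by (simp add: split kf_linear)
    moreover have "kf \<gamma> zr \<in> \<real>" "kf \<gamma> zi \<in> \<real>" using real that \<Gamma> by (auto simp: zr_def zi_def)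
    ultimately show ?thesis by (auto elim!: Reals_cases simp: complex_eq_iff)
  qed
  have "zr = 0" "zi = 0" using definite both unfolding zr_def zi_def by blast+
  then show ?thesis using split by simp
qed

text \<open>The map \<open>v \<mapsto> \<Sum> (\<gamma>, v) \<gamma>\<close> sends the span of \<open>\<Gamma>\<close> injectively, hence onto, itself; the required \<open>w\<close> has
  the same image as \<open>u\<close>.\<close>

lemma root_span_complement:
  assumes \<Gamma>: "\<Gamma> \<subseteq> \<Phi>" and ind: "vec.independent \<Gamma>"
  obtains w where "w \<in> vec.span \<Gamma>" "\<And>\<gamma>. \<gamma> \<in> \<Gamma> \<Longrightarrow> kf \<gamma> (u - w) = 0"
proof -
  have fin: "finite \<Gamma>" using \<Gamma> finite_roots finite_subset by blast
  define L where "L v = (\<Sum>\<gamma>\<in>\<Gamma>. kf \<gamma> v *s \<gamma>)" for v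
  have lin: "Vector_Spaces.linear (*s) (*s) L"
    by unfold_locales (simp_all add: L_def kf_linear vec.scale_left_distrib sum.distrib vec.scale_sum_right)
  have ker: "kf \<gamma> v = 0" if "L v = 0" "\<gamma> \<in> \<Gamma>" for v \<gamma>
    using vec.independentD[OF ind fin order_refl, of "\<lambda>\<gamma>. kf \<gamma> v" \<gamma>] that by (simp add: L_def)
  have inj: "inj_on L (vec.span \<Gamma>)"
  proof (rule inj_onI)
    fix u v assume uv: "u \<in> vec.span \<Gamma>" "v \<in> vec.span \<Gamma>" "L u = L v"
    then have "L (u - v) = 0" by (simp add: vec.linear_diff[OF lin])
    then have "u - v = 0" using ker kf_nondegenerate_root_span[OF \<Gamma>] uv vec.span_diff by blast
    then show "u = v" by simp
  qed
  have "L v \<in> vec.span \<Gamma>" for v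
    unfolding L_def by (intro vec.span_sum vec.span_scale vec.span_base)
  then have "L ` vec.span \<Gamma> = vec.span \<Gamma>"
    using vec.subspace_dim_equal[of "L ` vec.span \<Gamma>" "vec.span \<Gamma>"] vec.dim_image_eq[OF lin, of "vec.span \<Gamma>"] inj
      vec.linear_subspace_image[OF lin vec.subspace_span]
    by (simp add: image_subset_iff vec.span_span)
  moreover have "L u \<in> vec.span \<Gamma>" by fact
  ultimately obtain w where w: "w \<in> vec.span \<Gamma>" "L w = L u" by (metis image_iff)
  then have "L (u - w) = 0" by (simp add: vec.linear_diff[OF lin])
  then show ?thesis using that w(1) ker by blast
qed

section \<open>Brackets in root coordinates\<close>

lemma hp_br_e_e: assumes "\<beta> \<in> \<Phi>" "\<gamma> \<in> \<Phi>"
  shows "hp (br (e \<beta>) (e \<gamma>)) = (if \<gamma> = - \<beta> then \<beta> else 0)"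
proof (cases "\<beta> + \<gamma> = 0")
  case True
  then have "\<gamma> = - \<beta>" by (metis add_eq_0_iff)
  then show ?thesis using assms by (simp add: br_e_neg hp_h root_in_h)
next
  case False
  then have ne: "\<gamma> \<noteq> - \<beta>" by auto
  show ?thesis
  proof (cases "\<beta> + \<gamma> \<in> \<Phi>")
    case True
    then have "hp (br (e \<beta>) (e \<gamma>)) = hp (cf (\<beta> + \<gamma>) (br (e \<beta>) (e \<gamma>)) *s e (\<beta> + \<gamma>))"
      using br_e_e[OF assms] by simp
    then show ?thesis using True ne by (simp add: hp_linear hp_e)
  qed (use br_e_e_zero assms False ne in \<open>simp add: hp_more\<close>)
qed

lemma cf_br_e_e_zero: assumes "\<alpha> \<in> \<Phi>" "\<beta> \<in> \<Phi>" "\<gamma> \<in> \<Phi>" "\<alpha> \<noteq> \<beta> + \<gamma>"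
  shows "cf \<alpha> (br (e \<beta>) (e \<gamma>)) = 0"
proof -
  consider "\<beta> + \<gamma> = 0" | "\<beta> + \<gamma> \<noteq> 0" "\<beta> + \<gamma> \<notin> \<Phi>" | "\<beta> + \<gamma> \<in> \<Phi>" by blast
  then show ?thesis
  proof cases
    case 1
    then have "\<gamma> = - \<beta>" by (metis add_eq_0_iff)
    then show ?thesis using assms by (simp add: br_e_neg cf_h root_in_h)
  next
    case 2 then show ?thesis using br_e_e_zero assms by (simp add: cf_linear)
  next
    case 3
    have "cf \<alpha> (br (e \<beta>) (e \<gamma>)) = cf \<alpha> (cf (\<beta> + \<gamma>) (br (e \<beta>) (e \<gamma>)) *s e (\<beta> + \<gamma>))"
      using br_e_e[OF assms(2,3) 3] by simp
    also have "\<dots> = 0" using 3 assms by (simp add: cf_linear cf_e)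
    finally show ?thesis .
  qed
qed

definition part :: "(complex ^ 'n) set \<Rightarrow> complex ^ 'n \<Rightarrow> complex ^ 'n" where
  "part A u = (\<Sum>\<alpha>\<in>A. cf \<alpha> u *s e \<alpha>)"

lemma hp_part: "A \<subseteq> \<Phi> \<Longrightarrow> hp (part A u) = 0"
  by (auto simp: part_def hp_more hp_linear intro!: sum_cong_zero hp_e)

lemma cf_part: assumes "A \<subseteq> \<Phi>" "\<alpha> \<in> \<Phi>" shows "cf \<alpha> (part A u) = (if \<alpha> \<in> A then cf \<alpha> u else 0)"
proof -
  have fin: "finite A" using assms finite_roots finite_subset by blast
  have "cf \<alpha> (part A u) = (\<Sum>\<beta>\<in>A. if \<beta> = \<alpha> then cf \<beta> u else 0)"
    unfolding part_def cf_linear using assms by (intro sum.cong) (auto simp: cf_e)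
  then show ?thesis using fin by simp
qed

lemma expansion_part: "u = hp u + part \<Phi> u"
  using expansion by (simp add: part_def)

text \<open>On pairs of root components the bracket of \<open>g\<close>, the bracket of \<open>g'\<close> and the sum \<open>[R B, B'] + [B, R B']\<close>
  differ only by a weight, while elements of \<open>h\<close> act diagonally.\<close>

definition h_action :: "complex ^ 'n \<Rightarrow> complex ^ 'n \<Rightarrow> complex ^ 'n" where
  "h_action H u = (\<Sum>\<alpha>\<in>\<Phi>. (kf \<alpha> H * cf \<alpha> u) *s e \<alpha>)"

definition weighted_bracket :: "(complex ^ 'n \<Rightarrow> complex ^ 'n \<Rightarrow> complex) \<Rightarrow> complex ^ 'n \<Rightarrow> complex ^ 'n \<Rightarrow> complex ^ 'n" where
  "weighted_bracket w u v = (\<Sum>\<beta>\<in>\<Phi>. \<Sum>\<gamma>\<in>\<Phi>. (w \<beta> \<gamma> * (cf \<beta> u * cf \<gamma> v)) *s br (e \<beta>) (e \<gamma>))"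

lemma hp_h_action: "hp (h_action H u) = 0" and cf_h_action: "\<alpha> \<in> \<Phi> \<Longrightarrow> cf \<alpha> (h_action H u) = kf \<alpha> H * cf \<alpha> u"
  by (simp_all add: h_action_def hp_root_sum cf_root_sum)

lemma hp_weighted_bracket: "hp (weighted_bracket w u v) = (\<Sum>\<beta>\<in>\<Phi>. (w \<beta> (- \<beta>) * (cf \<beta> u * cf (- \<beta>) v)) *s \<beta>)"
proof -
  have "(\<Sum>\<gamma>\<in>\<Phi>. (w \<beta> \<gamma> * (cf \<beta> u * cf \<gamma> v)) *s hp (br (e \<beta>) (e \<gamma>)))
      = (w \<beta> (- \<beta>) * (cf \<beta> u * cf (- \<beta>) v)) *s \<beta>" if \<beta>: "\<beta> \<in> \<Phi>" for \<beta>
  proof -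
    have "(\<Sum>\<gamma>\<in>\<Phi>. (w \<beta> \<gamma> * (cf \<beta> u * cf \<gamma> v)) *s hp (br (e \<beta>) (e \<gamma>)))
      = (\<Sum>\<gamma>\<in>\<Phi>. if \<gamma> = - \<beta> then (w \<beta> \<gamma> * (cf \<beta> u * cf \<gamma> v)) *s \<beta> else 0)"
      using \<beta> by (intro sum.cong) (auto simp: hp_br_e_e)
    then show ?thesis using finite_roots neg_root[OF \<beta>] by simp
  qed
  then show ?thesis by (simp add: weighted_bracket_def hp_more hp_linear)
qed

lemma cf_weighted_bracket: "cf \<alpha> (weighted_bracket w u v) = (\<Sum>\<beta>\<in>\<Phi>. \<Sum>\<gamma>\<in>\<Phi>. w \<beta> \<gamma> * (cf \<beta> u * cf \<gamma> v) * cf \<alpha> (br (e \<beta>) (e \<gamma>)))"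
  by (simp add: weighted_bracket_def cf_linear)

lemma weighted_bracket_add: "weighted_bracket (\<lambda>\<beta> \<gamma>. w \<beta> \<gamma> + w' \<beta> \<gamma>) u v = weighted_bracket w u v + weighted_bracket w' u v"
  and weighted_bracket_minus: "weighted_bracket (\<lambda>\<beta> \<gamma>. - w \<beta> \<gamma>) u v = - weighted_bracket w u v"
  by (simp_all add: weighted_bracket_def distrib_right vec.scale_left_distrib sum.distrib sum_negf)

lemma br_h_part: assumes "A \<subseteq> \<Phi>" "H \<in> h" shows "br H (part A u) = h_action H (part A u)"
proof (rule eqI_cf)
  have eq: "br H (part A u) = (\<Sum>\<alpha>\<in>A. (kf \<alpha> H * cf \<alpha> u) *s e \<alpha>)"
    using assms by (simp add: part_def br_sum_right br_scale_right br_h_e subset_iff mult.commute)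
  show "hp (br H (part A u)) = hp (h_action H (part A u))"
    unfolding eq using assms by (auto simp: hp_h_action hp_more hp_linear intro!: sum_cong_zero hp_e)
  fix \<alpha> assume \<alpha>: "\<alpha> \<in> \<Phi>"
  have fin: "finite A" using assms finite_roots finite_subset by blast
  have "cf \<alpha> (br H (part A u)) = (\<Sum>\<beta>\<in>A. if \<beta> = \<alpha> then kf \<beta> H * cf \<beta> u else 0)"
    unfolding eq cf_linear using assms \<alpha> by (intro sum.cong) (auto simp: cf_e)
  then show "cf \<alpha> (br H (part A u)) = cf \<alpha> (h_action H (part A u))"
    using \<alpha> fin assms by (simp add: cf_h_action cf_part)
qed

lemma br_part_part: assumes "A \<subseteq> \<Phi>" "B \<subseteq> \<Phi>"
  shows "br (part A u) (part B v) = weighted_bracket (\<lambda>\<beta> \<gamma>. of_bool (\<beta> \<in> A \<and> \<gamma> \<in> B)) u v"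
proof -
  have "br (part A u) (part B v) = (\<Sum>\<beta>\<in>A. \<Sum>\<gamma>\<in>B. (cf \<beta> u * cf \<gamma> v) *s br (e \<beta>) (e \<gamma>))"
    by (simp add: part_def[of A] br_sum_left br_scale_left)
       (simp add: part_def br_sum_right br_scale_right vec.scale_sum_right)
  also have "\<dots> = (\<Sum>\<beta>\<in>\<Phi>. \<Sum>\<gamma>\<in>\<Phi>. (of_bool (\<beta> \<in> A \<and> \<gamma> \<in> B) * (cf \<beta> u * cf \<gamma> v)) *s br (e \<beta>) (e \<gamma>))"
  proof (rule sum.mono_neutral_cong_left[OF finite_roots assms(1)])
    show "(\<Sum>\<gamma>\<in>B. (cf \<beta> u * cf \<gamma> v) *s br (e \<beta>) (e \<gamma>))
      = (\<Sum>\<gamma>\<in>\<Phi>. (of_bool (\<beta> \<in> A \<and> \<gamma> \<in> B) * (cf \<beta> u * cf \<gamma> v)) *s br (e \<beta>) (e \<gamma>))" if "\<beta> \<in> A" for \<beta>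
      using that by (intro sum.mono_neutral_cong_left[OF finite_roots assms(2)]) auto
  qed auto
  finally show ?thesis by (simp add: weighted_bracket_def)
qed

lemma br_coordinates: "br u v = h_action (hp u) v - h_action (hp v) u + weighted_bracket (\<lambda>_ _. 1) u v"
proof -
  have "br u v = br (hp u + part \<Phi> u) (hp v + part \<Phi> v)" using expansion_part by metis
  also have "\<dots> = br (hp u) (part \<Phi> v) - br (hp v) (part \<Phi> u) + br (part \<Phi> u) (part \<Phi> v)"
    using br_skew[of "part \<Phi> u" "hp v"] by (simp add: br_add_left br_add_right h_abelian hp_in_h)
  also have "br (part \<Phi> u) (part \<Phi> v) = weighted_bracket (\<lambda>_ _. 1) u v"
    unfolding br_part_part[OF order_refl order_refl] weighted_bracket_def by (intro sum.cong refl) simp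
  finally show ?thesis by (simp add: br_h_part hp_in_h h_action_def cf_part)
qed

end

lemma proj_eqI:
  fixes X Y :: "(complex ^ 'n) set"
  assumes "vec.subspace X" "vec.subspace Y" "X \<inter> Y \<subseteq> {0}" "a \<in> X" "u - a \<in> Y"
  shows "proj X Y u = a"
  unfolding proj_def
proof (rule the_equality)
  fix b assume b: "b \<in> X \<and> u - b \<in> Y"
  have "b - a \<in> X" using b assms vec.subspace_diff by blast
  moreover have "b - a \<in> Y" using vec.subspace_diff[OF assms(2) assms(5), of "u - b"] b by simp
  ultimately show "b = a" using assms(3) by auto
qed (use assms in auto)

lemma span_Un_span: "vec.span (A \<union> vec.span B) = vec.span (A \<union> B)"
proof (rule antisym)
  show "vec.span (A \<union> vec.span B) \<subseteq> vec.span (A \<union> B)"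
    using vec.span_superset[of "A \<union> B"] vec.span_mono[of B "A \<union> B"]
    by (intro vec.span_minimal vec.subspace_span) auto
  show "vec.span (A \<union> B) \<subseteq> vec.span (A \<union> vec.span B)"
    using vec.span_superset[of B] by (intro vec.span_mono) auto
qed

context dynamical_r_matrix
begin

lemma \<Gamma>_roots: "\<Gamma> \<subseteq> \<Phi>" and \<Gamma>_independent: "vec.independent \<Gamma>"
  using simple_roots \<Gamma>_simple vec.independent_mono by (auto simp: simple_system_def)

section \<open>The grading by simple roots outside \<open>\<Gamma>\<close>\<close>

text \<open>The number of simple roots outside \<open>\<Gamma>\<close> in a root is additive and its sign distinguishes the three
  kinds of roots.\<close>

lemma grading_exists:
  "\<exists>d :: complex ^ 'n \<Rightarrow> real. (\<forall>u v. d (u + v) = d u + d v) \<and>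
     (\<forall>\<alpha>\<in>\<Phi>. (\<alpha> \<in> root_span \<longleftrightarrow> d \<alpha> = 0) \<and> (\<alpha> \<in> pos_compl \<longleftrightarrow> 0 < d \<alpha>) \<and> (\<alpha> \<in> neg_compl \<longleftrightarrow> d \<alpha> < 0))"
proof -
  have ind: "vec.independent S" using simple_roots by (simp add: simple_system_def)
  then have fin: "finite S" by (rule vec.finiteI_independent)
  \<comment> \<open>A linear functional with prescribed values on \<open>S\<close>, as one coordinate of a linear endomorphism.\<close>
  define i :: 'n where "i = undefined"
  obtain g :: "complex ^ 'n \<Rightarrow> complex ^ 'n" where g: "Vector_Spaces.linear (*s) (*s) g"
    "\<forall>\<beta>\<in>S. g \<beta> = (if \<beta> \<in> \<Gamma> then 0 else axis i 1)"
    using vec.linear_independent_extend[OF ind, of "\<lambda>\<beta>. if \<beta> \<in> \<Gamma> then 0 else axis i 1"] by blast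
  define d where "d u = Re (g u $ i)" for u
  have add: "d (u + v) = d u + d v" for u v by (simp add: d_def vec.linear_add[OF g(1)])
  have neg: "d (- u) = - d u" for u by (simp add: d_def vec.linear_neg[OF g(1)])
  have span: "d u = 0" if "u \<in> vec.span \<Gamma>" for u
  proof -
    have "g u = 0" using that
    proof (induction u rule: vec.span_induct)
      case base show ?case using g(1) by (intro vec.subspaceI)
          (simp_all add: vec.linear_0 vec.linear_add vec.linear_scale)
    next
      case (step a) then show ?case using g(2) \<Gamma>_simple by auto
    qed
    then show ?thesis by (simp add: d_def)
  qed
  have nat: "0 \<le> d u \<and> (d u = 0 \<longrightarrow> u \<in> vec.span \<Gamma>)" if u: "u \<in> nat_comb S" for u
  proof -
    obtain c :: "complex ^ 'n \<Rightarrow> nat" where c: "u = (\<Sum>\<beta>\<in>S. of_nat (c \<beta>) *s \<beta>)"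
      using u unfolding nat_comb_def by blast
    have "d u = (\<Sum>\<beta>\<in>S. Re (of_nat (c \<beta>) * g \<beta> $ i))"
      by (simp add: d_def c vec.linear_sum[OF g(1)] vec.linear_scale[OF g(1)])
    also have "\<dots> = (\<Sum>\<beta>\<in>S. if \<beta> \<in> \<Gamma> then 0 else real (c \<beta>))"
      using g(2) by (intro sum.cong) auto
    finally have d: "d u = (\<Sum>\<beta>\<in>S. if \<beta> \<in> \<Gamma> then 0 else real (c \<beta>))" .
    have "u \<in> vec.span \<Gamma>" if "d u = 0"
    proof -
      have zero: "\<forall>\<beta>\<in>S. (if \<beta> \<in> \<Gamma> then 0 else real (c \<beta>)) = 0"
        using that fin unfolding d by (subst (asm) sum_nonneg_eq_0_iff) auto
      have "of_nat (c \<beta>) *s \<beta> \<in> vec.span \<Gamma>" if \<beta>: "\<beta> \<in> S" for \<beta>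
      proof (cases "\<beta> \<in> \<Gamma>")
        case True then show ?thesis by (intro vec.span_scale vec.span_base)
      next
        case False
        then have "c \<beta> = 0" using bspec[OF zero \<beta>] by simp
        then show ?thesis by (simp add: vec.span_zero)
      qed
      then show ?thesis unfolding c by (intro vec.span_sum) auto
    qed
    then show ?thesis unfolding d by (auto intro: sum_nonneg)
  qed
  have "(\<alpha> \<in> root_span \<longleftrightarrow> d \<alpha> = 0) \<and> (\<alpha> \<in> pos_compl \<longleftrightarrow> 0 < d \<alpha>) \<and> (\<alpha> \<in> neg_compl \<longleftrightarrow> d \<alpha> < 0)"
    if \<alpha>: "\<alpha> \<in> \<Phi>" for \<alpha>
  proof -
    have "\<alpha> \<in> nat_comb S \<or> - \<alpha> \<in> nat_comb S" using simple_roots \<alpha> by (simp add: simple_system_def)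
    moreover have "- \<alpha> \<in> vec.span \<Gamma> \<longleftrightarrow> \<alpha> \<in> vec.span \<Gamma>"
      using vec.span_neg[of \<alpha> \<Gamma>] vec.span_neg[of "- \<alpha>" \<Gamma>] by auto
    ultimately show ?thesis
      using nat[of \<alpha>] nat[of "- \<alpha>"] neg[of \<alpha>] span[of \<alpha>] \<alpha>
      by (auto simp: root_span_def pos_compl_def neg_compl_def pos_roots_def neg_roots_def)
  qed
  then show ?thesis using add by blast
qed

definition deg :: "complex ^ 'n \<Rightarrow> real" where
  "deg = (SOME d. (\<forall>u v. d (u + v) = d u + d v) \<and>
     (\<forall>\<alpha>\<in>\<Phi>. (\<alpha> \<in> root_span \<longleftrightarrow> d \<alpha> = 0) \<and> (\<alpha> \<in> pos_compl \<longleftrightarrow> 0 < d \<alpha>) \<and> (\<alpha> \<in> neg_compl \<longleftrightarrow> d \<alpha> < 0)))"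

lemma deg_properties: "(\<forall>u v. deg (u + v) = deg u + deg v) \<and>
     (\<forall>\<alpha>\<in>\<Phi>. (\<alpha> \<in> root_span \<longleftrightarrow> deg \<alpha> = 0) \<and> (\<alpha> \<in> pos_compl \<longleftrightarrow> 0 < deg \<alpha>) \<and> (\<alpha> \<in> neg_compl \<longleftrightarrow> deg \<alpha> < 0))"
  unfolding deg_def by (rule someI_ex[OF grading_exists])

lemma deg_add: "deg (u + v) = deg u + deg v"
  and root_span_iff: "\<alpha> \<in> \<Phi> \<Longrightarrow> \<alpha> \<in> root_span \<longleftrightarrow> deg \<alpha> = 0"
  and pos_compl_iff: "\<alpha> \<in> \<Phi> \<Longrightarrow> \<alpha> \<in> pos_compl \<longleftrightarrow> 0 < deg \<alpha>"
  and neg_compl_iff: "\<alpha> \<in> \<Phi> \<Longrightarrow> \<alpha> \<in> neg_compl \<longleftrightarrow> deg \<alpha> < 0"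
  using deg_properties by simp_all

lemma deg_minus: "deg (- u) = - deg u"
  using deg_add[of u "- u"] deg_add[of 0 0] by simp

lemma root_kinds_sub: "root_span \<subseteq> \<Phi>" "pos_compl \<subseteq> \<Phi>" "neg_compl \<subseteq> \<Phi>"
  by (auto simp: root_span_def pos_compl_def neg_compl_def pos_roots_def neg_roots_def)

lemma roots_split: "root_span \<union> (pos_compl \<union> neg_compl) = \<Phi>"
proof
  show "\<Phi> \<subseteq> root_span \<union> (pos_compl \<union> neg_compl)"
  proof
    fix \<alpha> assume "\<alpha> \<in> \<Phi>"
    then show "\<alpha> \<in> root_span \<union> (pos_compl \<union> neg_compl)"
      using root_span_iff pos_compl_iff neg_compl_iff by (cases "deg \<alpha>" "0::real" rule: linorder_cases) auto
  qed
qed (simp add: root_kinds_sub)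

lemma roots_disjoint: "root_span \<inter> (pos_compl \<union> neg_compl) = {}" "pos_compl \<inter> neg_compl = {}"
proof -
  show "root_span \<inter> (pos_compl \<union> neg_compl) = {}" by (auto simp: pos_compl_def neg_compl_def)
  have False if \<alpha>: "\<alpha> \<in> pos_compl" "\<alpha> \<in> neg_compl" for \<alpha>
  proof -
    have "\<alpha> \<in> \<Phi>" using \<alpha>(1) root_kinds_sub(2) by (rule rev_subsetD)
    then show False using \<alpha> pos_compl_iff[of \<alpha>] neg_compl_iff[of \<alpha>] by simp
  qed
  then show "pos_compl \<inter> neg_compl = {}" by auto
qed

section \<open>The bracket of \<open>g'\<close>\<close>

text \<open>All subspaces from which \<open>g'\<close> is built have this form, with \<open>W\<close> a subspace of \<open>h\<close> and \<open>A\<close> a set of roots.\<close>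

definition component_space :: "(complex ^ 'n) set \<Rightarrow> (complex ^ 'n) set \<Rightarrow> (complex ^ 'n) set" where
  "component_space W A = {u. hp u \<in> W \<and> (\<forall>\<alpha>\<in>\<Phi> - A. cf \<alpha> u = 0)}"

lemma component_space_subspace: "vec.subspace W \<Longrightarrow> vec.subspace (component_space W A)"
  unfolding component_space_def by (rule vec.subspaceI)
    (auto simp: hp_linear hp_more cf_linear vec.subspace_0 vec.subspace_add vec.subspace_scale)

lemma component_space_decompose: assumes "u \<in> component_space W A" "A \<subseteq> \<Phi>" shows "u = hp u + part A u"
  
  by (rule eqI_cf) (use assms in \<open>auto simp: component_space_def hp_linear cf_linear hp_h hp_in_h hp_part cf_part cf_h\<close>)

lemma span_component_space: assumes W: "vec.subspace W" "W \<subseteq> h" and A: "A \<subseteq> \<Phi>"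
  shows "vec.span (W \<union> e ` A) = component_space W A"
proof (rule antisym)
  have 1: "W \<subseteq> component_space W A" using W(2) by (auto simp: component_space_def hp_h cf_h subset_iff)
  have 2: "e ` A \<subseteq> component_space W A"
    using A vec.subspace_0[OF W(1)] by (auto simp: component_space_def hp_e cf_e subset_iff)
  show "vec.span (W \<union> e ` A) \<subseteq> component_space W A"
    using 1 2 component_space_subspace[OF W(1)] by (intro vec.span_minimal) auto
  show "component_space W A \<subseteq> vec.span (W \<union> e ` A)"
  proof
    fix u assume u: "u \<in> component_space W A"
    have "hp u \<in> vec.span (W \<union> e ` A)" using u by (auto simp: component_space_def intro: vec.span_base)
    moreover have "part A u \<in> vec.span (W \<union> e ` A)"
      unfolding part_def by (intro vec.span_sum vec.span_scale vec.span_base) auto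
    ultimately show "u \<in> vec.span (W \<union> e ` A)"
      using component_space_decompose[OF u A] vec.span_add by metis
  qed
qed

lemma span_component_space_zero: assumes A: "A \<subseteq> \<Phi>" shows "vec.span (e ` A) = component_space {0} A"
proof -
  have "component_space {0} A = vec.span (insert 0 (e ` A))" using span_component_space[OF vec.subspace_single_0 _ A] h_subspace
    by (simp add: vec.subspace_0)
  then show ?thesis by (simp add: vec.span_insert_0)
qed

lemma proj_component_space:
  assumes W: "vec.subspace W" "vec.subspace W'" "W \<inter> W' \<subseteq> {0}" "W \<subseteq> h"
    and A: "A \<subseteq> \<Phi>" "A' \<subseteq> \<Phi>" "A \<inter> A' = {}"
    and w: "w \<in> W" "hp u - w \<in> W'" and supp: "\<And>\<alpha>. \<alpha> \<in> \<Phi> - (A \<union> A') \<Longrightarrow> cf \<alpha> u = 0"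
  shows "proj (component_space W A) (component_space W' A') u = w + part A u"
proof (rule proj_eqI)
  show "component_space W A \<inter> component_space W' A' \<subseteq> {0}"
  proof
    fix v assume v: "v \<in> component_space W A \<inter> component_space W' A'"
    have "v = 0"
      by (rule eqI_cf) (use v W A in \<open>auto simp: component_space_def hp_more cf_linear\<close>)
    then show "v \<in> {0}" by simp
  qed
  have wh: "hp w = w" using w W hp_h by blast
  show "w + part A u \<in> component_space W A"
    using w(1) wh A W by (auto simp: component_space_def hp_linear hp_part cf_linear cf_part cf_h subset_iff)
  show "u - (w + part A u) \<in> component_space W' A'"
    using w(2) wh A W(4) w(1) supp by (auto simp: component_space_def hp_linear hp_more hp_part cf_linear cf_part cf_h subset_iff)
qed (use W component_space_subspace in auto)

lemma n_component_space: "n = component_space {0} \<Phi>"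
  unfolding n_def by (rule span_component_space_zero) simp

lemma h_component_space: "h = component_space h {}"
  using span_component_space[OF h_subspace order_refl, of "{}"] vec.span_eq_iff[of h] h_subspace by simp

lemma proj_h_eq: "proj_h u = hp u"
  unfolding proj_h_def
  by (subst h_component_space, subst n_component_space, subst proj_component_space[where w="hp u"])
     (auto simp: h_subspace hp_in_h part_def)

lemma proj_n_eq: "proj_n u = part \<Phi> u"
  unfolding proj_n_def
  by (subst h_component_space, subst n_component_space, subst proj_component_space[where w=0])
     (auto simp: h_subspace hp_in_h vec.subspace_0)

lemma n_iff: "u \<in> n \<longleftrightarrow> hp u = 0"
  by (simp add: n_component_space component_space_def)

lemma n_pos_component_space: "n_pos = component_space {0} pos_compl" and n_neg_component_space: "n_neg = component_space {0} neg_compl"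
  unfolding n_pos_def n_neg_def by (intro span_component_space_zero root_kinds_sub)+

lemma h\<Gamma>_h: "h\<Gamma> \<subseteq> h" and h\<Gamma>_perp_h: "h\<Gamma>_perp \<subseteq> h"
  using vec.span_minimal[of \<Gamma> h] h_subspace \<Gamma>_roots root_in_h by (auto simp: h\<Gamma>_def h\<Gamma>_perp_def)

lemma h\<Gamma>_perp_subspace: "vec.subspace h\<Gamma>_perp"
  unfolding h\<Gamma>_perp_def using h_subspace
  by (intro vec.subspaceI) (auto simp: kf_linear vec.subspace_0 vec.subspace_add vec.subspace_scale)

lemma h\<Gamma>_subspace: "vec.subspace h\<Gamma>"
  by (simp add: h\<Gamma>_def vec.subspace_span)

lemma l\<Gamma>_component_space: "l\<Gamma> = component_space h\<Gamma> root_span"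
  unfolding l\<Gamma>_def by (rule span_component_space[OF h\<Gamma>_subspace h\<Gamma>_h root_kinds_sub(1)])

lemma n_pos_n_neg_component_space: "vec.span (n_pos \<union> n_neg) = component_space {0} (pos_compl \<union> neg_compl)"
proof -
  have "vec.span (n_pos \<union> n_neg) = vec.span (vec.span (e ` pos_compl) \<union> e ` neg_compl)"
    unfolding n_pos_def n_neg_def by (rule span_Un_span)
  also have "\<dots> = vec.span (e ` neg_compl \<union> vec.span (e ` pos_compl))" by (simp only: Un_commute)
  also have "\<dots> = vec.span (e ` neg_compl \<union> e ` pos_compl)" by (rule span_Un_span)
  also have "\<dots> = vec.span (e ` pos_compl \<union> e ` neg_compl)" by (simp only: Un_commute)
  finally show ?thesis using span_component_space_zero[of "pos_compl \<union> neg_compl"] root_kinds_sub by (simp add: image_Un)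
qed

lemma I\<Gamma>_component_space: "vec.span (h\<Gamma>_perp \<union> n_pos \<union> n_neg) = component_space h\<Gamma>_perp (pos_compl \<union> neg_compl)"
proof -
  have "vec.span (h\<Gamma>_perp \<union> n_pos \<union> n_neg) = vec.span (h\<Gamma>_perp \<union> vec.span (n_pos \<union> n_neg))"
    by (simp add: span_Un_span Un_assoc)
  also have "\<dots> = vec.span (h\<Gamma>_perp \<union> vec.span (e ` (pos_compl \<union> neg_compl)))"
    using n_pos_n_neg_component_space span_component_space_zero[of "pos_compl \<union> neg_compl"] root_kinds_sub by simp
  finally show ?thesis
    using span_component_space[OF h\<Gamma>_perp_subspace h\<Gamma>_perp_h, of "pos_compl \<union> neg_compl"] root_kinds_sub
    by (simp add: span_Un_span)
qed

lemma h\<Gamma>_perp_inter: "h\<Gamma> \<inter> h\<Gamma>_perp \<subseteq> {0}"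
proof
  fix z assume "z \<in> h\<Gamma> \<inter> h\<Gamma>_perp"
  then have "z \<in> vec.span \<Gamma>" "\<And>\<gamma>. \<gamma> \<in> \<Gamma> \<Longrightarrow> kf \<gamma> z = 0"
    by (auto simp: h\<Gamma>_def h\<Gamma>_perp_def vec.span_base)
  then show "z \<in> {0}" using kf_nondegenerate_root_span[OF \<Gamma>_roots] by blast
qed

lemma h_decompose: assumes "u \<in> h" obtains w where "w \<in> h\<Gamma>" "u - w \<in> h\<Gamma>_perp"
proof -
  obtain w where w: "w \<in> vec.span \<Gamma>" "\<And>\<gamma>. \<gamma> \<in> \<Gamma> \<Longrightarrow> kf \<gamma> (u - w) = 0"
    using root_span_complement[OF \<Gamma>_roots \<Gamma>_independent] by blast
  have "kf z (u - w) = 0" if "z \<in> vec.span \<Gamma>" for z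
    using that
  proof (induction z rule: vec.span_induct)
    case base show ?case by (rule vec.subspaceI) (simp_all add: kf_add_left kf_scale_left kf_zero)
  qed (rule w(2))
  then show ?thesis
    using that[of w] w(1) assms h\<Gamma>_h h_subspace vec.subspace_diff
    unfolding h\<Gamma>_def h\<Gamma>_perp_def by blast
qed

definition degree_zero :: "complex ^ 'n \<Rightarrow> complex ^ 'n" where
  "degree_zero u = hp u + part root_span u"

text \<open>The splitting \<open>h = h\<Gamma> \<oplus> h\<Gamma>_perp\<close> leaves no trace in the bracket, since both summands act by the bracket
  of \<open>g\<close> on everything; only the grading by degree matters.\<close>

lemma g'_bracket_eq:
  "g'_bracket u v = br (degree_zero u) (degree_zero v)
     + br (degree_zero u) (part pos_compl v + part neg_compl v) - br (degree_zero v) (part pos_compl u + part neg_compl u)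
     + br (part pos_compl u) (part pos_compl v) - br (part neg_compl u) (part neg_compl v)"
proof -
  let ?L = "l\<Gamma>" and ?I = "vec.span (h\<Gamma>_perp \<union> n_pos \<union> n_neg)" and ?N = "vec.span (n_pos \<union> n_neg)"
  let ?p = "part pos_compl" and ?m = "part neg_compl"
  have fin: "finite pos_compl" "finite neg_compl" using root_kinds_sub finite_roots finite_subset by blast+
  have part_Un: "part (pos_compl \<union> neg_compl) u = ?p u + ?m u" for u
    unfolding part_def using fin roots_disjoint(2) by (rule sum.union_disjoint)
  have "\<exists>w. \<forall>u. w u \<in> h\<Gamma> \<and> hp u - w u \<in> h\<Gamma>_perp"
  proof (rule choice, rule allI)
    show "\<exists>w. w \<in> h\<Gamma> \<and> hp u - w \<in> h\<Gamma>_perp" for u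
      using h_decompose[OF hp_in_h[of u]] by blast
  qed
  then obtain a where a: "\<And>u. a u \<in> h\<Gamma>" "\<And>u. hp u - a u \<in> h\<Gamma>_perp" by blast
  define b where "b u = hp u - a u" for u
  have b: "b u \<in> h\<Gamma>_perp" for u using a by (simp add: b_def)
  have hpb: "hp (b u) = b u" for u using b h\<Gamma>_perp_h hp_h by blast
  have L: "proj ?L ?I u = a u + part root_span u" for u
    unfolding l\<Gamma>_component_space I\<Gamma>_component_space using root_kinds_sub roots_disjoint roots_split a h\<Gamma>_h
    by (intro proj_component_space h\<Gamma>_subspace h\<Gamma>_perp_subspace h\<Gamma>_perp_inter) auto
  have I: "proj ?I ?L u = b u + (?p u + ?m u)" for u
    unfolding l\<Gamma>_component_space I\<Gamma>_component_space part_Un[symmetric]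
    using root_kinds_sub roots_disjoint roots_split a b h\<Gamma>_perp_h h\<Gamma>_perp_inter
    by (intro proj_component_space h\<Gamma>_subspace h\<Gamma>_perp_subspace) (auto simp: b_def)
  have perp_component_space: "h\<Gamma>_perp = component_space h\<Gamma>_perp {}"
    using span_component_space[OF h\<Gamma>_perp_subspace h\<Gamma>_perp_h, of "{}"] vec.span_eq_iff[of h\<Gamma>_perp] h\<Gamma>_perp_subspace by simp
  let ?c = "\<lambda>u. b u + (?p u + ?m u)"
  have sub: "pos_compl \<union> neg_compl \<subseteq> \<Phi>" using root_kinds_sub by blast
  have hpc: "hp (?c u) = b u" for u by (simp add: hp_linear hpb hp_part root_kinds_sub)
  have cfc: "cf \<alpha> (?c u) = (if \<alpha> \<in> pos_compl \<union> neg_compl then cf \<alpha> u else 0)" if "\<alpha> \<in> \<Phi>" for \<alpha> u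
    using that b h\<Gamma>_perp_h sub unfolding part_Un[symmetric] by (simp add: cf_linear cf_h cf_part subset_iff)
  have supp: "\<alpha> \<in> \<Phi> - (pos_compl \<union> neg_compl) \<Longrightarrow> cf \<alpha> (?c u) = 0" for \<alpha> u using cfc by auto
  have part_c: "part A (?c u) = part A u" if "A \<subseteq> pos_compl \<union> neg_compl" for A u
    unfolding part_def[of A]
  proof (rule sum.cong[OF refl])
    fix \<alpha> assume "\<alpha> \<in> A"
    then have "\<alpha> \<in> pos_compl \<union> neg_compl" "\<alpha> \<in> \<Phi>" using that sub by blast+
    then show "cf \<alpha> (?c u) *s e \<alpha> = cf \<alpha> u *s e \<alpha>" using cfc[of \<alpha> u] by simp
  qed
  have P: "proj h\<Gamma>_perp ?N (?c u) = b u" for u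
  proof -
    have "proj (component_space h\<Gamma>_perp {}) (component_space {0} (pos_compl \<union> neg_compl)) (?c u) = b u + part {} (?c u)"
      by (rule proj_component_space[OF h\<Gamma>_perp_subspace vec.subspace_single_0 _ h\<Gamma>_perp_h])
         (use sub b hpc supp in auto)
    then show ?thesis using perp_component_space n_pos_n_neg_component_space by (simp add: part_def)
  qed
  have N: "proj ?N h\<Gamma>_perp (?c u) = ?p u + ?m u" for u
  proof -
    have "proj (component_space {0} (pos_compl \<union> neg_compl)) (component_space h\<Gamma>_perp {}) (?c u) = 0 + part (pos_compl \<union> neg_compl) (?c u)"
      by (rule proj_component_space[OF vec.subspace_single_0 h\<Gamma>_perp_subspace])
         (use sub b hpc supp h_subspace in \<open>auto simp: vec.subspace_0\<close>)
    then show ?thesis using perp_component_space n_pos_n_neg_component_space part_c part_Un by simp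
  qed
  let ?d = "\<lambda>u. ?p u + ?m u"
  have hpd: "hp (?d u) = 0" for u by (simp add: hp_linear hp_part root_kinds_sub)
  have part_d: "part A (?d u) = part A u" if "A \<subseteq> pos_compl \<union> neg_compl" for A u
    unfolding part_def[of A]
  proof (rule sum.cong[OF refl])
    fix \<alpha> assume "\<alpha> \<in> A"
    then have "\<alpha> \<in> pos_compl \<union> neg_compl" "\<alpha> \<in> \<Phi>" using that sub by blast+
    then show "cf \<alpha> (?d u) *s e \<alpha> = cf \<alpha> u *s e \<alpha>"
      unfolding part_Un[symmetric] by (simp only: cf_part[OF sub]) simp
  qed
  have suppd: "\<alpha> \<in> \<Phi> - (pos_compl \<union> neg_compl) \<Longrightarrow> cf \<alpha> (?d u) = 0" for \<alpha> u
    unfolding part_Un[symmetric] using sub by (simp add: cf_part)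
  have pos: "proj n_pos n_neg (?d u) = ?p u" and neg: "proj n_neg n_pos (?d u) = ?m u" for u
  proof -
    have "proj (component_space {0} pos_compl) (component_space {0} neg_compl) (?d u) = 0 + part pos_compl (?d u)"
      by (rule proj_component_space[OF vec.subspace_single_0 vec.subspace_single_0])
         (use root_kinds_sub roots_disjoint hpd suppd h_subspace in \<open>auto simp: vec.subspace_0\<close>)
    then show "proj n_pos n_neg (?d u) = ?p u" by (simp add: n_pos_component_space n_neg_component_space part_d)
    have "proj (component_space {0} neg_compl) (component_space {0} pos_compl) (?d u) = 0 + part neg_compl (?d u)"
      by (rule proj_component_space[OF vec.subspace_single_0 vec.subspace_single_0])
         (use root_kinds_sub roots_disjoint hpd suppd h_subspace in \<open>auto simp: vec.subspace_0\<close>)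
    then show "proj n_neg n_pos (?d u) = ?m u" by (simp add: n_pos_component_space n_neg_component_space part_d)
  qed
  have Ib: "I_bracket (?c u) (?c v) = br (b u) (b v) + br (b u) (?d v) - br (b v) (?d u)
      + (br (?p u) (?p v) - br (?m u) (?m v))"
    unfolding I_bracket_def semidirect_bracket_def ominus_bracket_def P N pos neg ..
  have degree_zero: "degree_zero u = a u + part root_span u + b u" for u by (simp add: degree_zero_def b_def)
  have sk: "br (b u) (a v + part root_span v) = - br (a v + part root_span v) (b u)" by (rule br_skew)
  show ?thesis
    unfolding g'_bracket_def semidirect_bracket_def L I Ib degree_zero
    using sk by (simp add: br_add_left br_add_right algebra_simps)
qed

text \<open>The structure constants of \<open>g'\<close> relative to those of \<open>g\<close>.\<close>

definition bracket_sign :: "complex ^ 'n \<Rightarrow> complex ^ 'n \<Rightarrow> complex" where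
  "bracket_sign \<beta> \<gamma> = (if deg \<beta> = 0 \<or> deg \<gamma> = 0 then 1 else if 0 < deg \<beta> \<and> 0 < deg \<gamma> then 1
     else if deg \<beta> < 0 \<and> deg \<gamma> < 0 then - 1 else 0)"

lemma part_sum: "part root_span u + (part pos_compl u + part neg_compl u) = part \<Phi> u"
proof -
  have fin: "finite root_span" "finite pos_compl" "finite neg_compl"
    using root_kinds_sub finite_roots finite_subset by blast+
  have "part \<Phi> u = part root_span u + part (pos_compl \<union> neg_compl) u"
    unfolding part_def roots_split[symmetric] using fin roots_disjoint by (intro sum.union_disjoint) auto
  then show ?thesis unfolding part_def using fin roots_disjoint by (simp add: sum.union_disjoint)
qed

lemma g'_bracket_coordinates:
  "g'_bracket u v = h_action (hp u) v - h_action (hp v) u + weighted_bracket bracket_sign u v"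
proof -
  let ?z = "part root_span" and ?p = "part pos_compl" and ?m = "part neg_compl"
  have "g'_bracket u v = (br (hp u) (?z v + (?p v + ?m v)) - br (hp v) (?z u + (?p u + ?m u)))
     + (br (?z u) (?z v) + br (?z u) (?p v) + br (?z u) (?m v) + br (?p u) (?z v) + br (?m u) (?z v)
     + br (?p u) (?p v) - br (?m u) (?m v))"
    unfolding g'_bracket_eq degree_zero_def
    using br_skew[of "?z u" "hp v"] br_skew[of "?p u" "?z v"] br_skew[of "?m u" "?z v"] h_abelian[OF hp_in_h hp_in_h]
    by (simp add: br_add_left br_add_right algebra_simps)
  also have "br (hp u) (?z v + (?p v + ?m v)) - br (hp v) (?z u + (?p u + ?m u)) = h_action (hp u) v - h_action (hp v) u"
    unfolding part_sum by (simp add: br_h_part hp_in_h h_action_def cf_part)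
  also have "br (?z u) (?z v) + br (?z u) (?p v) + br (?z u) (?m v) + br (?p u) (?z v) + br (?m u) (?z v)
     + br (?p u) (?p v) - br (?m u) (?m v) = weighted_bracket bracket_sign u v"
    unfolding br_part_part[OF root_kinds_sub(1) root_kinds_sub(1)] br_part_part[OF root_kinds_sub(1) root_kinds_sub(2)]
      br_part_part[OF root_kinds_sub(1) root_kinds_sub(3)] br_part_part[OF root_kinds_sub(2) root_kinds_sub(1)]
      br_part_part[OF root_kinds_sub(3) root_kinds_sub(1)] br_part_part[OF root_kinds_sub(2) root_kinds_sub(2)]
      br_part_part[OF root_kinds_sub(3) root_kinds_sub(3)]
      weighted_bracket_add[symmetric] diff_conv_add_uminus weighted_bracket_minus[symmetric]
    unfolding weighted_bracket_def
    by (intro sum.cong refl arg_cong2[where f="(*s)"] arg_cong2[where f="(*)"])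
       (auto simp: root_span_iff pos_compl_iff neg_compl_iff bracket_sign_def)
  finally show ?thesis .
qed

section \<open>The Jacobi identity for \<open>g'\<close>\<close>

text \<open>The Cartan part has degree zero, like the components along \<open>root_span\<close>.\<close>

definition graded :: "(real \<Rightarrow> bool) \<Rightarrow> complex ^ 'n \<Rightarrow> bool" where
  "graded P u \<longleftrightarrow> (hp u \<noteq> 0 \<longrightarrow> P 0) \<and> (\<forall>\<alpha>\<in>\<Phi>. cf \<alpha> u \<noteq> 0 \<longrightarrow> P (deg \<alpha>))"

lemma graded_br:
  assumes u: "graded P u" and v: "graded Q v" and T: "\<And>a b. P a \<Longrightarrow> Q b \<Longrightarrow> T (a + b)"
  shows "graded T (br u v)"
  unfolding graded_def
proof (intro conjI ballI impI)
  assume "hp (br u v) \<noteq> 0"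
  then have "(\<Sum>\<beta>\<in>\<Phi>. (1 * (cf \<beta> u * cf (- \<beta>) v)) *s \<beta>) \<noteq> 0"
    by (subst (asm) br_coordinates) (simp add: hp_linear hp_more hp_h_action hp_weighted_bracket)
  then obtain \<beta> where \<beta>: "\<beta> \<in> \<Phi>" "(1 * (cf \<beta> u * cf (- \<beta>) v)) *s \<beta> \<noteq> 0"
    by (rule sum.not_neutral_contains_not_neutral)
  then have "P (deg \<beta>)" "Q (deg (- \<beta>))" using u v neg_root by (auto simp: graded_def)
  from T[OF this] show "T 0" by (simp add: deg_minus)
next
  fix \<alpha> assume \<alpha>: "\<alpha> \<in> \<Phi>" and ne: "cf \<alpha> (br u v) \<noteq> 0"
  have eq: "cf \<alpha> (br u v) = kf \<alpha> (hp u) * cf \<alpha> v - kf \<alpha> (hp v) * cf \<alpha> u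
      + (\<Sum>\<beta>\<in>\<Phi>. \<Sum>\<gamma>\<in>\<Phi>. 1 * (cf \<beta> u * cf \<gamma> v) * cf \<alpha> (br (e \<beta>) (e \<gamma>)))"
    using \<alpha> by (subst br_coordinates) (simp only: cf_linear cf_h_action cf_weighted_bracket)
  consider "kf \<alpha> (hp u) * cf \<alpha> v \<noteq> 0" | "kf \<alpha> (hp v) * cf \<alpha> u \<noteq> 0"
    | "(\<Sum>\<beta>\<in>\<Phi>. \<Sum>\<gamma>\<in>\<Phi>. 1 * (cf \<beta> u * cf \<gamma> v) * cf \<alpha> (br (e \<beta>) (e \<gamma>))) \<noteq> 0"
    using ne eq by force
  then show "T (deg \<alpha>)"
  proof cases
    case 1
    then have "P 0" "Q (deg \<alpha>)" using u v \<alpha> by (auto simp: graded_def kf_zero)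
    from T[OF this] show ?thesis by simp
  next
    case 2
    then have "P (deg \<alpha>)" "Q 0" using u v \<alpha> by (auto simp: graded_def kf_zero)
    from T[OF this] show ?thesis by simp
  next
    case 3
    then obtain \<beta> where \<beta>: "\<beta> \<in> \<Phi>" "(\<Sum>\<gamma>\<in>\<Phi>. 1 * (cf \<beta> u * cf \<gamma> v) * cf \<alpha> (br (e \<beta>) (e \<gamma>))) \<noteq> 0"
      by (rule sum.not_neutral_contains_not_neutral)
    from this(2) obtain \<gamma> where \<gamma>: "\<gamma> \<in> \<Phi>" "1 * (cf \<beta> u * cf \<gamma> v) * cf \<alpha> (br (e \<beta>) (e \<gamma>)) \<noteq> 0"
      by (rule sum.not_neutral_contains_not_neutral)
    have "\<alpha> = \<beta> + \<gamma>" using cf_br_e_e_zero[OF \<alpha> \<beta>(1) \<gamma>(1)] \<gamma>(2) by auto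
    moreover have "P (deg \<beta>)" "Q (deg \<gamma>)" using u v \<beta>(1) \<gamma> by (auto simp: graded_def)
    ultimately show ?thesis using T deg_add by simp
  qed
qed

lemma graded_add: "graded P u \<Longrightarrow> graded P v \<Longrightarrow> graded P (u + v)"
  and graded_diff: "graded P u \<Longrightarrow> graded P v \<Longrightarrow> graded P (u - v)"
  by (auto simp: graded_def hp_linear hp_more cf_linear)

lemma graded_components: "graded (\<lambda>a. a = 0) (degree_zero u)" "graded (\<lambda>a. 0 < a) (part pos_compl u)"
  "graded (\<lambda>a. a < 0) (part neg_compl u)"
  by (auto simp: graded_def degree_zero_def hp_linear cf_linear cf_part cf_h hp_in_h hp_part root_kinds_sub
      root_span_iff pos_compl_iff neg_compl_iff split: if_splits)

lemma graded_unique: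
  assumes "graded (\<lambda>a. a = 0) a" "graded (\<lambda>a. 0 < a) b" "graded (\<lambda>a. a < 0) c"
  shows "degree_zero (a + b + c) = a" "part pos_compl (a + b + c) = b" "part neg_compl (a + b + c) = c"
proof -
  have b: "hp b = 0" and c: "hp c = 0" using assms by (auto simp: graded_def)
  have cf: "\<alpha> \<in> \<Phi> \<Longrightarrow> deg \<alpha> \<noteq> 0 \<Longrightarrow> cf \<alpha> a = 0" "\<alpha> \<in> \<Phi> \<Longrightarrow> \<not> 0 < deg \<alpha> \<Longrightarrow> cf \<alpha> b = 0"
    "\<alpha> \<in> \<Phi> \<Longrightarrow> \<not> deg \<alpha> < 0 \<Longrightarrow> cf \<alpha> c = 0" for \<alpha>
    using assms by (auto simp: graded_def)
  show "degree_zero (a + b + c) = a"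
    by (rule eqI_cf) (auto simp: degree_zero_def hp_linear hp_h hp_in_h hp_part root_kinds_sub b c cf_linear cf_part cf_h root_span_iff cf)
  show "part pos_compl (a + b + c) = b"
    by (rule eqI_cf) (auto simp: hp_part root_kinds_sub b cf_linear cf_part pos_compl_iff cf)
  show "part neg_compl (a + b + c) = c"
    by (rule eqI_cf) (auto simp: hp_part root_kinds_sub c cf_linear cf_part neg_compl_iff cf)
qed

lemma part_linear: "part A (u + v) = part A u + part A v" "part A (c *s u) = c *s part A u"
  by (simp_all add: part_def cf_linear vec.scale_left_distrib sum.distrib vec.scale_sum_right)

lemma degree_zero_linear: "degree_zero (u + v) = degree_zero u + degree_zero v" "degree_zero (c *s u) = c *s degree_zero u"
  by (simp_all add: degree_zero_def hp_linear part_linear vec.scale_right_distrib)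

lemma g'_components:
  "degree_zero (g'_bracket u v) = br (degree_zero u) (degree_zero v)"
  "part pos_compl (g'_bracket u v) = br (degree_zero u) (part pos_compl v) - br (degree_zero v) (part pos_compl u)
     + br (part pos_compl u) (part pos_compl v)"
  "part neg_compl (g'_bracket u v) = br (degree_zero u) (part neg_compl v) - br (degree_zero v) (part neg_compl u)
     - br (part neg_compl u) (part neg_compl v)"
proof -
  let ?p = "part pos_compl" and ?m = "part neg_compl"
  have eq: "g'_bracket u v = br (degree_zero u) (degree_zero v)
      + (br (degree_zero u) (?p v) - br (degree_zero v) (?p u) + br (?p u) (?p v))
      + (br (degree_zero u) (?m v) - br (degree_zero v) (?m u) - br (?m u) (?m v))"
    unfolding g'_bracket_eq by (simp add: br_add_right algebra_simps)
  have 1: "graded (\<lambda>a. a = 0) (br (degree_zero u) (degree_zero v))"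
    by (rule graded_br[OF graded_components(1) graded_components(1)]) simp
  have 2: "graded (\<lambda>a. 0 < a) (br (degree_zero u) (?p v) - br (degree_zero v) (?p u) + br (?p u) (?p v))"
    by (intro graded_add graded_diff graded_br[OF graded_components(1) graded_components(2)]
        graded_br[OF graded_components(2) graded_components(2)]) auto
  have 3: "graded (\<lambda>a. a < 0) (br (degree_zero u) (?m v) - br (degree_zero v) (?m u) - br (?m u) (?m v))"
    by (intro graded_diff graded_br[OF graded_components(1) graded_components(3)]
        graded_br[OF graded_components(3) graded_components(3)]) auto
  note u = graded_unique[OF 1 2 3, folded eq]
  show "degree_zero (g'_bracket u v) = br (degree_zero u) (degree_zero v)" by (rule u(1))
  show "part pos_compl (g'_bracket u v) = br (degree_zero u) (?p v) - br (degree_zero v) (?p u) + br (?p u) (?p v)" by (rule u(2))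
  show "part neg_compl (g'_bracket u v) = br (degree_zero u) (?m v) - br (degree_zero v) (?m u) - br (?m u) (?m v)" by (rule u(3))
qed

lemma g'_add_left: "g'_bracket (u + v) w = g'_bracket u w + g'_bracket v w"
  and g'_add_right: "g'_bracket w (u + v) = g'_bracket w u + g'_bracket w v"
  and g'_scale_left: "g'_bracket (c *s u) w = c *s g'_bracket u w"
  and g'_scale_right: "g'_bracket w (c *s u) = c *s g'_bracket w u"
  unfolding g'_bracket_eq part_linear degree_zero_linear
  by (simp_all add: br_add_left br_add_right br_scale_left br_scale_right vec_distrib
      vec.scale_right_diff_distrib algebra_simps)

lemma g'_skew: "g'_bracket u v = - g'_bracket v u"
  unfolding g'_bracket_eq
  using br_skew[of "degree_zero u" "degree_zero v"] br_skew[of "part pos_compl u" "part pos_compl v"]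
    br_skew[of "part neg_compl u" "part neg_compl v"] by simp

text \<open>Forgetting the negative part, and forgetting the positive part while changing the sign of the negative
  one, are homomorphisms from \<open>g'\<close> to \<open>g\<close>; together they embed \<open>g'\<close> into \<open>g \<oplus> g\<close>.\<close>

lemma g'_jacobi: "g'_bracket u (g'_bracket v w) + g'_bracket v (g'_bracket w u) + g'_bracket w (g'_bracket u v) = 0"
proof -
  define P where "P u = degree_zero u + part pos_compl u" for u
  define Q where "Q u = degree_zero u - part neg_compl u" for u
  have PQ: "P (u + v) = P u + P v" "Q (u + v) = Q u + Q v" for u v
    by (simp_all add: P_def Q_def degree_zero_linear part_linear)
  have P: "P (g'_bracket u v) = br (P u) (P v)" for u v
    using br_skew[of "part pos_compl u" "degree_zero v"]
    by (simp add: P_def g'_components br_add_left br_add_right algebra_simps)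
  have Q: "Q (g'_bracket u v) = br (Q u) (Q v)" for u v
    using br_skew[of "part neg_compl u" "degree_zero v"]
    by (simp add: Q_def g'_components br_diff algebra_simps)
  have jac: "br a (br b c) + br b (br c a) + br c (br a b) = 0" for a b c
    using lie_br by (simp add: lie_algebra_def)
  define J where "J = g'_bracket u (g'_bracket v w) + g'_bracket v (g'_bracket w u) + g'_bracket w (g'_bracket u v)"
  have PJ: "P J = 0" and QJ: "Q J = 0" by (simp_all add: J_def PQ P Q jac)
  have "J = 0"
  proof (rule eqI_cf)
    have "hp (P J) = hp J" by (simp add: P_def degree_zero_def hp_linear hp_part root_kinds_sub hp_h hp_in_h)
    then show "hp J = hp 0" using PJ by simp
    fix \<alpha> assume \<alpha>: "\<alpha> \<in> \<Phi>"
    have "cf \<alpha> (P J) = 0" "cf \<alpha> (Q J) = 0" by (simp_all add: PJ QJ cf_linear)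
    then show "cf \<alpha> J = cf \<alpha> 0"
      using \<alpha> by (cases "deg \<alpha>" "0::real" rule: linorder_cases)
        (simp_all add: P_def Q_def degree_zero_def cf_linear cf_h hp_in_h cf_part root_kinds_sub
          root_span_iff pos_compl_iff neg_compl_iff)
  qed
  then show ?thesis by (simp add: J_def)
qed

section \<open>The functions \<open>C\<close>, \<open>\<phi>\<close> and \<open>\<psi>\<close> on the domain of analyticity\<close>

lemma U_sub: "U \<subseteq> h"
  by (auto simp: U_def)

lemma U_open: "openin (top_of_set h) U"
proof (subst openin_subopen, intro ballI)
  fix q assume "q \<in> U"
  then obtain V where V: "openin (top_of_set h) V" "q \<in> V" "\<forall>B. holo h (*s) V (\<lambda>p. R p B)"
    by (auto simp: U_def)
  then have "V \<subseteq> U" using openin_imp_subset unfolding U_def by blast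
  then show "\<exists>T. openin (top_of_set h) T \<and> q \<in> T \<and> T \<subseteq> U" using V by blast
qed

lemma R_holo: "holo h (*s) U (\<lambda>p. R p B)"
  unfolding holo_def[of h "(*s)" U]
proof
  fix q assume "q \<in> U"
  then obtain V where "q \<in> V" "\<forall>B. holo h (*s) V (\<lambda>p. R p B)" by (auto simp: U_def)
  then show "\<exists>D. ((\<lambda>p. R p B) has_derivative D) (at q within h) \<and> (\<forall>c v. D (c *s v) = c *s D v)"
    unfolding holo_def by blast
qed

lemma kf_bounded_linear: "bounded_linear (kf u)"
  by (rule linear_imp_bounded_linear) (simp_all add: kf_linear scaleR_conv_of_real)

lemma kf_holo:
  assumes V: "V \<subseteq> h" and f: "holo h (*s) V f"
  shows "holo h (*) V (\<lambda>p. kf u (f p))"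
    and "\<And>q v. q \<in> V \<Longrightarrow> v \<in> h \<Longrightarrow> dir_deriv h (\<lambda>p. kf u (f p)) q v = kf u (dir_deriv h f q v)"
  by (rule holo_linear[where ?sc1.0="(*s)" and ?sc2.0="(*)", OF h_subspace V kf_bounded_linear _ f]; simp add: kf_linear)+

lemma R_coordinates:
  shows "hp (R q B) = C_sharp q B" and "\<alpha> \<in> \<Phi> \<Longrightarrow> cf \<alpha> (R q B) = \<phi> \<alpha> q * cf \<alpha> B"
proof -
  have C: "(\<Sum>i\<in>UNIV. \<Sum>j\<in>UNIV. (C i j q * kf (x j) B) *s x i) = C_sharp q B"
    by (simp add: C_sharp_def kf_sym[of B])
  have Ch: "C_sharp q B \<in> h"
    unfolding C_sharp_def using h_subspace x_in_h by (intro vec.subspace_sum vec.subspace_scale) auto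
  show "hp (R q B) = C_sharp q B"
    unfolding R_def C using Ch by (simp add: hp_linear hp_root_sum hp_h)
  show "cf \<alpha> (R q B) = \<phi> \<alpha> q * cf \<alpha> B" if "\<alpha> \<in> \<Phi>"
    unfolding R_def C using Ch that by (simp add: cf_linear cf_h) (simp add: cf_linear[symmetric] cf_root_sum cf_def[of _ B])
qed

lemma C_sharp_in_h: "C_sharp q B \<in> h"
  using R_coordinates(1) hp_in_h by metis

lemma C_sharp_hp: "C_sharp q (hp B) = C_sharp q B"
proof -
  have "kf (x j) (hp B) = kf (x j) B" for j
  proof -
    have "kf (x j) (hp B) = (\<Sum>i\<in>UNIV. if i = j then kf (x i) B else 0)"
      unfolding hp_def kf_linear by (intro sum.cong) (auto simp: orthonormal)
    then show ?thesis by simp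
  qed
  then show ?thesis by (simp add: C_sharp_def kf_sym[of "hp B"] kf_sym[of B])
qed

lemma C_from_R: "C i j q = kf (x i) (R q (x j))"
proof -
  have "kf (x i) (e \<alpha>) = 0" if "\<alpha> \<in> \<Phi>" for \<alpha> using kf_e_h[OF that x_in_h] by (simp add: kf_sym)
  then have "kf (x i) (R q (x j)) = (\<Sum>i'\<in>UNIV. \<Sum>j'\<in>UNIV. C i' j' q * kf (x j') (x j) * kf (x i) (x i'))"
    by (simp add: R_def kf_linear)
  also have "\<dots> = (\<Sum>i'\<in>UNIV. if i' = i then (\<Sum>j'\<in>UNIV. if j' = j then C i' j' q else 0) else 0)"
    by (intro sum.cong refl) (auto simp: orthonormal if_distrib[of "\<lambda>z. _ * z"] cong: if_cong)
  finally show ?thesis by simp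
qed

lemma C_holo: "holo h (*) U (C i j)"
proof -
  have "C i j = (\<lambda>q. kf (x i) (R q (x j)))" using C_from_R by blast
  then show ?thesis using kf_holo(1)[OF U_sub R_holo] by metis
qed

lemma \<phi>_from_R: "\<alpha> \<in> \<Phi> \<Longrightarrow> \<phi> \<alpha> q = cf \<alpha> (R q (e \<alpha>))"
  by (simp add: R_coordinates cf_e)

lemma \<phi>_holo: assumes "\<alpha> \<in> \<Phi>" shows "holo h (*) U (\<phi> \<alpha>)"
proof -
  have "\<phi> \<alpha> = (\<lambda>q. kf (e (- \<alpha>)) (R q (e \<alpha>)))" using \<phi>_from_R[OF assms] by (auto simp: cf_def)
  then show ?thesis using kf_holo(1)[OF U_sub R_holo] by metis
qed

text \<open>At a zero of \<open>sinh\<close> the product \<open>\<phi> sinh = cosh / 2\<close>, valid nearby on a line through the point, would tend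
  to zero if \<open>\<phi>\<close> were continuous.\<close>

lemma sinh_nonzero:
  assumes q: "q \<in> U" and \<alpha>: "\<alpha> \<in> root_span"
  shows "sinh (K \<alpha> (q - \<mu>) / 2) \<noteq> 0"
proof
  assume 0: "sinh (K \<alpha> (q - \<mu>) / 2) = 0"
  have \<alpha>\<Phi>: "\<alpha> \<in> \<Phi>" using \<alpha> by (simp add: root_span_def)
  define z0 where "z0 = K \<alpha> (q - \<mu>) / 2"
  define c where "c = K \<alpha> \<alpha> / 2"
  have c: "c \<noteq> 0" using kf_root_nonzero[OF \<alpha>\<Phi>] by (simp add: c_def)
  have arg: "K \<alpha> (q + t *s \<alpha> - \<mu>) / 2 = z0 + t * c" for t
    by (simp add: z0_def c_def kf_linear field_simps)
  have "((\<lambda>t. \<phi> \<alpha> (q + t *s \<alpha>)) has_field_derivative dir_deriv h (\<phi> \<alpha>) (q + 0 *s \<alpha>) \<alpha>) (at 0)"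
    using holo_line[OF h_subspace U_sub \<phi>_holo[OF \<alpha>\<Phi>] _ root_in_h[OF \<alpha>\<Phi>], of q 0] q U_sub by auto
  then have "isCont (\<lambda>t. \<phi> \<alpha> (q + t *s \<alpha>)) 0" by (rule DERIV_isCont)
  then have lim1: "((\<lambda>t. \<phi> \<alpha> (q + t *s \<alpha>)) \<longlongrightarrow> \<phi> \<alpha> q) (at 0)" by (simp add: isCont_def)
  have der: "((\<lambda>t. sinh (z0 + t * c)) has_field_derivative cosh z0 * c) (at 0)"
    by (auto intro!: derivative_eq_intros)
  have "(cosh z0)\<^sup>2 = 1" using cosh_square_eq[of z0] 0 by (simp add: z0_def)
  then have ch: "cosh z0 \<noteq> 0" by auto
  have lim2: "((\<lambda>t. sinh (z0 + t * c) / t) \<longlongrightarrow> cosh z0 * c) (at 0)"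
    using der 0 by (simp add: DERIV_def z0_def)
  have "\<forall>\<^sub>F t in at 0. sinh (z0 + t * c) / t \<noteq> 0"
    by (rule tendsto_imp_eventually_ne[OF lim2]) (simp add: ch c)
  then have ev: "\<forall>\<^sub>F t in at 0. \<phi> \<alpha> (q + t *s \<alpha>) * sinh (z0 + t * c) = cosh (z0 + t * c) / 2"
  proof eventually_elim
    case (elim t)
    then show ?case using \<alpha> by (simp add: \<phi>_def arg)
  qed
  have "isCont (\<lambda>t. sinh (z0 + t * c)) 0" using der by (rule DERIV_isCont)
  then have "((\<lambda>t. sinh (z0 + t * c)) \<longlongrightarrow> 0) (at 0)" using 0 by (simp add: isCont_def z0_def)
  from tendsto_mult[OF lim1 this]
  have "((\<lambda>t. \<phi> \<alpha> (q + t *s \<alpha>) * sinh (z0 + t * c)) \<longlongrightarrow> 0) (at 0)" by simp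
  then have "((\<lambda>t. cosh (z0 + t * c) / 2) \<longlongrightarrow> 0) (at 0)"
    using tendsto_cong[OF ev] by simp
  moreover have "((\<lambda>t. cosh (z0 + t * c) / 2) \<longlongrightarrow> cosh (z0 + 0 * c) / 2) (at 0)"
    by (intro tendsto_intros) simp
  ultimately have "cosh z0 / 2 = 0" using LIM_unique by fastforce
  then show False using ch by simp
qed

lemma \<psi>_coeff_nonzero: assumes "q \<in> U" "\<alpha> \<in> \<Phi>" shows "\<psi>_coeff \<alpha> q \<noteq> 0"
  using sinh_nonzero[OF assms(1)] by (auto simp: \<psi>_coeff_def)

text \<open>The chain rule for functions of \<open>(\<alpha>, q - \<mu>) / 2\<close>, an affine function of \<open>q\<close>.\<close>

lemma holo_compose_root:
  assumes V: "V \<subseteq> h" and G: "\<And>q. q \<in> V \<Longrightarrow> (G has_field_derivative G' q) (at (K \<alpha> (q - \<mu>) / 2))"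
  shows "holo h (*) V (\<lambda>p. G (K \<alpha> (p - \<mu>) / 2))"
    and "\<And>q v. q \<in> V \<Longrightarrow> v \<in> h \<Longrightarrow> dir_deriv h (\<lambda>p. G (K \<alpha> (p - \<mu>) / 2)) q v = G' q * (K \<alpha> v / 2)"
proof -
  have D: "((\<lambda>p. G (K \<alpha> (p - \<mu>) / 2)) has_derivative (\<lambda>v. G' q * (K \<alpha> v / 2))) (at q within h)" if "q \<in> V" for q
  proof -
    have "bounded_linear (\<lambda>v. K \<alpha> v / 2)" using kf_bounded_linear by (rule bounded_linear_divide[THEN bounded_linear_compose])
    then have "((\<lambda>v. K \<alpha> v / 2) has_derivative (\<lambda>v. K \<alpha> v / 2)) (at q within h)"
      by (rule bounded_linear_imp_has_derivative)
    from has_derivative_diff[OF this has_derivative_const[of "K \<alpha> \<mu> / 2"]]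
    have "((\<lambda>p. K \<alpha> (p - \<mu>) / 2) has_derivative (\<lambda>v. K \<alpha> v / 2)) (at q within h)"
      by (simp add: kf_linear diff_divide_distrib)
    moreover have "(G has_derivative (*) (G' q)) (at (K \<alpha> (q - \<mu>) / 2))"
      using G[OF that] by (simp add: has_field_derivative_def)
    ultimately show ?thesis by (rule has_derivative_compose)
  qed
  show "holo h (*) V (\<lambda>p. G (K \<alpha> (p - \<mu>) / 2))"
    unfolding holo_def using D by (intro ballI exI conjI) (auto simp: kf_linear)
  show "dir_deriv h (\<lambda>p. G (K \<alpha> (p - \<mu>) / 2)) q v = G' q * (K \<alpha> v / 2)" if "q \<in> V" "v \<in> h" for q v
    using dir_deriv_eq[OF h_subspace _ that(2) D[OF that(1)]] that(1) V by auto
qed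

lemma deg_cases:
  assumes "\<alpha> \<in> \<Phi>"
  shows "\<phi> \<alpha> q = (if deg \<alpha> = 0 then cosh (K \<alpha> (q - \<mu>) / 2) / sinh (K \<alpha> (q - \<mu>) / 2) / 2
      else if 0 < deg \<alpha> then 1 / 2 else - 1 / 2)"
    and "\<psi>_coeff \<alpha> q = (if deg \<alpha> = 0 then - 1 / (2 * sinh (K \<alpha> (q - \<mu>) / 2))
      else if 0 < deg \<alpha> then - exp (- (K \<alpha> (q - \<mu>) / 2)) else - exp (K \<alpha> (q - \<mu>) / 2))"
  using assms by (simp_all add: \<phi>_def \<psi>_coeff_def root_span_iff pos_compl_iff)

text \<open>Up to sign and a factor \<open>\<alpha>(v)\<close>, \<open>\<phi> \<alpha>\<close> is the logarithmic derivative of \<open>1 / sinh\<close> or of an exponential.\<close>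

lemma \<psi>_coeff_deriv:
  assumes \<alpha>: "\<alpha> \<in> \<Phi>"
  shows "holo h (*) U (\<psi>_coeff \<alpha>)"
    and "\<And>q v. q \<in> U \<Longrightarrow> v \<in> h \<Longrightarrow> dir_deriv h (\<psi>_coeff \<alpha>) q v = - \<phi> \<alpha> q * \<psi>_coeff \<alpha> q * K \<alpha> v"
proof -
  have "holo h (*) U (\<psi>_coeff \<alpha>) \<and>
    (\<forall>q\<in>U. \<forall>v\<in>h. dir_deriv h (\<psi>_coeff \<alpha>) q v = - \<phi> \<alpha> q * \<psi>_coeff \<alpha> q * K \<alpha> v)"
  proof (cases "deg \<alpha>" "0::real" rule: linorder_cases)
    case equal
    have eq: "\<psi>_coeff \<alpha> = (\<lambda>p. (\<lambda>z. - 1 / (2 * sinh z)) (K \<alpha> (p - \<mu>) / 2))"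
      using deg_cases(2)[OF \<alpha>] equal by auto
    have s: "sinh (K \<alpha> (q - \<mu>) / 2) \<noteq> 0" if "q \<in> U" for q
      using sinh_nonzero[OF that] equal root_span_iff[OF \<alpha>] by blast
    have "((\<lambda>z. - 1 / (2 * sinh z)) has_field_derivative
        cosh (K \<alpha> (q - \<mu>) / 2) / (2 * (sinh (K \<alpha> (q - \<mu>) / 2))\<^sup>2)) (at (K \<alpha> (q - \<mu>) / 2))" if "q \<in> U" for q
      using s[OF that] by (auto intro!: derivative_eq_intros simp: field_simps power2_eq_square)
    note C = holo_compose_root[OF U_sub this, folded eq]
    show ?thesis
    proof (intro conjI ballI C(1))
      fix q v assume "q \<in> U" "v \<in> h"
      then show "dir_deriv h (\<psi>_coeff \<alpha>) q v = - \<phi> \<alpha> q * \<psi>_coeff \<alpha> q * K \<alpha> v"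
        using C(2) s equal by (simp add: deg_cases[OF \<alpha>] field_simps power2_eq_square)
    qed
  next
    case greater
    have eq: "\<psi>_coeff \<alpha> = (\<lambda>p. (\<lambda>z. - exp (- z)) (K \<alpha> (p - \<mu>) / 2))"
      using deg_cases(2)[OF \<alpha>] greater by auto
    have "((\<lambda>z. - exp (- z)) has_field_derivative exp (- (K \<alpha> (q - \<mu>) / 2))) (at (K \<alpha> (q - \<mu>) / 2))" if "q \<in> U" for q
      by (auto intro!: derivative_eq_intros)
    note C = holo_compose_root[OF U_sub this, folded eq]
    show ?thesis
    proof (intro conjI ballI C(1))
      fix q v assume "q \<in> U" "v \<in> h"
      then show "dir_deriv h (\<psi>_coeff \<alpha>) q v = - \<phi> \<alpha> q * \<psi>_coeff \<alpha> q * K \<alpha> v"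
        using C(2) greater by (simp add: deg_cases[OF \<alpha>])
    qed
  next
    case less
    have eq: "\<psi>_coeff \<alpha> = (\<lambda>p. (\<lambda>z. - exp z) (K \<alpha> (p - \<mu>) / 2))"
      using deg_cases(2)[OF \<alpha>] less by auto
    have "((\<lambda>z. - exp z) has_field_derivative - exp (K \<alpha> (q - \<mu>) / 2)) (at (K \<alpha> (q - \<mu>) / 2))" if "q \<in> U" for q
      by (auto intro!: derivative_eq_intros)
    note C = holo_compose_root[OF U_sub this, folded eq]
    show ?thesis
    proof (intro conjI ballI C(1))
      fix q v assume "q \<in> U" "v \<in> h"
      then show "dir_deriv h (\<psi>_coeff \<alpha>) q v = - \<phi> \<alpha> q * \<psi>_coeff \<alpha> q * K \<alpha> v"
        using C(2) less by (simp add: deg_cases[OF \<alpha>])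
    qed
  qed
  then show "holo h (*) U (\<psi>_coeff \<alpha>)"
    and "\<And>q v. q \<in> U \<Longrightarrow> v \<in> h \<Longrightarrow> dir_deriv h (\<psi>_coeff \<alpha>) q v = - \<phi> \<alpha> q * \<psi>_coeff \<alpha> q * K \<alpha> v" by blast+
qed

lemma \<phi>_odd: assumes "\<alpha> \<in> \<Phi>" shows "\<phi> (- \<alpha>) q = - \<phi> \<alpha> q"
  using neg_root[OF assms] assms by (auto simp: deg_cases deg_minus kf_minus(1))

text \<open>For roots in the span of \<open>\<Gamma>\<close> this is \<open>coth' = -1 / sinh\<^sup>2\<close>; for the others both sides vanish. The
  product of the sign and the two weights is the factor with which \<open>\<alpha>\<close> enters the Cartan part of the
  bracket of \<open>g'\<close> after \<open>\<psi>\<close> has been applied.\<close>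

lemma \<phi>_deriv:
  assumes \<alpha>: "\<alpha> \<in> \<Phi>" and q: "q \<in> U" and v: "v \<in> h"
  shows "dir_deriv h (\<phi> \<alpha>) q v = bracket_sign \<alpha> (- \<alpha>) * (\<psi>_coeff \<alpha> q * \<psi>_coeff (- \<alpha>) q) * K \<alpha> v"
proof (cases "deg \<alpha> = 0")
  case True
  have eq: "\<phi> \<alpha> = (\<lambda>p. (\<lambda>z. cosh z / sinh z / 2) (K \<alpha> (p - \<mu>) / 2))"
    using deg_cases(1)[OF \<alpha>] True by auto
  have s: "sinh (K \<alpha> (q - \<mu>) / 2) \<noteq> 0" if "q \<in> U" for q
    using sinh_nonzero[OF that] True root_span_iff[OF \<alpha>] by blast
  have "((\<lambda>z. cosh z / sinh z / 2) has_field_derivative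
      - 1 / (2 * (sinh (K \<alpha> (q - \<mu>) / 2))\<^sup>2)) (at (K \<alpha> (q - \<mu>) / 2))" if "q \<in> U" for q
    using s[OF that] cosh_square_eq[of "K \<alpha> (q - \<mu>) / 2"]
    by (auto intro!: derivative_eq_intros simp: field_simps power2_eq_square)
  note C = holo_compose_root[OF U_sub this, folded eq]
  show ?thesis
    using C(2)[OF _ q v] s[OF q] True neg_root[OF \<alpha>] \<alpha>
    by (simp add: deg_cases deg_minus bracket_sign_def kf_minus(1) field_simps power2_eq_square)
next
  case False
  then have eq: "\<phi> \<alpha> = (\<lambda>p. if 0 < deg \<alpha> then 1 / 2 else - 1 / 2)" using deg_cases(1)[OF \<alpha>] by auto
  have "bracket_sign \<alpha> (- \<alpha>) = 0" using False by (auto simp: bracket_sign_def deg_minus)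
  then show ?thesis unfolding eq using holo_const(2)[where sc="(*)" and 'b=complex, OF h_subspace U_sub _ q v] by simp
qed

text \<open>The addition theorem behind the theorem: the weights \<open>\<psi>\<close> turn the bracket with the weights
  \<open>\<phi>\<^sub>\<beta> + \<phi>\<^sub>\<gamma>\<close> into the bracket of \<open>g'\<close>.\<close>

lemma \<phi>_\<psi>_addition:
  assumes q: "q \<in> U" and r: "\<beta> \<in> \<Phi>" "\<gamma> \<in> \<Phi>" "\<beta> + \<gamma> \<in> \<Phi>"
  shows "bracket_sign \<beta> \<gamma> * (\<psi>_coeff \<beta> q * \<psi>_coeff \<gamma> q) = - \<psi>_coeff (\<beta> + \<gamma>) q * (\<phi> \<beta> q + \<phi> \<gamma> q)"
proof -
  define a where "a = K \<beta> (q - \<mu>) / 2"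
  define b where "b = K \<gamma> (q - \<mu>) / 2"
  have ab: "K (\<beta> + \<gamma>) (q - \<mu>) / 2 = a + b" by (simp add: a_def b_def kf_add_left add_divide_distrib)
  have s: "deg \<beta> = 0 \<Longrightarrow> sinh a \<noteq> 0" "deg \<gamma> = 0 \<Longrightarrow> sinh b \<noteq> 0" "deg (\<beta> + \<gamma>) = 0 \<Longrightarrow> sinh (a + b) \<noteq> 0"
    using sinh_nonzero[OF q, of \<beta>] root_span_iff[OF r(1)] sinh_nonzero[OF q, of \<gamma>] root_span_iff[OF r(2)]
      sinh_nonzero[OF q, of "\<beta> + \<gamma>"] root_span_iff[OF r(3)] unfolding ab a_def[symmetric] b_def[symmetric]
    by blast+
  note [simp] = deg_cases[OF r(1)] deg_cases[OF r(2)] deg_cases[OF r(3)] deg_add bracket_sign_def ab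
    a_def[symmetric] b_def[symmetric]
  have coth: "cosh z / sinh z / 2 + 1 / 2 = exp z / (2 * sinh z)"
    "cosh z / sinh z / 2 - 1 / 2 = exp (- z) / (2 * sinh z)" if "sinh z \<noteq> 0" for z :: complex
    using that by (simp_all add: field_simps flip: cosh_plus_sinh cosh_minus_sinh)
  have exps: "exp (- a - b) * exp a = exp (- b)" "exp (a + b) * exp (- a) = exp b"
    "exp (- a - b) * exp b = exp (- a)" "exp (a + b) * exp (- b) = exp a"
    "exp (- a) * exp (- b) = exp (- a - b)" "exp a * exp b = exp (a + b)"
    by (simp_all add: mult_exp_exp)
  consider "deg \<beta> = 0" "deg \<gamma> = 0" | "deg \<beta> = 0" "deg \<gamma> \<noteq> 0" | "deg \<beta> \<noteq> 0" "deg \<gamma> = 0"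
    | "deg \<beta> \<noteq> 0" "deg \<gamma> \<noteq> 0" "0 < deg \<beta> \<longleftrightarrow> 0 < deg \<gamma>" | "deg \<beta> \<noteq> 0" "deg \<gamma> \<noteq> 0" "0 < deg \<beta> \<longleftrightarrow> \<not> 0 < deg \<gamma>" by blast
  then show ?thesis
  proof cases
    case 1
    then have "\<phi> \<beta> q + \<phi> \<gamma> q = sinh (a + b) / (2 * (sinh a * sinh b))"
      using s by (simp add: sinh_add field_simps)
    then show ?thesis using 1 s by (simp del: deg_cases(1))
  next
    case 2
    note c = coth[OF s(1)[OF 2(1)]]
    show ?thesis
    proof (cases "0 < deg \<gamma>")
      case True
      then have "\<phi> \<beta> q + \<phi> \<gamma> q = exp a / (2 * sinh a)" using 2 c(1) by simp
      then show ?thesis using 2 True exps(1) by (simp del: deg_cases(1))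
    next
      case False
      then have "\<phi> \<beta> q + \<phi> \<gamma> q = exp (- a) / (2 * sinh a)" using 2 c(2) by simp
      then show ?thesis using 2 False exps(2) by (simp del: deg_cases(1))
    qed
  next
    case 3
    note c = coth[OF s(2)[OF 3(2)]]
    show ?thesis
    proof (cases "0 < deg \<beta>")
      case True
      then have "\<phi> \<beta> q + \<phi> \<gamma> q = exp b / (2 * sinh b)" using 3 c(1) by (simp add: add.commute)
      then show ?thesis using 3 True exps(3) by (simp del: deg_cases(1))
    next
      case False
      then have "\<phi> \<beta> q + \<phi> \<gamma> q = exp (- b) / (2 * sinh b)" using 3 c(2) by (simp add: algebra_simps)
      then show ?thesis using 3 False exps(4) by (simp del: deg_cases(1))
    qed
  next
    case 4
    then show ?thesis using exps(5,6) by auto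
  next
    case 5
    then show ?thesis by auto
  qed
qed

end

section \<open>Transport of Lie algebroid structures\<close>

lemma open_in_base_cong: "tangent A = tangent B \<Longrightarrow> base A = base B \<Longrightarrow> open_in_base A V = open_in_base B V"
  by (simp add: open_in_base_def)

lemma sections_cong:
  assumes "open_in_base A V" "s \<in> sections A V" "\<And>q. q \<in> V \<Longrightarrow> s q = t q"
  shows "t \<in> sections A V"
  using assms holo_cong[of "tangent A" V s t scale2] by (simp add: sections_def open_in_base_def)

lemma scale2_zero: "scale2 c 0 = 0"
  by (simp add: scale2_def zero_prod_def)

text \<open>If fibrewise isomorphisms \<open>f\<close>, with inverses \<open>g\<close>, respect sections and anchors and \<open>g\<close> intertwines a
  bracket on \<open>B\<close> with that of the algebroid \<open>A\<close>, then the bracket of \<open>B\<close> is \<open>f\<close> applied to the bracket of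
  \<open>A\<close>, and every axiom is carried over from \<open>A\<close> to \<open>B\<close>.\<close>

locale algebroid_transport = lie_algebroid A for A :: "'n::finite algebroid" +
  fixes B :: "'n algebroid"
    and f g :: "complex ^ 'n \<Rightarrow> (complex ^ 'n) \<times> (complex ^ 'n) \<Rightarrow> (complex ^ 'n) \<times> (complex ^ 'n)"
  assumes tangent_eq: "tangent A = tangent B" and base_eq: "base A = base B"
    and fibre_B: "pair.subspace (fibre B)"
    and f_fibre: "\<And>q u. q \<in> base A \<Longrightarrow> u \<in> fibre A \<Longrightarrow> f q u \<in> fibre B"
    and g_fibre: "\<And>q u. q \<in> base A \<Longrightarrow> u \<in> fibre B \<Longrightarrow> g q u \<in> fibre A"
    and gf: "\<And>q u. q \<in> base A \<Longrightarrow> u \<in> fibre A \<Longrightarrow> g q (f q u) = u"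
    and fg: "\<And>q u. q \<in> base A \<Longrightarrow> u \<in> fibre B \<Longrightarrow> f q (g q u) = u"
    and f_add: "\<And>q u v. q \<in> base A \<Longrightarrow> u \<in> fibre A \<Longrightarrow> v \<in> fibre A \<Longrightarrow> f q (u + v) = f q u + f q v"
    and f_scale: "\<And>q u c. q \<in> base A \<Longrightarrow> u \<in> fibre A \<Longrightarrow> f q (scale2 c u) = scale2 c (f q u)"
    and f_sections: "\<And>V s. open_in_base A V \<Longrightarrow> s \<in> sections A V \<Longrightarrow> (\<lambda>q. f q (s q)) \<in> sections B V"
    and g_sections: "\<And>V s. open_in_base A V \<Longrightarrow> s \<in> sections B V \<Longrightarrow> (\<lambda>q. g q (s q)) \<in> sections A V"
    and anchor_eq: "\<And>q u. q \<in> base A \<Longrightarrow> u \<in> fibre B \<Longrightarrow> anchor A q (g q u) = anchor B q u"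
    and anchor_B_holo: "\<And>u. u \<in> fibre B \<Longrightarrow> holo (tangent B) (*s) (base B) (\<lambda>q. anchor B q u)"
    and bracket_fibre: "\<And>V s t q. open_in_base A V \<Longrightarrow> s \<in> sections B V \<Longrightarrow> t \<in> sections B V \<Longrightarrow> q \<in> V \<Longrightarrow>
      bracket B s t q \<in> fibre B"
    and bracket_eq: "\<And>V s t q. open_in_base A V \<Longrightarrow> s \<in> sections B V \<Longrightarrow> t \<in> sections B V \<Longrightarrow> q \<in> V \<Longrightarrow>
      g q (bracket B s t q) = bracket A (\<lambda>p. g p (s p)) (\<lambda>p. g p (t p)) q"
begin

lemma section_fibre: "s \<in> sections A V \<Longrightarrow> q \<in> V \<Longrightarrow> s q \<in> fibre A"
  "s \<in> sections B V \<Longrightarrow> q \<in> V \<Longrightarrow> s q \<in> fibre B"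
  by (simp_all add: sections_def)

lemma in_base: "open_in_base A V \<Longrightarrow> q \<in> V \<Longrightarrow> q \<in> base A"
  by (auto simp: open_in_base_def)

lemma g_add: assumes "q \<in> base A" "u \<in> fibre B" "v \<in> fibre B" shows "g q (u + v) = g q u + g q v"
proof -
  have "f q (g q u + g q v) = u + v" using assms by (simp add: f_add g_fibre fg)
  then show ?thesis using gf[of q "g q u + g q v"] assms g_fibre pair.subspace_add[OF fibre_subspace] by metis
qed

lemma g_scale: assumes "q \<in> base A" "u \<in> fibre B" shows "g q (scale2 c u) = scale2 c (g q u)"
proof -
  have "f q (scale2 c (g q u)) = scale2 c u" using assms by (simp add: f_scale g_fibre fg)
  then show ?thesis using gf[of q "scale2 c (g q u)"] assms g_fibre pair.subspace_scale[OF fibre_subspace] by metis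
qed

lemma bracket_B:
  assumes "open_in_base A V" "s \<in> sections B V" "t \<in> sections B V" "q \<in> V"
  shows "bracket B s t q = f q (bracket A (\<lambda>p. g p (s p)) (\<lambda>p. g p (t p)) q)"
  using bracket_eq[OF assms] fg[OF in_base[OF assms(1,4)] bracket_fibre[OF assms]] by metis

lemma bracket_B_section:
  assumes "open_in_base A V" "s \<in> sections B V" "t \<in> sections B V"
  shows "bracket B s t \<in> sections B V"
proof (rule sections_cong)
  show "open_in_base B V" using assms open_in_base_cong tangent_eq base_eq by blast
  show "(\<lambda>q. f q (bracket A (\<lambda>p. g p (s p)) (\<lambda>p. g p (t p)) q)) \<in> sections B V"
    using assms by (intro f_sections bracket_section g_sections)
qed (use bracket_B assms in auto)

lemma f_minus: assumes "q \<in> base A" "u \<in> fibre A" shows "f q (- u) = - f q u"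
proof -
  have "- u = scale2 (- 1) u" "- f q u = scale2 (- 1) (f q u)" by (simp_all add: scale2_def prod_eq_iff)
  then show ?thesis using f_scale[OF assms, of "- 1"] by metis
qed

lemma f_zero: assumes "q \<in> base A" shows "f q 0 = 0"
  using f_scale[OF assms, of 0 0] pair.subspace_0[OF fibre_subspace] by (simp add: scale2_def zero_prod_def)

lemma bracket_B_local:
  assumes V: "open_in_base A V" and s: "s \<in> sections B V" "s' \<in> sections B V" "t \<in> sections B V" "t' \<in> sections B V"
    and eq: "\<forall>p\<in>V. s p = s' p \<and> t p = t' p" and q: "q \<in> V"
  shows "bracket B s t q = bracket B s' t' q"
proof -
  have "bracket A (\<lambda>p. g p (s p)) (\<lambda>p. g p (t p)) q = bracket A (\<lambda>p. g p (s' p)) (\<lambda>p. g p (t' p)) q"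
    by (rule bracket_local[OF V]) (use s eq q g_sections[OF V] in auto)
  then show ?thesis using bracket_B V s q by simp
qed

lemma bracket_B_nested:
  assumes V: "open_in_base A V" and s: "s \<in> sections B V" "t \<in> sections B V" "u \<in> sections B V" and q: "q \<in> V"
  shows "bracket B s (bracket B t u) q
    = f q (bracket A (\<lambda>p. g p (s p)) (bracket A (\<lambda>p. g p (t p)) (\<lambda>p. g p (u p))) q)"
proof -
  have "bracket A (\<lambda>p. g p (s p)) (\<lambda>p. g p (bracket B t u p)) q
    = bracket A (\<lambda>p. g p (s p)) (bracket A (\<lambda>p. g p (t p)) (\<lambda>p. g p (u p))) q"
    by (rule bracket_local[OF V])
       (use s q bracket_eq[OF V] bracket_B_section[OF V] g_sections[OF V] bracket_section[OF V] in auto)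
  then show ?thesis using bracket_B[OF V s(1) bracket_B_section[OF V s(2,3)] q] by simp
qed

lemma lie_algebroid_B: "lie_algebroid B"
proof
  note cong = open_in_base_cong[OF tangent_eq base_eq]
  show "vec.subspace (tangent B)" using tangent_subspace tangent_eq by simp
  show "openin (top_of_set (tangent B)) (base B)" using base_open tangent_eq base_eq by simp
  show "pair.subspace (fibre B)" by (rule fibre_B)
  show "holo (tangent B) (*s) (base B) (\<lambda>q. anchor B q u)" if "u \<in> fibre B" for u by (rule anchor_B_holo[OF that])
  show "anchor B q u \<in> tangent B" if "q \<in> base B" "u \<in> fibre B" for q u
    using that anchor_eq anchor_tangent g_fibre tangent_eq base_eq by metis
  show "anchor B q (u + v) = anchor B q u + anchor B q v"
    if "q \<in> base B" "u \<in> fibre B" "v \<in> fibre B" for q u v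
  proof -
    have "u + v \<in> fibre B" using that fibre_B pair.subspace_add by blast
    then show ?thesis
      using that base_eq by (simp add: anchor_eq[symmetric] g_add anchor_add g_fibre)
  qed
  show "anchor B q (scale2 c u) = c *s anchor B q u" if "q \<in> base B" "u \<in> fibre B" for q u c
  proof -
    have "scale2 c u \<in> fibre B" using that fibre_B pair.subspace_scale by blast
    then show ?thesis
      using that base_eq by (simp add: anchor_eq[symmetric] g_scale anchor_scale g_fibre)
  qed
  fix V s t q assume V': "open_in_base B V"
  then have V: "open_in_base A V" using cong by simp
  have VB: "openin (top_of_set (tangent B)) V" "V \<subseteq> tangent B" and hB: "vec.subspace (tangent B)"
    using V' openin_imp_subset tangent_subspace tangent_eq by (auto simp: open_in_base_def)
  {
    fix s' t' assume "s \<in> sections B V" "s' \<in> sections B V" "t \<in> sections B V" "t' \<in> sections B V"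
      "\<forall>p\<in>V. s p = s' p \<and> t p = t' p" "q \<in> V"
    then show "bracket B s t q = bracket B s' t' q" by (rule bracket_B_local[OF V])
  }
  assume s: "s \<in> sections B V" and t: "t \<in> sections B V"
  note gs = g_sections[OF V s] and gt = g_sections[OF V t]
  show "bracket B s t \<in> sections B V" by (rule bracket_B_section[OF V s t])
  {
    fix \<phi> :: "complex ^ 'n \<Rightarrow> complex" assume \<phi>: "holo (tangent B) (*) V \<phi>" and q: "q \<in> V"
    have qb: "q \<in> base A" using in_base V q by blast
    have scaled: "(\<lambda>p. scale2 (\<phi> p) (t p)) \<in> sections B V"
    proof -
      have "holo (tangent B) (*s) V (fst \<circ> t)" "holo (tangent B) (*s) V (snd \<circ> t)"
        using t holo_pair[OF hB VB(2)] by (auto simp: sections_def)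
      then have "holo (tangent B) (*s) V (\<lambda>p. \<phi> p *s (fst \<circ> t) p)" "holo (tangent B) (*s) V (\<lambda>p. \<phi> p *s (snd \<circ> t) p)"
        using holo_scale(1)[OF hB VB(2) \<phi>] by blast+
      then have "holo (tangent B) scale2 V (\<lambda>p. scale2 (\<phi> p) (t p))"
        by (simp add: holo_pair[OF hB VB(2)] comp_def) (simp add: scale2_def)
      then show ?thesis using t pair.subspace_scale[OF fibre_B] by (simp add: sections_def)
    qed
    have eq: "bracket A (\<lambda>p. g p (s p)) (\<lambda>p. g p (scale2 (\<phi> p) (t p))) q
        = bracket A (\<lambda>p. g p (s p)) (\<lambda>p. scale2 (\<phi> p) (g p (t p))) q"
    proof (rule bracket_local[OF V gs gs g_sections[OF V scaled] _ _ q])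
      have e: "g p (scale2 (\<phi> p) (t p)) = scale2 (\<phi> p) (g p (t p))" if "p \<in> V" for p
        using g_scale in_base[OF V that] section_fibre(2)[OF t that] by blast
      then show "\<forall>p\<in>V. g p (s p) = g p (s p) \<and> g p (scale2 (\<phi> p) (t p)) = scale2 (\<phi> p) (g p (t p))" by simp
      show "(\<lambda>p. scale2 (\<phi> p) (g p (t p))) \<in> sections A V"
        by (rule sections_cong[OF V g_sections[OF V scaled] e])
    qed
    have A: "bracket A (\<lambda>p. g p (s p)) (\<lambda>p. g p (t p)) q \<in> fibre A" "g q (t q) \<in> fibre A" "g q (s q) \<in> fibre A"
      using bracket_section[OF V gs gt] gt gs q by (auto simp: sections_def)
    have an: "anchor A q (g q (s q)) = anchor B q (s q)" using anchor_eq qb section_fibre(2)[OF s q] by blast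
    show "bracket B s (\<lambda>p. scale2 (\<phi> p) (t p)) q = scale2 (\<phi> q) (bracket B s t q)
        + scale2 (dir_deriv (tangent B) \<phi> q (anchor B q (s q))) (t q)"
      unfolding bracket_B[OF V s scaled q] eq bracket_B[OF V s t q]
      using bracket_leibniz[OF V gs gt, of \<phi> q] \<phi> q tangent_eq A qb an fg[OF qb section_fibre(2)[OF t q]]
        pair.subspace_scale[OF fibre_subspace]
      by (simp add: f_add f_scale)
  }
  {
    assume q: "q \<in> V"
    have qb: "q \<in> base A" using in_base V q by blast
    show "bracket B s t q = - bracket B t s q"
      unfolding bracket_B[OF V s t q] bracket_B[OF V t s q] bracket_skew[OF V gs gt q]
      using bracket_section[OF V gt gs] q f_minus qb by (simp add: sections_def)
  }
  fix u assume u: "u \<in> sections B V" and q: "q \<in> V"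
  note gu = g_sections[OF V u]
  have qb: "q \<in> base A" using in_base V q by blast
  show "bracket B s (\<lambda>p. t p + u p) q = bracket B s t q + bracket B s u q"
  proof -
    have sum: "(\<lambda>p. t p + u p) \<in> sections B V"
    proof -
      have "holo (tangent B) scale2 V (\<lambda>p. t p + u p)"
        using t u by (intro holo_add(1)[OF hB VB(2)]) (auto simp: sections_def scale2_def vec_distrib)
      then show ?thesis using t u pair.subspace_add[OF fibre_B] by (simp add: sections_def)
    qed
    have e: "g p (t p + u p) = g p (t p) + g p (u p)" if "p \<in> V" for p
      using g_add in_base[OF V that] section_fibre(2)[OF t that] section_fibre(2)[OF u that] by blast
    have "bracket A (\<lambda>p. g p (s p)) (\<lambda>p. g p (t p + u p)) q = bracket A (\<lambda>p. g p (s p)) (\<lambda>p. g p (t p) + g p (u p)) q"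
    proof (rule bracket_local[OF V gs gs g_sections[OF V sum] _ _ q])
      show "\<forall>p\<in>V. g p (s p) = g p (s p) \<and> g p (t p + u p) = g p (t p) + g p (u p)" using e by simp
      show "(\<lambda>p. g p (t p) + g p (u p)) \<in> sections A V"
        by (rule sections_cong[OF V g_sections[OF V sum] e])
    qed
    then show ?thesis
      unfolding bracket_B[OF V s sum q] bracket_B[OF V s t q] bracket_B[OF V s u q]
      using bracket_add[OF V gs gt gu q] bracket_section[OF V gs gt] bracket_section[OF V gs gu] q qb
      by (simp add: sections_def f_add)
  qed
  show "bracket B s (bracket B t u) q + bracket B t (bracket B u s) q + bracket B u (bracket B s t) q = 0"
  proof -
    let ?s = "\<lambda>p. g p (s p)" and ?t = "\<lambda>p. g p (t p)" and ?u = "\<lambda>p. g p (u p)"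
    have fib: "bracket A ?s (bracket A ?t ?u) q \<in> fibre A" "bracket A ?t (bracket A ?u ?s) q \<in> fibre A"
      "bracket A ?u (bracket A ?s ?t) q \<in> fibre A"
      by (rule section_fibre(1)[OF bracket_section[OF V gs bracket_section[OF V gt gu]] q]
          section_fibre(1)[OF bracket_section[OF V gt bracket_section[OF V gu gs]] q]
          section_fibre(1)[OF bracket_section[OF V gu bracket_section[OF V gs gt]] q])+
    have "bracket B s (bracket B t u) q + bracket B t (bracket B u s) q + bracket B u (bracket B s t) q
      = f q (bracket A ?s (bracket A ?t ?u) q + bracket A ?t (bracket A ?u ?s) q + bracket A ?u (bracket A ?s ?t) q)"
      unfolding bracket_B_nested[OF V s t u q] bracket_B_nested[OF V t u s q] bracket_B_nested[OF V u s t q]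
      using fib qb pair.subspace_add[OF fibre_subspace] by (simp add: f_add)
    then show ?thesis using bracket_jacobi[OF V gs gt gu q] f_zero qb by simp
  qed
qed

lemma base_open_in_base: "open_in_base A (base A)"
  using base_open by (simp add: open_in_base_def)

lemma const_section:
  shows "u \<in> fibre A \<Longrightarrow> (\<lambda>q. u) \<in> sections A (base A)"
    and "u \<in> fibre B \<Longrightarrow> (\<lambda>q. u) \<in> sections B (base A)"
proof -
  have "holo (tangent A) scale2 (base A) (\<lambda>q. u)"
    by (rule holo_const(1)[where sc=scale2, OF tangent_subspace openin_imp_subset[OF base_open] scale2_zero])
  then show "u \<in> fibre A \<Longrightarrow> (\<lambda>q. u) \<in> sections A (base A)" "u \<in> fibre B \<Longrightarrow> (\<lambda>q. u) \<in> sections B (base A)"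
    using tangent_eq by (simp_all add: sections_def)
qed

lemma iso:
  fixes F
  assumes F: "\<And>q u. q \<in> base A \<Longrightarrow> u \<in> fibre A \<Longrightarrow> F (q, u) = (q, f q u)"
  shows "lie_algebroid_iso A B F"
    and "\<And>q u. q \<in> base A \<Longrightarrow> u \<in> fibre B \<Longrightarrow> inv_into (total_space A) F (q, u) = (q, g q u)"
proof -
  have bij: "bij_betw F (total_space A) (total_space B)"
    by (rule bij_betw_byWitness[of _ "\<lambda>(q, u). (q, g q u)"])
       (auto simp: total_space_def F gf fg f_fibre g_fibre base_eq[symmetric])
  show inv: "inv_into (total_space A) F (q, u) = (q, g q u)" if "q \<in> base A" "u \<in> fibre B" for q u
  proof (rule inv_into_f_eq)
    show "inj_on F (total_space A)" using bij by (simp add: bij_betw_def)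
    show "(q, g q u) \<in> total_space A" "F (q, g q u) = (q, u)"
      using that by (simp_all add: total_space_def g_fibre F fg)
  qed
  have cong: "open_in_base B V = open_in_base A V" for V using open_in_base_cong tangent_eq base_eq by metis
  have "lie_algebroid_morphism A B F"
    unfolding lie_algebroid_morphism_def
  proof (intro conjI ballI allI impI tangent_eq base_eq)
    fix q u assume q: "q \<in> base A" and u: "u \<in> fibre A"
    show "fst (F (q, u)) = q" "snd (F (q, u)) \<in> fibre B" using q u by (simp_all add: F f_fibre)
    show "snd (F (q, scale2 c u)) = scale2 c (snd (F (q, u)))" for c
      using q u pair.subspace_scale[OF fibre_subspace] by (simp add: F f_scale)
    show "anchor B q (snd (F (q, u))) = anchor A q u"
      using q u by (simp add: F anchor_eq[symmetric] f_fibre gf)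
    show "snd (F (q, u + v)) = snd (F (q, u)) + snd (F (q, v))" if "v \<in> fibre A" for v
      using q u that pair.subspace_add[OF fibre_subspace] by (simp add: F f_add)
  next
    fix u assume u: "u \<in> fibre A"
    have "(\<lambda>q. snd (F (q, u))) \<in> sections B (base A)"
      by (rule sections_cong[OF _ f_sections[OF base_open_in_base const_section(1)[OF u]]])
         (use base_open_in_base cong u in \<open>auto simp: F\<close>)
    then show "holo (tangent A) scale2 (base A) (\<lambda>q. snd (F (q, u)))" using tangent_eq by (simp add: sections_def)
  next
    fix V s t q assume V: "open_in_base A V" and s: "s \<in> sections A V" and t: "t \<in> sections A V" and q: "q \<in> V"
    have Fs: "(\<lambda>p. snd (F (p, s p))) \<in> sections B V" if s: "s \<in> sections A V" for s
      by (rule sections_cong[OF _ f_sections[OF V s]])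
         (use V cong s section_fibre in_base[OF V] in \<open>auto simp: F\<close>)
    have gF: "g p (snd (F (p, s p))) = s p" if "s \<in> sections A V" "p \<in> V" for s p
      using that section_fibre in_base[OF V] by (simp add: F gf)
    have "bracket A (\<lambda>p. g p (snd (F (p, s p)))) (\<lambda>p. g p (snd (F (p, t p)))) q = bracket A s t q"
      by (rule bracket_local[OF V g_sections[OF V Fs[OF s]] s g_sections[OF V Fs[OF t]] t _ q])
         (use gF s t in auto)
    then show "snd (F (q, bracket A s t q)) = bracket B (\<lambda>p. snd (F (p, s p))) (\<lambda>p. snd (F (p, t p))) q"
      using bracket_B[OF V Fs[OF s] Fs[OF t] q] F in_base[OF V q] section_fibre(1)[OF bracket_section[OF V s t] q] by simp
  qed
  moreover have "lie_algebroid_morphism B A (inv_into (total_space A) F)"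
    unfolding lie_algebroid_morphism_def base_eq[symmetric] tangent_eq[symmetric]
  proof (intro conjI ballI allI impI refl)
    fix q u assume q: "q \<in> base A" and u: "u \<in> fibre B"
    show "fst (inv_into (total_space A) F (q, u)) = q" "snd (inv_into (total_space A) F (q, u)) \<in> fibre A"
      using q u by (simp_all add: inv g_fibre)
    show "snd (inv_into (total_space A) F (q, scale2 c u)) = scale2 c (snd (inv_into (total_space A) F (q, u)))" for c
      using q u pair.subspace_scale[OF fibre_B] by (simp add: inv g_scale)
    show "anchor A q (snd (inv_into (total_space A) F (q, u))) = anchor B q u"
      using q u by (simp add: inv anchor_eq)
    show "snd (inv_into (total_space A) F (q, u + v))
        = snd (inv_into (total_space A) F (q, u)) + snd (inv_into (total_space A) F (q, v))" if "v \<in> fibre B" for v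
      using q u that pair.subspace_add[OF fibre_B] by (simp add: inv g_add)
  next
    fix u assume u: "u \<in> fibre B"
    have "(\<lambda>q. snd (inv_into (total_space A) F (q, u))) \<in> sections A (base A)"
      by (rule sections_cong[OF base_open_in_base g_sections[OF base_open_in_base const_section(2)[OF u]]])
         (use u in \<open>auto simp: inv\<close>)
    then show "holo (tangent A) scale2 (base A) (\<lambda>q. snd (inv_into (total_space A) F (q, u)))"
      by (simp add: sections_def)
  next
    fix V s t q assume V': "open_in_base B V" and s: "s \<in> sections B V" and t: "t \<in> sections B V" and q: "q \<in> V"
    have V: "open_in_base A V" using V' cong by simp
    have eq: "snd (inv_into (total_space A) F (p, s p)) = g p (s p)" if "s \<in> sections B V" "p \<in> V" for s p
      using that section_fibre in_base[OF V] by (simp add: inv)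
    have Gs: "(\<lambda>p. snd (inv_into (total_space A) F (p, s p))) \<in> sections A V" if s: "s \<in> sections B V" for s
      by (rule sections_cong[OF V g_sections[OF V s]]) (simp add: eq s)
    have "bracket A (\<lambda>p. snd (inv_into (total_space A) F (p, s p))) (\<lambda>p. snd (inv_into (total_space A) F (p, t p))) q
      = bracket A (\<lambda>p. g p (s p)) (\<lambda>p. g p (t p)) q"
      by (rule bracket_local[OF V Gs[OF s] g_sections[OF V s] Gs[OF t] g_sections[OF V t] _ q])
         (use eq s t in auto)
    then show "snd (inv_into (total_space A) F (q, bracket B s t q))
      = bracket A (\<lambda>p. snd (inv_into (total_space A) F (p, s p))) (\<lambda>p. snd (inv_into (total_space A) F (p, t p))) q"
      using bracket_eq[OF V s t q] inv[OF in_base[OF V q] bracket_fibre[OF V s t q]] by simp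
  qed
  ultimately show "lie_algebroid_iso A B F"
    using bij lie_algebroid_B lie_algebroid_axioms by (simp add: lie_algebroid_iso_def)
qed

end

section \<open>The trivial Lie algebroid\<close>

lemma vector_scale_axioms: "(c::complex) *s (u + v) = c *s u + c *s (v :: complex ^ 'm)" "(c::complex) *s (0 :: complex ^ 'm) = 0"
  by (simp_all add: vec_distrib)

lemma holo_minus:
  fixes f :: "complex ^ 'n \<Rightarrow> complex ^ 'm"
  assumes h: "vec.subspace h" and V: "V \<subseteq> h" and f: "holo h (*s) V f"
  shows "holo h (*s) V (\<lambda>p. - f p)"
    and "\<And>q v. q \<in> V \<Longrightarrow> v \<in> h \<Longrightarrow> dir_deriv h (\<lambda>p. - f p) q v = - dir_deriv h f q v"
  by (rule holo_linear[where ?sc1.0="(*s)" and ?sc2.0="(*s)", OF h V bounded_linear_minus[OF bounded_linear_ident] _ f];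
      simp)+

lemma holo_diff:
  fixes f g :: "complex ^ 'n \<Rightarrow> complex ^ 'm"
  assumes h: "vec.subspace h" and V: "V \<subseteq> h" and f: "holo h (*s) V f" and g: "holo h (*s) V g"
  shows "holo h (*s) V (\<lambda>p. f p - g p)"
    and "\<And>q v. q \<in> V \<Longrightarrow> v \<in> h \<Longrightarrow> dir_deriv h (\<lambda>p. f p - g p) q v = dir_deriv h f q v - dir_deriv h g q v"
  using holo_add[OF h V vector_scale_axioms(1) f holo_minus(1)[OF h V g]] holo_minus(2)[OF h V g] by simp_all

context dynamical_r_matrix
begin

lemma g'_bounded_bilinear: "bounded_bilinear g'_bracket"
proof -
  have "bounded_linear (g'_bracket u)" "bounded_linear (\<lambda>u. g'_bracket u v)" for u v
    by (rule linear_imp_bounded_linear; simp add: g'_add_left g'_add_right g'_scale_left g'_scale_right scaleR_vector_scale)+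
  then have "bilinear g'_bracket" by (simp add: bilinear_def linear_conv_bounded_linear)
  then show ?thesis by (simp add: bilinear_conv_bounded_bilinear)
qed

lemma g'_diff_right: "g'_bracket w (u - v) = g'_bracket w u - g'_bracket w v"
  using g'_add_right[of w u "- v"] g'_scale_right[of w "- 1" v] by simp

lemma section_iff:
  assumes V: "V \<subseteq> h"
  shows "s \<in> sections A_trivial V \<longleftrightarrow>
    (\<forall>p\<in>V. fst (s p) \<in> h) \<and> holo h (*s) V (fst \<circ> s) \<and> holo h (*s) V (snd \<circ> s)"
  by (simp add: sections_def A_trivial_def holo_pair[OF h_subspace V] mem_Times_iff)

lemma open_in_base_iff: "open_in_base A_trivial V \<longleftrightarrow> V \<subseteq> U \<and> openin (top_of_set h) V"
  by (simp add: open_in_base_def A_trivial_def)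

lemma g'_holo:
  assumes V: "V \<subseteq> h" and f: "holo h (*s) V f" and g: "holo h (*s) V g"
  shows "holo h (*s) V (\<lambda>p. g'_bracket (f p) (g p))"
    and "\<And>q v. q \<in> V \<Longrightarrow> v \<in> h \<Longrightarrow> dir_deriv h (\<lambda>p. g'_bracket (f p) (g p)) q v
      = g'_bracket (f q) (dir_deriv h g q v) + g'_bracket (dir_deriv h f q v) (g q)"
  by (rule holo_bilinear[where ?sc1.0="(*s)" and ?sc2.0="(*s)" and ?sc3.0="(*s)",
        OF h_subspace V g'_bounded_bilinear _ _ _ f g];
      simp add: g'_scale_left g'_scale_right vec_distrib)+

lemma trivial_bracket_eq:
  "trivial_bracket s t q = (dir_deriv h (fst \<circ> t) q (fst (s q)) - dir_deriv h (fst \<circ> s) q (fst (t q)),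
     dir_deriv h (snd \<circ> t) q (fst (s q)) - dir_deriv h (snd \<circ> s) q (fst (t q)) + g'_bracket (snd (s q)) (snd (t q)))"
  by (simp add: trivial_bracket_def)

lemma trivial_bracket_section:
  assumes V: "openin (top_of_set h) V" and s: "s \<in> sections A_trivial V" and t: "t \<in> sections A_trivial V"
  shows "trivial_bracket s t \<in> sections A_trivial V"
proof -
  have Vh: "V \<subseteq> h" using V openin_imp_subset by blast
  have sh: "\<And>p. p \<in> V \<Longrightarrow> (fst \<circ> s) p \<in> h" "holo h (*s) V (fst \<circ> s)" "holo h (*s) V (snd \<circ> s)"
    and th: "\<And>p. p \<in> V \<Longrightarrow> (fst \<circ> t) p \<in> h" "holo h (*s) V (fst \<circ> t)" "holo h (*s) V (snd \<circ> t)"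
    using s t section_iff[OF Vh] by auto
  have 1: "holo h (*s) V (\<lambda>q. dir_deriv h (fst \<circ> t) q ((fst \<circ> s) q) - dir_deriv h (fst \<circ> s) q ((fst \<circ> t) q))"
    by (rule holo_diff(1)[OF h_subspace Vh dir_deriv_along(1)[OF h_subspace V th(2) sh(2,1)]
          dir_deriv_along(1)[OF h_subspace V sh(2) th(2,1)]])
  have 2: "holo h (*s) V (\<lambda>q. dir_deriv h (snd \<circ> t) q ((fst \<circ> s) q) - dir_deriv h (snd \<circ> s) q ((fst \<circ> t) q)
      + g'_bracket ((snd \<circ> s) q) ((snd \<circ> t) q))"
    by (rule holo_add(1)[OF h_subspace Vh vector_scale_axioms(1)
          holo_diff(1)[OF h_subspace Vh dir_deriv_along(1)[OF h_subspace V th(3) sh(2,1)]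
            dir_deriv_along(1)[OF h_subspace V sh(3) th(2,1)]] g'_holo(1)[OF Vh sh(3) th(3)]])
  have "dir_deriv h (fst \<circ> t) q ((fst \<circ> s) q) - dir_deriv h (fst \<circ> s) q ((fst \<circ> t) q) \<in> h" if q: "q \<in> V" for q
    using dir_deriv_in_subspace[OF h_subspace V th(2) h_subspace th(1) q sh(1)[OF q]]
      dir_deriv_in_subspace[OF h_subspace V sh(2) h_subspace sh(1) q th(1)[OF q]] h_subspace
    by (intro vec.subspace_diff)
  then show ?thesis
    unfolding section_iff[OF Vh] using 1 2 by (simp add: trivial_bracket_eq comp_def)
qed

text \<open>In the cyclic sum of these expressions the second derivatives cancel by their symmetry, the products of
  first derivatives cancel identically, and the Jacobi identity of \<open>g'\<close> accounts for the rest.\<close>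

lemma trivial_bracket_nested:
  assumes V: "openin (top_of_set h) V" and s: "s \<in> sections A_trivial V" and t: "t \<in> sections A_trivial V"
    and u: "u \<in> sections A_trivial V" and q: "q \<in> V"
  defines "D \<equiv> \<lambda>f v. dir_deriv h f q v"
    and "D2 \<equiv> \<lambda>f v w. dir_deriv h (\<lambda>p. dir_deriv h f p w) q v"
  shows "trivial_bracket s (trivial_bracket t u) q =
   (D2 (fst \<circ> u) (fst (s q)) (fst (t q)) + D (fst \<circ> u) (D (fst \<circ> t) (fst (s q)))
    - (D2 (fst \<circ> t) (fst (s q)) (fst (u q)) + D (fst \<circ> t) (D (fst \<circ> u) (fst (s q))))
    - (D (fst \<circ> s) (D (fst \<circ> u) (fst (t q))) - D (fst \<circ> s) (D (fst \<circ> t) (fst (u q)))),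
    D2 (snd \<circ> u) (fst (s q)) (fst (t q)) + D (snd \<circ> u) (D (fst \<circ> t) (fst (s q)))
    - (D2 (snd \<circ> t) (fst (s q)) (fst (u q)) + D (snd \<circ> t) (D (fst \<circ> u) (fst (s q))))
    + (g'_bracket (snd (t q)) (D (snd \<circ> u) (fst (s q))) + g'_bracket (D (snd \<circ> t) (fst (s q))) (snd (u q)))
    - (D (snd \<circ> s) (D (fst \<circ> u) (fst (t q))) - D (snd \<circ> s) (D (fst \<circ> t) (fst (u q))))
    + (g'_bracket (snd (s q)) (D (snd \<circ> u) (fst (t q))) - g'_bracket (snd (s q)) (D (snd \<circ> t) (fst (u q)))
      + g'_bracket (snd (s q)) (g'_bracket (snd (t q)) (snd (u q)))))"
proof -
  have Vh: "V \<subseteq> h" using V openin_imp_subset by blast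
  have sh: "\<And>p. p \<in> V \<Longrightarrow> (fst \<circ> s) p \<in> h" "holo h (*s) V (fst \<circ> s)" "holo h (*s) V (snd \<circ> s)"
    and th: "\<And>p. p \<in> V \<Longrightarrow> (fst \<circ> t) p \<in> h" "holo h (*s) V (fst \<circ> t)" "holo h (*s) V (snd \<circ> t)"
    and uh: "\<And>p. p \<in> V \<Longrightarrow> (fst \<circ> u) p \<in> h" "holo h (*s) V (fst \<circ> u)" "holo h (*s) V (snd \<circ> u)"
    using s t u section_iff[OF Vh] by auto
  have sq: "fst (s q) \<in> h" and tq: "fst (t q) \<in> h" and uq: "fst (u q) \<in> h" using sh th uh q by auto
  have Dh: "D (fst \<circ> u) v \<in> h" "D (fst \<circ> t) v \<in> h" if "v \<in> h" for v
    unfolding D_def using dir_deriv_in_subspace[OF h_subspace V uh(2) h_subspace uh(1) q that]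
      dir_deriv_in_subspace[OF h_subspace V th(2) h_subspace th(1) q that] by blast+
  have along: "dir_deriv h (\<lambda>p. dir_deriv h f p (fst (a p))) q v = D2 f v (fst (a q)) + D f (D (fst \<circ> a) v)"
    if "holo h (*s) V f" "a \<in> sections A_trivial V" "v \<in> h" for f :: "complex ^ 'n \<Rightarrow> complex ^ 'n" and a v
    using dir_deriv_along(2)[OF h_subspace V that(1) _ _ q that(3), of "fst \<circ> a"] that(2) section_iff[OF Vh]
    by (simp add: D_def D2_def comp_def)
  have alongh: "holo h (*s) V (\<lambda>p. dir_deriv h f p (fst (a p)))"
    if "holo h (*s) V f" "a \<in> sections A_trivial V" for f :: "complex ^ 'n \<Rightarrow> complex ^ 'n" and a
    using dir_deriv_along(1)[OF h_subspace V that(1), of "fst \<circ> a"] that(2) section_iff[OF Vh]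
    by (simp add: comp_def)
  have diff: "D f (v - w) = D f v - D f w" if "holo h (*s) V f" "v \<in> h" "w \<in> h" for f :: "complex ^ 'n \<Rightarrow> complex ^ 'n" and v w
  proof -
    have wh: "- w \<in> h" using that(3) h_subspace vec.subspace_neg by blast
    have "D f (- w) = - D f w"
      using dir_deriv_direction(2)[OF h_subspace Vh that(1) q that(3), of "- 1"] by (simp add: D_def)
    then show ?thesis
      using dir_deriv_direction(1)[OF h_subspace Vh that(1) q that(2) wh] by (simp add: D_def)
  qed
  have m: "fst \<circ> trivial_bracket t u = (\<lambda>p. dir_deriv h (fst \<circ> u) p (fst (t p)) - dir_deriv h (fst \<circ> t) p (fst (u p)))"
    "snd \<circ> trivial_bracket t u = (\<lambda>p. dir_deriv h (snd \<circ> u) p (fst (t p)) - dir_deriv h (snd \<circ> t) p (fst (u p))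
        + g'_bracket ((snd \<circ> t) p) ((snd \<circ> u) p))"
    by (auto simp: trivial_bracket_eq)
  have Dm: "D (fst \<circ> trivial_bracket t u) v = D2 (fst \<circ> u) v (fst (t q)) + D (fst \<circ> u) (D (fst \<circ> t) v)
      - (D2 (fst \<circ> t) v (fst (u q)) + D (fst \<circ> t) (D (fst \<circ> u) v))" if v: "v \<in> h" for v
    unfolding m
    using holo_diff(2)[OF h_subspace Vh alongh[OF uh(2) t] alongh[OF th(2) u] q v]
      along[OF uh(2) t v] along[OF th(2) u v] by (simp add: D_def)
  have Dy: "D (snd \<circ> trivial_bracket t u) v = D2 (snd \<circ> u) v (fst (t q)) + D (snd \<circ> u) (D (fst \<circ> t) v)
      - (D2 (snd \<circ> t) v (fst (u q)) + D (snd \<circ> t) (D (fst \<circ> u) v))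
      + (g'_bracket (snd (t q)) (D (snd \<circ> u) v) + g'_bracket (D (snd \<circ> t) v) (snd (u q)))" if v: "v \<in> h" for v
    unfolding m
    using holo_diff[OF h_subspace Vh alongh[OF uh(3) t] alongh[OF th(3) u]]
      holo_add(2)[OF h_subspace Vh vector_scale_axioms(1) holo_diff(1)[OF h_subspace Vh alongh[OF uh(3) t] alongh[OF th(3) u]]
        g'_holo(1)[OF Vh th(3) uh(3)] q v] g'_holo(2)[OF Vh th(3) uh(3) q v]
      along[OF uh(3) t v] along[OF th(3) u v] q v by (simp add: D_def)
  have tb: "fst (trivial_bracket t u q) = D (fst \<circ> u) (fst (t q)) - D (fst \<circ> t) (fst (u q))"
    "snd (trivial_bracket t u q) = D (snd \<circ> u) (fst (t q)) - D (snd \<circ> t) (fst (u q))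
       + g'_bracket (snd (t q)) (snd (u q))"
    by (simp_all add: trivial_bracket_eq D_def)
  have outer: "trivial_bracket s (trivial_bracket t u) q =
     (D (fst \<circ> trivial_bracket t u) (fst (s q)) - D (fst \<circ> s) (fst (trivial_bracket t u q)),
      D (snd \<circ> trivial_bracket t u) (fst (s q)) - D (snd \<circ> s) (fst (trivial_bracket t u q))
        + g'_bracket (snd (s q)) (snd (trivial_bracket t u q)))"
    unfolding D_def by (rule trivial_bracket_eq)
  show ?thesis
    unfolding outer tb Dm[OF sq] Dy[OF sq] diff[OF sh(2) Dh(1)[OF tq] Dh(2)[OF uq]]
      diff[OF sh(3) Dh(1)[OF tq] Dh(2)[OF uq]] g'_add_right g'_diff_right ..
qed

lemma lie_algebroid_trivial: "lie_algebroid A_trivial"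
proof
  have fields: "tangent A_trivial = h" "base A_trivial = U" "fibre A_trivial = h \<times> UNIV"
    "anchor A_trivial = (\<lambda>q u. fst u)" "bracket A_trivial = trivial_bracket"
    by (simp_all add: A_trivial_def)
  note [simp] = fields
  show "vec.subspace (tangent A_trivial)" using h_subspace by simp
  show "openin (top_of_set (tangent A_trivial)) (base A_trivial)" using U_open by simp
  show "pair.subspace (fibre A_trivial)"
    using h_subspace by (auto simp: pair.subspace_def scale2_def zero_prod_def vec.subspace_0 vec.subspace_add vec.subspace_scale)
  show "anchor A_trivial q u \<in> tangent A_trivial" if "q \<in> base A_trivial" "u \<in> fibre A_trivial" for q u
    using that by (simp add: mem_Times_iff)
  show "anchor A_trivial q (u + v) = anchor A_trivial q u + anchor A_trivial q v"
    "anchor A_trivial q (scale2 c u) = c *s anchor A_trivial q u" for q u v c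
    by (simp_all add: scale2_def)
  show "holo (tangent A_trivial) (*s) (base A_trivial) (\<lambda>q. anchor A_trivial q u)" for u
    using holo_const(1)[where sc="(*s)", OF h_subspace U_sub vector_scale_axioms(2), of "fst u"] by simp
  fix V q and s t :: "complex ^ 'n \<Rightarrow> (complex ^ 'n) \<times> (complex ^ 'n)"
  assume "open_in_base A_trivial V"
  then have V: "openin (top_of_set h) V" and VU: "V \<subseteq> U" by (simp_all add: open_in_base_iff)
  have Vh: "V \<subseteq> h" using V openin_imp_subset by blast
  {
    fix s' t' :: "complex ^ 'n \<Rightarrow> (complex ^ 'n) \<times> (complex ^ 'n)"
    assume eq: "\<forall>p\<in>V. s p = s' p \<and> t p = t' p" and q: "q \<in> V"
    have "dir_deriv h (k \<circ> s) q v = dir_deriv h (k \<circ> s') q v" "dir_deriv h (k \<circ> t) q v = dir_deriv h (k \<circ> t') q v"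
      for k :: "(complex ^ 'n) \<times> (complex ^ 'n) \<Rightarrow> complex ^ 'n" and v using eq by (auto intro!: dir_deriv_cong[OF V q])
    then show "bracket A_trivial s t q = bracket A_trivial s' t' q"
      using eq q by (simp add: trivial_bracket_eq)
  }
  assume s: "s \<in> sections A_trivial V" and t: "t \<in> sections A_trivial V"
  have sh: "\<And>p. p \<in> V \<Longrightarrow> fst (s p) \<in> h" "holo h (*s) V (fst \<circ> s)" "holo h (*s) V (snd \<circ> s)"
    and th: "\<And>p. p \<in> V \<Longrightarrow> fst (t p) \<in> h" "holo h (*s) V (fst \<circ> t)" "holo h (*s) V (snd \<circ> t)"
    using s t section_iff[OF Vh] by auto
  show "bracket A_trivial s t \<in> sections A_trivial V" using trivial_bracket_section[OF V s t] by simp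
  {
    fix f assume f: "holo (tangent A_trivial) (*) V f" and q: "q \<in> V"
    have f': "holo h (*) V f" using f by simp
    have c: "fst \<circ> (\<lambda>p. scale2 (f p) (t p)) = (\<lambda>p. f p *s (fst \<circ> t) p)"
      "snd \<circ> (\<lambda>p. scale2 (f p) (t p)) = (\<lambda>p. f p *s (snd \<circ> t) p)" by (auto simp: scale2_def)
    note D = holo_scale(2)[OF h_subspace Vh f' th(2) q sh(1)[OF q]] holo_scale(2)[OF h_subspace Vh f' th(3) q sh(1)[OF q]]
      dir_deriv_direction(2)[OF h_subspace Vh sh(2) q th(1)[OF q]] dir_deriv_direction(2)[OF h_subspace Vh sh(3) q th(1)[OF q]]
    show "bracket A_trivial s (\<lambda>p. scale2 (f p) (t p)) q = scale2 (f q) (bracket A_trivial s t q)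
        + scale2 (dir_deriv (tangent A_trivial) f q (anchor A_trivial q (s q))) (t q)"
      unfolding fields trivial_bracket_eq c D
      using D by (simp add: scale2_def g'_scale_right vec_distrib vec.scale_right_diff_distrib algebra_simps)
  }
  show "bracket A_trivial s t q = - bracket A_trivial t s q"
    using g'_skew[of "snd (s q)" "snd (t q)"] by (simp add: trivial_bracket_eq)
  fix u assume u: "u \<in> sections A_trivial V" and q: "q \<in> V"
  have uh: "\<And>p. p \<in> V \<Longrightarrow> fst (u p) \<in> h" "holo h (*s) V (fst \<circ> u)" "holo h (*s) V (snd \<circ> u)"
    using u section_iff[OF Vh] by auto
  show "bracket A_trivial s (\<lambda>p. t p + u p) q = bracket A_trivial s t q + bracket A_trivial s u q"
  proof -
    have c: "fst \<circ> (\<lambda>p. t p + u p) = (\<lambda>p. (fst \<circ> t) p + (fst \<circ> u) p)"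
      "snd \<circ> (\<lambda>p. t p + u p) = (\<lambda>p. (snd \<circ> t) p + (snd \<circ> u) p)" by auto
    show ?thesis
      unfolding fields trivial_bracket_eq c
      using holo_add(2)[OF h_subspace Vh vector_scale_axioms(1) th(2) uh(2) q sh(1)[OF q]]
        holo_add(2)[OF h_subspace Vh vector_scale_axioms(1) th(3) uh(3) q sh(1)[OF q]]
        dir_deriv_direction(1)[OF h_subspace Vh sh(2) q th(1)[OF q] uh(1)[OF q]]
        dir_deriv_direction(1)[OF h_subspace Vh sh(3) q th(1)[OF q] uh(1)[OF q]]
      by (simp add: g'_add_right)
  qed
  show "bracket A_trivial s (bracket A_trivial t u) q + bracket A_trivial t (bracket A_trivial u s) q
      + bracket A_trivial u (bracket A_trivial s t) q = 0"
  proof -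
    let ?D2 = "\<lambda>f v w. dir_deriv h (\<lambda>p. dir_deriv h f p w) q v"
    note sq = sh(1)[OF q] and tq = th(1)[OF q] and uq = uh(1)[OF q]
    have c: "?D2 (fst \<circ> u) (fst (s q)) (fst (t q)) = ?D2 (fst \<circ> u) (fst (t q)) (fst (s q))"
      "?D2 (snd \<circ> u) (fst (s q)) (fst (t q)) = ?D2 (snd \<circ> u) (fst (t q)) (fst (s q))"
      "?D2 (fst \<circ> t) (fst (s q)) (fst (u q)) = ?D2 (fst \<circ> t) (fst (u q)) (fst (s q))"
      "?D2 (snd \<circ> t) (fst (s q)) (fst (u q)) = ?D2 (snd \<circ> t) (fst (u q)) (fst (s q))"
      "?D2 (fst \<circ> s) (fst (t q)) (fst (u q)) = ?D2 (fst \<circ> s) (fst (u q)) (fst (t q))"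
      "?D2 (snd \<circ> s) (fst (t q)) (fst (u q)) = ?D2 (snd \<circ> s) (fst (u q)) (fst (t q))"
      by (rule dir_deriv_commute_vector[OF h_subspace V _ q]; (rule sh th uh sq tq uq)?)+
    have k: "g'_bracket (dir_deriv h (snd \<circ> a) q v) w = - g'_bracket w (dir_deriv h (snd \<circ> a) q v)"
      for a :: "complex ^ 'n \<Rightarrow> (complex ^ 'n) \<times> (complex ^ 'n)" and v w by (rule g'_skew)
    show ?thesis
      unfolding fields trivial_bracket_nested[OF V s t u q] trivial_bracket_nested[OF V t u s q]
        trivial_bracket_nested[OF V u s t q] c k
      using g'_jacobi[of "snd (s q)" "snd (t q)" "snd (u q)"]
      by (simp add: zero_prod_def algebra_simps)
  qed
qed

section \<open>The isomorphism and its inverse on fibres and sections\<close>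

lemma kf_x_e: "\<alpha> \<in> \<Phi> \<Longrightarrow> kf (x k) (e \<alpha>) = 0"
  using kf_e_h[OF _ x_in_h] by (simp add: kf_sym)

lemma kf_x_hp: "kf (x k) (hp u) = kf (x k) u"
proof -
  have "kf (x k) u = kf (x k) (hp u + (\<Sum>\<alpha>\<in>\<Phi>. cf \<alpha> u *s e \<alpha>))" using expansion[of u] by simp
  then show ?thesis by (simp add: kf_linear kf_x_e)
qed

lemma coordinates_eqI:
  assumes "\<And>k. kf (x k) u = kf (x k) v" "\<And>\<alpha>. \<alpha> \<in> \<Phi> \<Longrightarrow> cf \<alpha> u = cf \<alpha> v"
  shows "u = v"
  by (rule eqI_cf) (simp_all add: hp_def assms)

lemma C_sharp_coord: "kf (x k) (C_sharp q u) = (\<Sum>j\<in>UNIV. C k j q * kf (x j) u)"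
proof -
  have "kf (x k) (C_sharp q u) = (\<Sum>i\<in>UNIV. if i = k then (\<Sum>j\<in>UNIV. C i j q * kf (x j) u) else 0)"
    unfolding C_sharp_def kf_linear
    by (intro sum.cong refl) (auto simp: orthonormal kf_sym[of u])
  then show ?thesis by simp
qed

lemma C_sharp_linear: "C_sharp q (u + v) = C_sharp q u + C_sharp q v" "C_sharp q (c *s u) = c *s C_sharp q u"
  by (rule coordinates_eqI; simp add: kf_linear C_sharp_coord cf_linear cf_h C_sharp_in_h sum.distrib
      sum_distrib_left algebra_simps)+

lemma \<psi>_eq: "\<psi> q u = (\<Sum>\<alpha>\<in>\<Phi>. (\<psi>_coeff \<alpha> q * cf \<alpha> u) *s e \<alpha>)"
  by (simp add: \<psi>_def cf_def)

lemma hp_\<psi>: "hp (\<psi> q u) = 0" and cf_\<psi>: "\<alpha> \<in> \<Phi> \<Longrightarrow> cf \<alpha> (\<psi> q u) = \<psi>_coeff \<alpha> q * cf \<alpha> u"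
  by (simp_all add: \<psi>_eq hp_root_sum cf_root_sum)

text \<open>The inverse of \<open>\<psi> q\<close> on \<open>n\<close>, extended by zero to \<open>h\<close>.\<close>

definition \<psi>inv :: "complex ^ 'n \<Rightarrow> complex ^ 'n \<Rightarrow> complex ^ 'n" where
  "\<psi>inv q u = (\<Sum>\<alpha>\<in>\<Phi>. (inverse (\<psi>_coeff \<alpha> q) * cf \<alpha> u) *s e \<alpha>)"

lemma hp_\<psi>inv: "hp (\<psi>inv q u) = 0" and cf_\<psi>inv: "\<alpha> \<in> \<Phi> \<Longrightarrow> cf \<alpha> (\<psi>inv q u) = inverse (\<psi>_coeff \<alpha> q) * cf \<alpha> u"
  by (simp_all add: \<psi>inv_def hp_root_sum cf_root_sum)

lemma inv_\<psi>: assumes q: "q \<in> U" shows "inv_into n (\<psi> q) (proj_n u) = \<psi>inv q u"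
proof (rule inv_into_f_eq)
  show "inj_on (\<psi> q) n"
  proof (rule inj_onI)
    fix u v assume uv: "u \<in> n" "v \<in> n" "\<psi> q u = \<psi> q v"
    show "u = v"
    proof (rule eqI_cf)
      fix \<alpha> assume \<alpha>: "\<alpha> \<in> \<Phi>"
      have "\<psi>_coeff \<alpha> q * cf \<alpha> u = \<psi>_coeff \<alpha> q * cf \<alpha> v" using uv(3) cf_\<psi>[OF \<alpha>] by metis
      then show "cf \<alpha> u = cf \<alpha> v" using \<psi>_coeff_nonzero[OF q \<alpha>] by simp
    qed (use uv in \<open>simp add: n_iff\<close>)
  qed
  show "\<psi>inv q u \<in> n" by (simp add: n_iff hp_\<psi>inv)
  show "\<psi> q (\<psi>inv q u) = proj_n u"
    by (rule eqI_cf) (simp_all add: hp_\<psi> proj_n_eq hp_part cf_\<psi> cf_\<psi>inv cf_part \<psi>_coeff_nonzero[OF q])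
qed

text \<open>\<open>\<sigma>\<close> and \<open>\<tau>\<close> on the fibre over \<open>q\<close>, with the inverse of \<open>\<psi> q\<close> made explicit.\<close>

definition \<sigma>_fibre :: "complex ^ 'n \<Rightarrow> (complex ^ 'n) \<times> (complex ^ 'n) \<Rightarrow> (complex ^ 'n) \<times> (complex ^ 'n)" where
  "\<sigma>_fibre q u = (- C_sharp q (fst u) - hp (snd u), fst u + \<psi>inv q (snd u))"

definition \<tau>_fibre :: "complex ^ 'n \<Rightarrow> (complex ^ 'n) \<times> (complex ^ 'n) \<Rightarrow> (complex ^ 'n) \<times> (complex ^ 'n)" where
  "\<tau>_fibre q u = (hp (snd u), - C_sharp q (hp (snd u)) - fst u + \<psi> q (snd u))"

lemma \<sigma>_eq: "q \<in> U \<Longrightarrow> \<sigma> (q, u) = (q, \<sigma>_fibre q u)"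
  by (simp add: \<sigma>_def \<sigma>_fibre_def inv_\<psi> proj_h_eq split: prod.split)

lemma \<sigma>_fibre_in: "u \<in> h \<times> UNIV \<Longrightarrow> \<sigma>_fibre q u \<in> h \<times> UNIV"
  using h_subspace C_sharp_in_h hp_in_h
  by (simp add: \<sigma>_fibre_def mem_Times_iff vec.subspace_diff vec.subspace_neg)

lemma \<tau>_fibre_in: "\<tau>_fibre q u \<in> h \<times> UNIV"
  by (simp add: \<tau>_fibre_def hp_in_h)

lemma \<tau>_\<sigma>: assumes "q \<in> U" "u \<in> h \<times> UNIV" shows "\<tau>_fibre q (\<sigma>_fibre q u) = u"
proof (rule prod_eqI)
  have l: "fst u \<in> h" "hp (fst u) = fst u" using assms(2) hp_h by (auto simp: mem_Times_iff)
  show "fst (\<tau>_fibre q (\<sigma>_fibre q u)) = fst u"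
    by (simp add: \<tau>_fibre_def \<sigma>_fibre_def hp_linear hp_\<psi>inv l)
  show "snd (\<tau>_fibre q (\<sigma>_fibre q u)) = snd u"
    by (rule eqI_cf)
       (use \<psi>_coeff_nonzero[OF assms(1)] in \<open>simp_all add: \<tau>_fibre_def \<sigma>_fibre_def hp_linear hp_more hp_\<psi>inv hp_\<psi> l
          hp_h[OF hp_in_h] hp_h[OF C_sharp_in_h] cf_linear cf_\<psi> cf_\<psi>inv cf_h C_sharp_in_h hp_in_h\<close>)
qed

lemma \<sigma>_\<tau>: assumes "q \<in> U" "u \<in> h \<times> UNIV" shows "\<sigma>_fibre q (\<tau>_fibre q u) = u"
proof (rule prod_eqI)
  have l: "fst u \<in> h" "hp (fst u) = fst u" using assms(2) hp_h by (auto simp: mem_Times_iff)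
  show "fst (\<sigma>_fibre q (\<tau>_fibre q u)) = fst u"
    by (simp add: \<tau>_fibre_def \<sigma>_fibre_def hp_linear hp_more hp_\<psi> l hp_h[OF C_sharp_in_h])
  show "snd (\<sigma>_fibre q (\<tau>_fibre q u)) = snd u"
    by (rule eqI_cf)
       (use \<psi>_coeff_nonzero[OF assms(1)] in \<open>simp_all add: \<tau>_fibre_def \<sigma>_fibre_def hp_linear hp_more hp_\<psi>inv hp_\<psi> l
          hp_h[OF hp_in_h] hp_h[OF C_sharp_in_h] cf_linear cf_\<psi> cf_\<psi>inv cf_h C_sharp_in_h hp_in_h\<close>)
qed

lemma \<sigma>_fibre_linear: "\<sigma>_fibre q (u + v) = \<sigma>_fibre q u + \<sigma>_fibre q v" "\<sigma>_fibre q (scale2 c u) = scale2 c (\<sigma>_fibre q u)"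
proof -
  have "\<psi>inv q (u + v) = \<psi>inv q u + \<psi>inv q v" "\<psi>inv q (c *s u) = c *s \<psi>inv q u" for u v c
    by (simp_all add: \<psi>inv_def cf_linear vec_distrib sum.distrib distrib_left vec.scale_sum_right mult.left_commute)
  then show "\<sigma>_fibre q (u + v) = \<sigma>_fibre q u + \<sigma>_fibre q v" "\<sigma>_fibre q (scale2 c u) = scale2 c (\<sigma>_fibre q u)"
    by (simp_all add: \<sigma>_fibre_def scale2_def C_sharp_linear hp_linear vec_distrib vec.scale_right_diff_distrib)
qed

lemma holo_subset: "holo h sc W f \<Longrightarrow> V \<subseteq> W \<Longrightarrow> holo h sc V f"
  by (auto simp: holo_def)

lemma holo_mult:
  assumes V: "V \<subseteq> h" and f: "holo h (*) V (f :: complex ^ 'n \<Rightarrow> complex)" and g: "holo h (*) V g"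
  shows "holo h (*) V (\<lambda>p. f p * g p)"
    and "\<And>q v. q \<in> V \<Longrightarrow> v \<in> h \<Longrightarrow> dir_deriv h (\<lambda>p. f p * g p) q v = f q * dir_deriv h g q v + dir_deriv h f q v * g q"
  by (rule holo_bilinear[where ?sc1.0="(*)" and ?sc2.0="(*)" and ?sc3.0="(*)",
        OF h_subspace V bounded_bilinear_mult _ _ _ f g]; simp add: algebra_simps)+

lemma holo_scalar_sum:
  assumes V: "V \<subseteq> h" and f: "\<And>i. i \<in> I \<Longrightarrow> holo h (*) V (f i :: complex ^ 'n \<Rightarrow> complex)"
  shows "holo h (*) V (\<lambda>p. \<Sum>i\<in>I. f i p)"
    and "\<And>q v. q \<in> V \<Longrightarrow> v \<in> h \<Longrightarrow> dir_deriv h (\<lambda>p. \<Sum>i\<in>I. f i p) q v = (\<Sum>i\<in>I. dir_deriv h (f i) q v)"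
proof -
  note S = holo_sum[where sc="(*)" and f=f and I=I, OF h_subspace V distrib_left f]
  show "holo h (*) V (\<lambda>p. \<Sum>i\<in>I. f i p)" by (rule conjunct1[OF S])
  show "dir_deriv h (\<lambda>p. \<Sum>i\<in>I. f i p) q v = (\<Sum>i\<in>I. dir_deriv h (f i) q v)" if "q \<in> V" "v \<in> h" for q v
    using conjunct2[OF S] that by simp
qed

lemma holo_scalar_const:
  assumes V: "V \<subseteq> h"
  shows "holo h (*) V (\<lambda>p. k :: complex)" and "\<And>q v. q \<in> V \<Longrightarrow> v \<in> h \<Longrightarrow> dir_deriv h (\<lambda>p. k :: complex) q v = 0"
  by (rule holo_const[where sc="(*)" and 'b=complex, OF h_subspace V]; simp)+

lemma holo_vector_sum:
  assumes V: "V \<subseteq> h" and f: "\<And>i. i \<in> I \<Longrightarrow> holo h (*) V (f i)"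
  shows "holo h (*s) V (\<lambda>p. \<Sum>i\<in>I. f i p *s (b i :: complex ^ 'n))"
  by (rule conjunct1[OF holo_sum[where sc="(*s)" and f="\<lambda>i p. f i p *s b i" and I=I, OF h_subspace V vector_scale_axioms(1)
        holo_scale(1)[OF h_subspace V f holo_const(1)[where sc="(*s)", OF h_subspace V vector_scale_axioms(2)]]]])

lemma cf_holo:
  assumes V: "V \<subseteq> h" and f: "holo h (*s) V f"
  shows "holo h (*) V (\<lambda>p. cf \<alpha> (f p))"
    and "\<And>q v. q \<in> V \<Longrightarrow> v \<in> h \<Longrightarrow> dir_deriv h (\<lambda>p. cf \<alpha> (f p)) q v = cf \<alpha> (dir_deriv h f q v)"
  unfolding cf_def by (rule kf_holo[OF assms]; assumption)+

lemma hp_holo: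
  assumes V: "V \<subseteq> h" and f: "holo h (*s) V f"
  shows "holo h (*s) V (\<lambda>p. hp (f p))"
    and "\<And>q v. q \<in> V \<Longrightarrow> v \<in> h \<Longrightarrow> dir_deriv h (\<lambda>p. hp (f p)) q v = hp (dir_deriv h f q v)"
proof -
  have "bounded_linear hp" by (rule linear_imp_bounded_linear) (simp_all add: hp_linear scaleR_vector_scale)
  note L = holo_linear[where ?sc1.0="(*s)" and ?sc2.0="(*s)", OF h_subspace V this hp_linear(2) f]
  show "holo h (*s) V (\<lambda>p. hp (f p))" by (rule L(1))
  show "\<And>q v. q \<in> V \<Longrightarrow> v \<in> h \<Longrightarrow> dir_deriv h (\<lambda>p. hp (f p)) q v = hp (dir_deriv h f q v)" by (rule L(2))
qed

lemma C_sharp_holo: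
  assumes V: "V \<subseteq> U" and f: "holo h (*s) V f"
  shows "holo h (*s) V (\<lambda>p. C_sharp p (f p))"
proof -
  have Vh: "V \<subseteq> h" using V U_sub by blast
  have "holo h (*) V (\<lambda>p. \<Sum>j\<in>UNIV. C i j p * kf (x j) (f p))" for i
    by (rule holo_scalar_sum(1)[OF Vh], rule holo_mult(1)[OF Vh holo_subset[OF C_holo V] kf_holo(1)[OF Vh f]])
  then have "holo h (*s) V (\<lambda>p. \<Sum>i\<in>UNIV. (\<Sum>j\<in>UNIV. C i j p * kf (x j) (f p)) *s x i)"
    by (rule holo_vector_sum[OF Vh])
  then show ?thesis by (simp add: C_sharp_def kf_sym[of _ "x _"] vec.scale_sum_left)
qed

lemma \<psi>_holo:
  assumes V: "V \<subseteq> U" and f: "holo h (*s) V f"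
  shows "holo h (*s) V (\<lambda>p. \<psi> p (f p))" and "holo h (*s) V (\<lambda>p. \<psi>inv p (f p))"
proof -
  have Vh: "V \<subseteq> h" using V U_sub by blast
  show "holo h (*s) V (\<lambda>p. \<psi> p (f p))"
    unfolding \<psi>_eq
    by (rule holo_vector_sum[OF Vh], rule holo_mult(1)[OF Vh holo_subset[OF \<psi>_coeff_deriv(1) V] cf_holo(1)[OF Vh f]])
  have inv: "holo h (*) V (\<lambda>p. inverse (\<psi>_coeff \<alpha> p))" if \<alpha>: "\<alpha> \<in> \<Phi>" for \<alpha>
    unfolding holo_def
  proof
    fix q assume q: "q \<in> V"
    obtain D where D: "(\<psi>_coeff \<alpha> has_derivative D) (at q within h)" "\<And>c v. D (c *s v) = c * D v"
      using \<psi>_coeff_deriv(1)[OF \<alpha>] q V unfolding holo_def by blast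
    have nz: "\<psi>_coeff \<alpha> q \<noteq> 0" using \<psi>_coeff_nonzero \<alpha> q V by blast
    show "\<exists>D. ((\<lambda>p. inverse (\<psi>_coeff \<alpha> p)) has_derivative D) (at q within h) \<and> (\<forall>c v. D (c *s v) = c * D v)"
      using Deriv.has_derivative_inverse[OF nz D(1)] D(2) by (intro exI conjI) auto
  qed
  show "holo h (*s) V (\<lambda>p. \<psi>inv p (f p))"
    unfolding \<psi>inv_def by (rule holo_vector_sum[OF Vh], rule holo_mult(1)[OF Vh inv cf_holo(1)[OF Vh f]])
qed

lemma \<tau>_holo:
  assumes V: "V \<subseteq> U" and Z: "holo h (*s) V Z" and B: "holo h (*s) V B"
  shows "holo h (*s) V (\<lambda>p. - C_sharp p (hp (B p)) - Z p + \<psi> p (B p))"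
proof -
  have Vh: "V \<subseteq> h" using V U_sub by blast
  show ?thesis
    by (rule holo_add(1)[where sc="(*s)", OF h_subspace Vh vector_scale_axioms(1)
          holo_diff(1)[OF h_subspace Vh holo_minus(1)[OF h_subspace Vh C_sharp_holo[OF V hp_holo(1)[OF Vh B]]] Z]
          \<psi>_holo(1)[OF V B]])
qed

lemma A_dynamical_simps: "tangent A_dynamical = h" "base A_dynamical = U" "fibre A_dynamical = h \<times> UNIV"
    "anchor A_dynamical = (\<lambda>q u. hp (snd u))" "bracket A_dynamical = dynamical_bracket"
  and A_trivial_simps: "tangent A_trivial = h" "base A_trivial = U" "fibre A_trivial = h \<times> UNIV"
    "anchor A_trivial = (\<lambda>q u. fst u)" "bracket A_trivial = trivial_bracket"
  by (simp_all add: A_dynamical_def A_trivial_def proj_h_eq fun_eq_iff)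

lemma sections_eq: "sections A_dynamical V = sections A_trivial V"
  by (simp add: sections_def A_dynamical_simps A_trivial_simps)

lemma \<sigma>_\<tau>_sections:
  assumes V: "V \<subseteq> U" and s: "s \<in> sections A_trivial V"
  shows "(\<lambda>p. \<sigma>_fibre p (s p)) \<in> sections A_trivial V" and "(\<lambda>p. \<tau>_fibre p (s p)) \<in> sections A_trivial V"
proof -
  have Vh: "V \<subseteq> h" using V U_sub by blast
  have s': "\<And>p. p \<in> V \<Longrightarrow> fst (s p) \<in> h" "holo h (*s) V (\<lambda>p. fst (s p))" "holo h (*s) V (\<lambda>p. snd (s p))"
    using s section_iff[OF Vh] by (auto simp: comp_def)
  show "(\<lambda>p. \<sigma>_fibre p (s p)) \<in> sections A_trivial V"
    unfolding section_iff[OF Vh]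
  proof (intro conjI ballI)
    show "fst (\<sigma>_fibre p (s p)) \<in> h" if "p \<in> V" for p
      using \<sigma>_fibre_in[of "s p" p] s'(1)[OF that] by (simp add: mem_Times_iff)
    show "holo h (*s) V (fst \<circ> (\<lambda>p. \<sigma>_fibre p (s p)))" "holo h (*s) V (snd \<circ> (\<lambda>p. \<sigma>_fibre p (s p)))"
      unfolding comp_def \<sigma>_fibre_def fst_conv snd_conv
      by (rule holo_diff(1)[OF h_subspace Vh holo_minus(1)[OF h_subspace Vh C_sharp_holo[OF V s'(2)]] hp_holo(1)[OF Vh s'(3)]]
          holo_add(1)[where sc="(*s)", OF h_subspace Vh vector_scale_axioms(1) s'(2) \<psi>_holo(2)[OF V s'(3)]])+
  qed
  show "(\<lambda>p. \<tau>_fibre p (s p)) \<in> sections A_trivial V"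
    unfolding section_iff[OF Vh]
  proof (intro conjI ballI)
    show "fst (\<tau>_fibre p (s p)) \<in> h" for p using \<tau>_fibre_in[of p "s p"] by (simp add: mem_Times_iff)
    show "holo h (*s) V (fst \<circ> (\<lambda>p. \<tau>_fibre p (s p)))" "holo h (*s) V (snd \<circ> (\<lambda>p. \<tau>_fibre p (s p)))"
      unfolding comp_def \<tau>_fibre_def fst_conv snd_conv
      by (rule hp_holo(1)[OF Vh s'(3)] \<tau>_holo[OF V s'(2,3)])+
  qed
qed

section \<open>The bracket identity\<close>

lemma dir_deriv_expand:
  assumes V: "V \<subseteq> h" and f: "holo h sc V f" and q: "q \<in> V" and v: "v \<in> h"
  shows "dir_deriv h f q v = (\<Sum>k\<in>UNIV. sc (kf (x k) v) (dir_deriv h f q (x k)))"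
proof -
  obtain D where D: "(f has_derivative D) (at q within h)" "\<And>c v. D (c *s v) = sc c (D v)"
    "\<And>v. v \<in> h \<Longrightarrow> dir_deriv h f q v = D v" by (rule holoD[OF h_subspace V f q]) blast
  interpret D: bounded_linear D using D(1) by (rule has_derivative_bounded_linear)
  have "D v = D (\<Sum>k\<in>UNIV. kf (x k) v *s x k)" using hp_h[OF v] by (simp add: hp_def)
  then show ?thesis using D(2,3) v x_in_h by (simp add: D.sum)
qed

text \<open>Existence of the representing vector comes from the orthonormal basis. Its root part is already written
  with the weights of \<open>g'\<close>, in view of \<open>\<phi>_deriv\<close>.\<close>

lemma dR_form_coord:
  assumes q: "q \<in> U"
  shows "dR_form q B B' \<in> h"
    and "kf (x k) (dR_form q B B') =
      (\<Sum>i\<in>UNIV. \<Sum>j\<in>UNIV. dir_deriv h (C i j) q (x k) * kf (x j) B * kf (x i) B')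
      + (\<Sum>\<alpha>\<in>\<Phi>. bracket_sign \<alpha> (- \<alpha>) * (\<psi>_coeff \<alpha> q * \<psi>_coeff (- \<alpha>) q) * kf \<alpha> (x k) * (cf \<alpha> B * cf (- \<alpha>) B'))"
proof -
  define G where "G v = kf (dir_deriv h (\<lambda>p. R p B) q v) B'" for v
  define w where "w = (\<Sum>k\<in>UNIV. G (x k) *s x k)"
  have w: "w \<in> h" unfolding w_def using h_subspace x_in_h by (intro vec.subspace_sum vec.subspace_scale) auto
  have kw: "kf v w = G v" if v: "v \<in> h" for v
    unfolding G_def dir_deriv_expand[OF U_sub R_holo q v] w_def
    by (simp add: kf_linear kf_sym[of v] mult.commute)
  have dR: "dR_form q B B' = w"
    unfolding dR_form_def
  proof (rule the_equality)
    show "w \<in> h \<and> (\<forall>v\<in>h. kf v w = kf (dir_deriv h (\<lambda>p. R p B) q v) B')" using w kw by (simp add: G_def)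
    fix w' assume w': "w' \<in> h \<and> (\<forall>v\<in>h. kf v w' = kf (dir_deriv h (\<lambda>p. R p B) q v) B')"
    have "kf (w' - w) v = 0" if "v \<in> h" for v
      using w' kw[OF that] that by (simp add: kf_sym[of _ v] kf_linear G_def)
    moreover have "w' - w \<in> h" using w w' h_subspace vec.subspace_diff by blast
    ultimately show "w' = w" using kf_nondegenerate_h[of "w' - w"] by simp
  qed
  show "dR_form q B B' \<in> h" using dR w by simp
  have eq: "kf B' (R p B) = (\<Sum>i\<in>UNIV. (\<Sum>j\<in>UNIV. C i j p * kf (x j) B) * kf (x i) B')
      + (\<Sum>\<alpha>\<in>\<Phi>. \<phi> \<alpha> p * (cf \<alpha> B * cf (- \<alpha>) B'))" for p
    unfolding R_def kf_linear cf_def minus_minus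
    by (intro arg_cong2[where f="(+)"] sum.cong refl)
       (simp_all add: kf_sym[of B'] kf_linear sum_distrib_right mult.assoc)
  note sum = holo_scalar_sum[OF U_sub] and mult = holo_mult[OF U_sub] and const = holo_scalar_const[OF U_sub]
  have hC: "holo h (*) U (\<lambda>p. C i j p * c)" for i j c by (rule mult(1)[OF C_holo const(1)])
  have hC2: "holo h (*) U (\<lambda>p. \<Sum>j\<in>UNIV. C i j p * kf (x j) B)" for i by (rule sum(1)[OF hC])
  have hC3: "holo h (*) U (\<lambda>p. (\<Sum>j\<in>UNIV. C i j p * kf (x j) B) * c)" for i c by (rule mult(1)[OF hC2 const(1)])
  have h\<phi>: "holo h (*) U (\<lambda>p. \<phi> \<alpha> p * c)" if "\<alpha> \<in> \<Phi>" for \<alpha> c by (rule mult(1)[OF \<phi>_holo[OF that] const(1)])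
  have xk: "x k \<in> h" by (rule x_in_h)
  have D1: "dir_deriv h (\<lambda>p. C i j p * c) q (x k) = dir_deriv h (C i j) q (x k) * c" for i j c
    using mult(2)[OF C_holo const(1) q xk] const(2)[OF q xk] by simp
  have D2: "dir_deriv h (\<lambda>p. \<Sum>j\<in>UNIV. C i j p * kf (x j) B) q (x k)
      = (\<Sum>j\<in>UNIV. dir_deriv h (C i j) q (x k) * kf (x j) B)" for i
    unfolding sum(2)[where f="\<lambda>j p. C i j p * kf (x j) B", OF hC q xk] D1 ..
  have D3: "dir_deriv h (\<lambda>p. (\<Sum>j\<in>UNIV. C i j p * kf (x j) B) * c) q (x k)
      = (\<Sum>j\<in>UNIV. dir_deriv h (C i j) q (x k) * kf (x j) B) * c" for i c
    using mult(2)[OF hC2 const(1) q xk, of i c] const(2)[OF q xk, of c] D2[of i] by simp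
  have D4: "dir_deriv h (\<lambda>p. \<phi> \<alpha> p * c) q (x k) = dir_deriv h (\<phi> \<alpha>) q (x k) * c" if "\<alpha> \<in> \<Phi>" for \<alpha> c
    using mult(2)[OF \<phi>_holo[OF that] const(1) q xk] const(2)[OF q xk] by simp
  have "kf (x k) (dR_form q B B') = kf B' (dir_deriv h (\<lambda>p. R p B) q (x k))"
    unfolding dR kw[OF xk] G_def by (rule kf_sym)
  also have "\<dots> = dir_deriv h (\<lambda>p. kf B' (R p B)) q (x k)"
    by (rule kf_holo(2)[OF U_sub R_holo q xk, symmetric])
  also have "\<dots> = dir_deriv h (\<lambda>p. \<Sum>i\<in>UNIV. (\<Sum>j\<in>UNIV. C i j p * kf (x j) B) * kf (x i) B') q (x k)
      + dir_deriv h (\<lambda>p. \<Sum>\<alpha>\<in>\<Phi>. \<phi> \<alpha> p * (cf \<alpha> B * cf (- \<alpha>) B')) q (x k)"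
    unfolding eq by (rule holo_add(2)[where sc="(*)", OF h_subspace U_sub distrib_left sum(1)[OF hC3] sum(1)[OF h\<phi>] q xk])
  also have "dir_deriv h (\<lambda>p. \<Sum>i\<in>UNIV. (\<Sum>j\<in>UNIV. C i j p * kf (x j) B) * kf (x i) B') q (x k)
      = (\<Sum>i\<in>UNIV. \<Sum>j\<in>UNIV. dir_deriv h (C i j) q (x k) * kf (x j) B * kf (x i) B')"
    unfolding sum(2)[where f="\<lambda>i p. (\<Sum>j\<in>UNIV. C i j p * kf (x j) B) * kf (x i) B'", OF hC3 q xk] D3
    by (simp add: sum_distrib_right)
  also have "dir_deriv h (\<lambda>p. \<Sum>\<alpha>\<in>\<Phi>. \<phi> \<alpha> p * (cf \<alpha> B * cf (- \<alpha>) B')) q (x k)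
      = (\<Sum>\<alpha>\<in>\<Phi>. dir_deriv h (\<phi> \<alpha>) q (x k) * (cf \<alpha> B * cf (- \<alpha>) B'))"
    by (subst sum(2)[where f="\<lambda>\<alpha> p. \<phi> \<alpha> p * (cf \<alpha> B * cf (- \<alpha>) B')" and I=\<Phi>, OF h\<phi> q xk])
       (assumption, rule sum.cong[OF refl D4])
  also have "\<dots> = (\<Sum>\<alpha>\<in>\<Phi>. bracket_sign \<alpha> (- \<alpha>) * (\<psi>_coeff \<alpha> q * \<psi>_coeff (- \<alpha>) q) * kf \<alpha> (x k) * (cf \<alpha> B * cf (- \<alpha>) B'))"
    by (intro sum.cong refl) (simp add: \<phi>_deriv[OF _ q xk])
  finally show "kf (x k) (dR_form q B B') =
      (\<Sum>i\<in>UNIV. \<Sum>j\<in>UNIV. dir_deriv h (C i j) q (x k) * kf (x j) B * kf (x i) B')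
      + (\<Sum>\<alpha>\<in>\<Phi>. bracket_sign \<alpha> (- \<alpha>) * (\<psi>_coeff \<alpha> q * \<psi>_coeff (- \<alpha>) q) * kf \<alpha> (x k) * (cf \<alpha> B * cf (- \<alpha>) B'))" .
qed

text \<open>The cyclic identity expresses the derivative of \<open>C\<close> in the direction \<open>x k\<close> by derivatives in the directions
  of the two contracted vectors. In this form it cancels against the derivatives of \<open>C_sharp\<close>.\<close>

lemma closed_contracted:
  assumes q: "q \<in> U"
  shows "(\<Sum>i\<in>UNIV. \<Sum>j\<in>UNIV. dir_deriv h (C i j) q (x k) * kf (x j) B * kf (x i) B')
    = (\<Sum>j\<in>UNIV. dir_deriv h (C k j) q (hp B') * kf (x j) B) - (\<Sum>j\<in>UNIV. dir_deriv h (C k j) q (hp B) * kf (x j) B')"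
proof -
  let ?d = "\<lambda>i j m. dir_deriv h (C i j) q (x m)"
  have skew: "?d i j m = - ?d j i m" for i j m
  proof -
    have "?d i j m = dir_deriv h (\<lambda>p. - 1 * C j i p) q (x m)"
      using U_sub C_skew by (intro dir_deriv_cong[OF U_open q]) auto
    then show ?thesis
      using holo_mult(2)[OF U_sub holo_scalar_const(1)[OF U_sub, of "- 1"] C_holo q x_in_h, of j i m]
        holo_scalar_const(2)[OF U_sub q x_in_h, of "- 1" m] by simp
  qed
  have cl: "?d i j k = ?d k j i - ?d k i j" for i j
    using C_closed[OF U_open C_holo q, of i j k] skew[of j k i] by (simp add: algebra_simps eq_neg_iff_add_eq_0)
  have ex: "dir_deriv h (C k j) q (hp u) = (\<Sum>m\<in>UNIV. kf (x m) u * ?d k j m)" for j u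
    using dir_deriv_expand[OF U_sub C_holo q hp_in_h, of k j u] by (simp add: kf_x_hp)
  have "(\<Sum>i\<in>UNIV. \<Sum>j\<in>UNIV. ?d i j k * kf (x j) B * kf (x i) B')
      = (\<Sum>i\<in>UNIV. \<Sum>j\<in>UNIV. kf (x i) B' * ?d k j i * kf (x j) B)
       - (\<Sum>i\<in>UNIV. \<Sum>j\<in>UNIV. kf (x j) B * ?d k i j * kf (x i) B')"
    unfolding cl by (simp add: sum_subtractf[symmetric] algebra_simps)
  also have "(\<Sum>i\<in>UNIV. \<Sum>j\<in>UNIV. kf (x i) B' * ?d k j i * kf (x j) B)
      = (\<Sum>j\<in>UNIV. \<Sum>i\<in>UNIV. kf (x i) B' * ?d k j i * kf (x j) B)"
    by (rule sum.swap)
  finally show ?thesis by (simp add: ex sum_distrib_right)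
qed

text \<open>Root components pair to \<open>\<phi> \<beta> + \<phi> (- \<beta>) = 0\<close>. Hence the anchor is compatible with the bracket.\<close>

lemma R_bracket_h:
  assumes "Z \<in> h" "Z' \<in> h"
  shows "hp (br (R q B + Z) B' + br B (R q B' + Z')) = 0"
proof -
  have "hp (br u v) = (\<Sum>\<beta>\<in>\<Phi>. (cf \<beta> u * cf (- \<beta>) v) *s \<beta>)" for u v
    by (subst br_coordinates) (simp add: hp_linear hp_more hp_h_action hp_weighted_bracket)
  then have "hp (br (R q B + Z) B' + br B (R q B' + Z'))
      = (\<Sum>\<beta>\<in>\<Phi>. (cf \<beta> (R q B + Z) * cf (- \<beta>) B') *s \<beta> + (cf \<beta> B * cf (- \<beta>) (R q B' + Z')) *s \<beta>)"
    by (simp add: hp_linear sum.distrib)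
  also have "\<dots> = 0"
  proof (rule sum_cong_zero)
    fix \<beta> assume \<beta>: "\<beta> \<in> \<Phi>"
    show "(cf \<beta> (R q B + Z) * cf (- \<beta>) B') *s \<beta> + (cf \<beta> B * cf (- \<beta>) (R q B' + Z')) *s \<beta> = 0"
      using \<beta> neg_root[OF \<beta>] assms
      by (simp add: cf_linear R_coordinates(2) cf_h \<phi>_odd vec.scale_left_distrib[symmetric])
  qed
  finally show ?thesis .
qed

lemma R_bracket_root:
  assumes "\<alpha> \<in> \<Phi>" "Z \<in> h" "Z' \<in> h"
  shows "cf \<alpha> (br (R q B + Z) B' + br B (R q B' + Z'))
    = kf \<alpha> (C_sharp q B + Z) * cf \<alpha> B' - kf \<alpha> (C_sharp q B' + Z') * cf \<alpha> B
      + \<phi> \<alpha> q * (kf \<alpha> (hp B) * cf \<alpha> B' - kf \<alpha> (hp B') * cf \<alpha> B)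
      + (\<Sum>\<beta>\<in>\<Phi>. \<Sum>\<gamma>\<in>\<Phi>. (\<phi> \<beta> q + \<phi> \<gamma> q) * (cf \<beta> B * cf \<gamma> B') * cf \<alpha> (br (e \<beta>) (e \<gamma>)))"
proof -
  have br: "cf \<alpha> (br u v) = kf \<alpha> (hp u) * cf \<alpha> v - kf \<alpha> (hp v) * cf \<alpha> u
      + (\<Sum>\<beta>\<in>\<Phi>. \<Sum>\<gamma>\<in>\<Phi>. cf \<beta> u * cf \<gamma> v * cf \<alpha> (br (e \<beta>) (e \<gamma>)))" for u v
    using assms(1) by (subst br_coordinates) (simp add: cf_linear cf_h_action cf_weighted_bracket)
  have 1: "(\<Sum>\<beta>\<in>\<Phi>. \<Sum>\<gamma>\<in>\<Phi>. cf \<beta> (R q B + Z) * cf \<gamma> B' * cf \<alpha> (br (e \<beta>) (e \<gamma>)))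
      = (\<Sum>\<beta>\<in>\<Phi>. \<Sum>\<gamma>\<in>\<Phi>. \<phi> \<beta> q * (cf \<beta> B * cf \<gamma> B') * cf \<alpha> (br (e \<beta>) (e \<gamma>)))"
    using assms by (intro sum.cong refl) (simp add: cf_linear R_coordinates cf_h)
  have 2: "(\<Sum>\<beta>\<in>\<Phi>. \<Sum>\<gamma>\<in>\<Phi>. cf \<beta> B * cf \<gamma> (R q B' + Z') * cf \<alpha> (br (e \<beta>) (e \<gamma>)))
      = (\<Sum>\<beta>\<in>\<Phi>. \<Sum>\<gamma>\<in>\<Phi>. \<phi> \<gamma> q * (cf \<beta> B * cf \<gamma> B') * cf \<alpha> (br (e \<beta>) (e \<gamma>)))"
    using assms by (intro sum.cong refl) (simp add: cf_linear R_coordinates cf_h)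
  show ?thesis
    unfolding cf_linear(1)[of \<alpha> "br (R q B + Z) B'"] br[of "R q B + Z" B'] br[of B "R q B' + Z'"] 1 2
    using assms by (simp add: cf_linear(1) R_coordinates cf_h hp_linear hp_h distrib_right sum.distrib)
       (simp add: algebra_simps)
qed

text \<open>The core of the theorem. Both sides are compared in the coordinates of \<open>g\<close>: the coefficients of root
  vectors and the products with the basis of \<open>h\<close>.\<close>

lemma \<tau>_bracket:
  assumes V: "openin (top_of_set h) V" "V \<subseteq> U" and q: "q \<in> V"
    and s: "s \<in> sections A_trivial V" and t: "t \<in> sections A_trivial V"
  shows "\<tau>_fibre q (dynamical_bracket s t q) = trivial_bracket (\<lambda>p. \<tau>_fibre p (s p)) (\<lambda>p. \<tau>_fibre p (t p)) q"
    and "fst (dynamical_bracket s t q) \<in> h"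
proof -
  have Vh: "V \<subseteq> h" and qU: "q \<in> U" using V q U_sub by auto
  define Z B Z' B' where "Z = (\<lambda>p. fst (s p))" and "B = (\<lambda>p. snd (s p))" and "Z' = (\<lambda>p. fst (t p))" and "B' = (\<lambda>p. snd (t p))"
  have Z: "\<And>p. p \<in> V \<Longrightarrow> Z p \<in> h" "holo h (*s) V Z" and B: "holo h (*s) V B"
    and Z': "\<And>p. p \<in> V \<Longrightarrow> Z' p \<in> h" "holo h (*s) V Z'" and B': "holo h (*s) V B'"
    using s t section_iff[OF Vh] by (auto simp: comp_def Z_def B_def Z'_def B'_def)
  define l l' where "l = hp (B q)" and "l' = hp (B' q)"
  have lh: "l \<in> h" "l' \<in> h" by (simp_all add: l_def l'_def hp_in_h)
  define W where "W = br (R q (B q) + Z q) (B' q) + br (B q) (R q (B' q) + Z' q)"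
  define E where "E = dir_deriv h B' q l - dir_deriv h B q l' - W"
  define F where "F = dir_deriv h Z' q l - dir_deriv h Z q l' - dR_form q (B q) (B' q)"
  have db: "dynamical_bracket s t q = (F, E)"
    by (simp add: dynamical_bracket_def comp_def E_def F_def W_def l_def l'_def proj_h_eq Z_def B_def Z'_def B'_def)
  have Fh: "F \<in> h"
    unfolding F_def using dir_deriv_in_subspace[OF h_subspace V(1) Z(2) h_subspace Z(1) q lh(2)]
      dir_deriv_in_subspace[OF h_subspace V(1) Z'(2) h_subspace Z'(1) q lh(1)] dR_form_coord(1)[OF qU] h_subspace
    by (intro vec.subspace_diff)
  then show "fst (dynamical_bracket s t q) \<in> h" by (simp add: db)
  have hpW: "hp W = 0" unfolding W_def by (rule R_bracket_h[OF Z(1)[OF q] Z'(1)[OF q]])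
  define \<xi> where "\<xi> = (\<lambda>p. - C_sharp p (hp (B p)) - Z p + \<psi> p (B p))"
  define \<xi>' where "\<xi>' = (\<lambda>p. - C_sharp p (hp (B' p)) - Z' p + \<psi> p (B' p))"
  have \<xi>h: "holo h (*s) V \<xi>" "holo h (*s) V \<xi>'"
    unfolding \<xi>_def \<xi>'_def
    by (rule \<tau>_holo[OF V(2) Z(2) B] \<tau>_holo[OF V(2) Z'(2) B'])+
  have tb: "trivial_bracket (\<lambda>p. \<tau>_fibre p (s p)) (\<lambda>p. \<tau>_fibre p (t p)) q =
     (hp (dir_deriv h B' q l) - hp (dir_deriv h B q l'),
      dir_deriv h \<xi>' q l - dir_deriv h \<xi> q l' + g'_bracket (\<xi> q) (\<xi>' q))"
    using hp_holo(2)[OF Vh B q lh(2)] hp_holo(2)[OF Vh B' q lh(1)]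
    by (simp add: trivial_bracket_eq comp_def \<tau>_fibre_def \<xi>_def \<xi>'_def l_def l'_def Z_def B_def Z'_def B'_def)
  have \<xi>cf: "cf \<alpha> (\<xi> p) = \<psi>_coeff \<alpha> p * cf \<alpha> (B p)" "cf \<alpha> (\<xi>' p) = \<psi>_coeff \<alpha> p * cf \<alpha> (B' p)"
    if "\<alpha> \<in> \<Phi>" "p \<in> V" for \<alpha> p
    using that Z(1) Z'(1) by (simp_all add: \<xi>_def \<xi>'_def cf_linear cf_\<psi> cf_h C_sharp_in_h)
  have kx: "kf (x k) (\<psi> p u) = 0" for k p u by (subst kf_x_hp[symmetric]) (simp add: hp_\<psi> kf_linear)
  have \<xi>x: "kf (x k) (\<xi> p) = - (\<Sum>j\<in>UNIV. C k j p * kf (x j) (B p)) - kf (x k) (Z p)"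
    "kf (x k) (\<xi>' p) = - (\<Sum>j\<in>UNIV. C k j p * kf (x j) (B' p)) - kf (x k) (Z' p)" for k p
    by (simp_all add: \<xi>_def \<xi>'_def kf_linear C_sharp_coord kf_x_hp kx)
  have hp\<xi>: "hp (\<xi> q) = - (C_sharp q (B q) + Z q)" "hp (\<xi>' q) = - (C_sharp q (B' q) + Z' q)"
    using Z(1)[OF q] Z'(1)[OF q]
    by (simp_all add: \<xi>_def \<xi>'_def hp_linear hp_more hp_\<psi> hp_h C_sharp_in_h C_sharp_hp)
  \<comment> \<open>Root components: the logarithmic derivative of \<open>\<psi>\<close> and the addition theorem.\<close>
  have dcf: "cf \<alpha> (dir_deriv h f q v) = \<psi>_coeff \<alpha> q * cf \<alpha> (dir_deriv h b q v) - \<phi> \<alpha> q * \<psi>_coeff \<alpha> q * kf \<alpha> v * cf \<alpha> (b q)"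
    if "\<alpha> \<in> \<Phi>" "v \<in> h" "holo h (*s) V f" "holo h (*s) V b" "\<And>p. p \<in> V \<Longrightarrow> cf \<alpha> (f p) = \<psi>_coeff \<alpha> p * cf \<alpha> (b p)"
    for \<alpha> v f b
  proof -
    have "cf \<alpha> (dir_deriv h f q v) = dir_deriv h (\<lambda>p. cf \<alpha> (f p)) q v"
      by (rule cf_holo(2)[OF Vh that(3) q that(2), symmetric])
    also have "\<dots> = dir_deriv h (\<lambda>p. \<psi>_coeff \<alpha> p * cf \<alpha> (b p)) q v" by (rule dir_deriv_cong[OF V(1) q that(5)])
    also have "\<dots> = \<psi>_coeff \<alpha> q * dir_deriv h (\<lambda>p. cf \<alpha> (b p)) q v + dir_deriv h (\<psi>_coeff \<alpha>) q v * cf \<alpha> (b q)"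
      by (rule holo_mult(2)[OF Vh holo_subset[OF \<psi>_coeff_deriv(1)[OF that(1)] V(2)] cf_holo(1)[OF Vh that(4)] q that(2)])
    finally show ?thesis
      using cf_holo(2)[OF Vh that(4) q that(2)] \<psi>_coeff_deriv(2)[OF that(1) qU that(2)] by simp
  qed
  have roots: "cf \<alpha> (- C_sharp q (hp E) - F + \<psi> q E)
      = cf \<alpha> (dir_deriv h \<xi>' q l - dir_deriv h \<xi> q l' + g'_bracket (\<xi> q) (\<xi>' q))" if \<alpha>: "\<alpha> \<in> \<Phi>" for \<alpha>
  proof -
    define mixed where "mixed = (\<Sum>\<beta>\<in>\<Phi>. \<Sum>\<gamma>\<in>\<Phi>. (\<phi> \<beta> q + \<phi> \<gamma> q) * (cf \<beta> (B q) * cf \<gamma> (B' q)) * cf \<alpha> (br (e \<beta>) (e \<gamma>)))"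
    define twisted where "twisted = (\<Sum>\<beta>\<in>\<Phi>. \<Sum>\<gamma>\<in>\<Phi>. bracket_sign \<beta> \<gamma> * (cf \<beta> (\<xi> q) * cf \<gamma> (\<xi>' q)) * cf \<alpha> (br (e \<beta>) (e \<gamma>)))"
    have ST: "\<psi>_coeff \<alpha> q * mixed = - twisted"
      unfolding mixed_def twisted_def sum_distrib_left sum_negf[symmetric]
    proof (intro sum.cong refl)
      fix \<beta> \<gamma> assume \<beta>: "\<beta> \<in> \<Phi>" and \<gamma>: "\<gamma> \<in> \<Phi>"
      show "\<psi>_coeff \<alpha> q * ((\<phi> \<beta> q + \<phi> \<gamma> q) * (cf \<beta> (B q) * cf \<gamma> (B' q)) * cf \<alpha> (br (e \<beta>) (e \<gamma>)))
        = - (bracket_sign \<beta> \<gamma> * (cf \<beta> (\<xi> q) * cf \<gamma> (\<xi>' q)) * cf \<alpha> (br (e \<beta>) (e \<gamma>)))"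
      proof (cases "\<alpha> = \<beta> + \<gamma>")
        case True
        have "- (bracket_sign \<beta> \<gamma> * (cf \<beta> (\<xi> q) * cf \<gamma> (\<xi>' q)))
          = - (bracket_sign \<beta> \<gamma> * (\<psi>_coeff \<beta> q * \<psi>_coeff \<gamma> q)) * (cf \<beta> (B q) * cf \<gamma> (B' q))"
          using \<xi>cf[OF \<beta> q] \<xi>cf[OF \<gamma> q] by simp
        also have "\<dots> = \<psi>_coeff \<alpha> q * (\<phi> \<beta> q + \<phi> \<gamma> q) * (cf \<beta> (B q) * cf \<gamma> (B' q))"
          using \<phi>_\<psi>_addition[OF qU \<beta> \<gamma>] \<alpha> True by simp
        finally have E: "- (bracket_sign \<beta> \<gamma> * (cf \<beta> (\<xi> q) * cf \<gamma> (\<xi>' q)))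
          = \<psi>_coeff \<alpha> q * (\<phi> \<beta> q + \<phi> \<gamma> q) * (cf \<beta> (B q) * cf \<gamma> (B' q))" .
        let ?c = "cf \<alpha> (br (e \<beta>) (e \<gamma>))"
        have "\<psi>_coeff \<alpha> q * ((\<phi> \<beta> q + \<phi> \<gamma> q) * (cf \<beta> (B q) * cf \<gamma> (B' q)) * ?c)
          = (\<psi>_coeff \<alpha> q * (\<phi> \<beta> q + \<phi> \<gamma> q) * (cf \<beta> (B q) * cf \<gamma> (B' q))) * ?c" by (simp only: mult.assoc)
        also have "\<dots> = - (bracket_sign \<beta> \<gamma> * (cf \<beta> (\<xi> q) * cf \<gamma> (\<xi>' q))) * ?c" by (simp only: E)
        finally show ?thesis by (simp only: mult_minus_left)
      qed (use cf_br_e_e_zero[OF \<alpha> \<beta> \<gamma>] in simp)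
    qed
    have W: "cf \<alpha> W = kf \<alpha> (C_sharp q (B q) + Z q) * cf \<alpha> (B' q) - kf \<alpha> (C_sharp q (B' q) + Z' q) * cf \<alpha> (B q)
      + \<phi> \<alpha> q * (kf \<alpha> l * cf \<alpha> (B' q) - kf \<alpha> l' * cf \<alpha> (B q)) + mixed"
      unfolding W_def mixed_def l_def l'_def by (rule R_bracket_root[OF \<alpha> Z(1)[OF q] Z'(1)[OF q]])
    have L: "cf \<alpha> (- C_sharp q (hp E) - F + \<psi> q E)
        = \<psi>_coeff \<alpha> q * (cf \<alpha> (dir_deriv h B' q l) - cf \<alpha> (dir_deriv h B q l') - cf \<alpha> W)"
      using \<alpha> Fh by (simp add: cf_linear cf_h C_sharp_in_h cf_\<psi> E_def)
    have G: "cf \<alpha> (g'_bracket (\<xi> q) (\<xi>' q)) = kf \<alpha> (hp (\<xi> q)) * cf \<alpha> (\<xi>' q) - kf \<alpha> (hp (\<xi>' q)) * cf \<alpha> (\<xi> q) + twisted"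
      using \<alpha> by (simp add: g'_bracket_coordinates cf_linear cf_h_action cf_weighted_bracket twisted_def)
    have d: "cf \<alpha> (dir_deriv h \<xi>' q l) = \<psi>_coeff \<alpha> q * cf \<alpha> (dir_deriv h B' q l)
        - \<phi> \<alpha> q * \<psi>_coeff \<alpha> q * kf \<alpha> l * cf \<alpha> (B' q)"
      by (rule dcf[OF \<alpha> lh(1) \<xi>h(2) B' \<xi>cf(2)[OF \<alpha>]])
    have d': "cf \<alpha> (dir_deriv h \<xi> q l') = \<psi>_coeff \<alpha> q * cf \<alpha> (dir_deriv h B q l')
        - \<phi> \<alpha> q * \<psi>_coeff \<alpha> q * kf \<alpha> l' * cf \<alpha> (B q)"
      by (rule dcf[OF \<alpha> lh(2) \<xi>h(1) B \<xi>cf(1)[OF \<alpha>]])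
    have "twisted = - (\<psi>_coeff \<alpha> q * mixed)" using ST by simp
    then show ?thesis
      unfolding L cf_linear(1)[of \<alpha> "dir_deriv h \<xi>' q l - dir_deriv h \<xi> q l'"] cf_linear(5) G W
        d d' hp\<xi> \<xi>cf[OF \<alpha> q] kf_minus
      by (simp add: algebra_simps)
  qed
  \<comment> \<open>Components in \<open>h\<close>: closedness of the two-form and the derivative of \<open>\<phi>\<close>.\<close>
  have dx: "kf (x k) (dir_deriv h f q v) = - (\<Sum>j\<in>UNIV. C k j q * kf (x j) (dir_deriv h b q v))
      - (\<Sum>j\<in>UNIV. dir_deriv h (C k j) q v * kf (x j) (b q)) - kf (x k) (dir_deriv h z q v)"
    if "v \<in> h" "holo h (*s) V f" "holo h (*s) V b" "holo h (*s) V z"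
      "\<And>p. kf (x k) (f p) = - (\<Sum>j\<in>UNIV. C k j p * kf (x j) (b p)) - kf (x k) (z p)" for k v f b z
  proof -
    note m = holo_mult[OF Vh holo_subset[OF C_holo V(2)] kf_holo(1)[OF Vh that(3)]]
    have hs: "holo h (*) V (\<lambda>p. (\<Sum>j\<in>UNIV. C k j p * kf (x j) (b p)))" by (rule holo_scalar_sum(1)[OF Vh m(1)])
    have hf: "holo h (*) V (\<lambda>p. (\<Sum>j\<in>UNIV. C k j p * kf (x j) (b p)) + kf (x k) (z p))"
      by (rule holo_add(1)[where sc="(*)", OF h_subspace Vh distrib_left hs kf_holo(1)[OF Vh that(4)]])
    have "kf (x k) (dir_deriv h f q v) = dir_deriv h (\<lambda>p. kf (x k) (f p)) q v"
      by (rule kf_holo(2)[OF Vh that(2) q that(1), symmetric])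
    also have "(\<lambda>p. kf (x k) (f p)) = (\<lambda>p. - 1 * ((\<Sum>j\<in>UNIV. C k j p * kf (x j) (b p)) + kf (x k) (z p)))"
      using that(5) by auto
    also have "dir_deriv h \<dots> q v = - (dir_deriv h (\<lambda>p. \<Sum>j\<in>UNIV. C k j p * kf (x j) (b p)) q v
        + dir_deriv h (\<lambda>p. kf (x k) (z p)) q v)"
      using holo_mult(2)[OF Vh holo_scalar_const(1)[OF Vh, of "- 1"] hf q that(1)] holo_scalar_const(2)[OF Vh q that(1), of "- 1"]
        holo_add(2)[where sc="(*)", OF h_subspace Vh distrib_left hs kf_holo(1)[OF Vh that(4)] q that(1)] by simp
    also have "\<dots> = - ((\<Sum>j\<in>UNIV. C k j q * kf (x j) (dir_deriv h b q v) + dir_deriv h (C k j) q v * kf (x j) (b q))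
        + kf (x k) (dir_deriv h z q v))"
      using holo_scalar_sum(2)[OF Vh m(1) q that(1)] m(2)[OF q that(1)] kf_holo(2)[OF Vh that(3) q that(1)]
        kf_holo(2)[OF Vh that(4) q that(1)] by simp
    finally show ?thesis by (simp add: sum.distrib)
  qed
  have g'x: "kf (x k) (g'_bracket (\<xi> q) (\<xi>' q))
      = (\<Sum>\<alpha>\<in>\<Phi>. bracket_sign \<alpha> (- \<alpha>) * (\<psi>_coeff \<alpha> q * \<psi>_coeff (- \<alpha>) q) * kf \<alpha> (x k) * (cf \<alpha> (B q) * cf (- \<alpha>) (B' q)))" for k
  proof -
    have "kf (x k) (g'_bracket (\<xi> q) (\<xi>' q)) = kf (x k) (hp (g'_bracket (\<xi> q) (\<xi>' q)))" by (rule kf_x_hp[symmetric])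
    also have "\<dots> = (\<Sum>\<alpha>\<in>\<Phi>. bracket_sign \<alpha> (- \<alpha>) * (cf \<alpha> (\<xi> q) * cf (- \<alpha>) (\<xi>' q)) * kf \<alpha> (x k))"
      by (simp add: g'_bracket_coordinates hp_linear hp_more hp_h_action hp_weighted_bracket kf_linear kf_sym[of "x k"])
    finally show ?thesis
      using \<xi>cf q neg_root by simp (simp add: mult_ac)
  qed
  have cartan: "kf (x k) (- C_sharp q (hp E) - F + \<psi> q E)
      = kf (x k) (dir_deriv h \<xi>' q l - dir_deriv h \<xi> q l' + g'_bracket (\<xi> q) (\<xi>' q))" for k
  proof -
    have "kf (x j) E = kf (x j) (dir_deriv h B' q l) - kf (x j) (dir_deriv h B q l')" for j
      using kf_x_hp[of j W] hpW by (simp add: E_def kf_linear)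
    then show ?thesis
      unfolding kf_add_right kf_diff kf_minus C_sharp_coord kf_x_hp kx g'x F_def
        dx[OF lh(1) \<xi>h(2) B' Z'(2) \<xi>x(2)] dx[OF lh(2) \<xi>h(1) B Z(2) \<xi>x(1)]
        dR_form_coord(2)[OF qU] closed_contracted[OF qU] l_def[symmetric] l'_def[symmetric]
      by (simp add: right_diff_distrib sum_subtractf)
  qed
  have "- C_sharp q (hp E) - F + \<psi> q E = dir_deriv h \<xi>' q l - dir_deriv h \<xi> q l' + g'_bracket (\<xi> q) (\<xi>' q)"
    by (rule coordinates_eqI[OF cartan roots])
  moreover have "hp E = hp (dir_deriv h B' q l) - hp (dir_deriv h B q l')"
    using hpW by (simp add: E_def hp_more)
  ultimately show "\<tau>_fibre q (dynamical_bracket s t q) = trivial_bracket (\<lambda>p. \<tau>_fibre p (s p)) (\<lambda>p. \<tau>_fibre p (t p)) q"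
    unfolding tb db by (simp add: \<tau>_fibre_def)
qed

lemma transport: "algebroid_transport A_trivial A_dynamical \<sigma>_fibre \<tau>_fibre"
proof (intro algebroid_transport.intro algebroid_transport_axioms.intro lie_algebroid_trivial)
  show "pair.subspace (fibre A_dynamical)"
    using lie_algebroid.fibre_subspace[OF lie_algebroid_trivial] by (simp add: A_dynamical_simps A_trivial_simps)
  show "holo (tangent A_dynamical) (*s) (base A_dynamical) (\<lambda>q. anchor A_dynamical q u)" for u
    unfolding A_dynamical_simps by (rule holo_const(1)[where sc="(*s)", OF h_subspace U_sub vector_scale_axioms(2)])
  fix V s assume V: "open_in_base A_trivial V"
  show "(\<lambda>q. \<sigma>_fibre q (s q)) \<in> sections A_dynamical V" if "s \<in> sections A_trivial V"
    using \<sigma>_\<tau>_sections(1) that V by (simp add: sections_eq open_in_base_iff)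
  show "(\<lambda>q. \<tau>_fibre q (s q)) \<in> sections A_trivial V" if "s \<in> sections A_dynamical V"
    using \<sigma>_\<tau>_sections(2) that V by (simp add: sections_eq open_in_base_iff)
  fix t q assume s: "s \<in> sections A_dynamical V" and t: "t \<in> sections A_dynamical V" and q: "q \<in> V"
  have V': "openin (top_of_set h) V" "V \<subseteq> U" using V by (simp_all add: open_in_base_iff)
  show "bracket A_dynamical s t q \<in> fibre A_dynamical"
    and "\<tau>_fibre q (bracket A_dynamical s t q) = bracket A_trivial (\<lambda>p. \<tau>_fibre p (s p)) (\<lambda>p. \<tau>_fibre p (t p)) q"
    using \<tau>_bracket[OF V' q] s t by (simp_all add: sections_eq A_dynamical_simps A_trivial_simps mem_Times_iff)
qed (simp_all add: A_dynamical_simps A_trivial_simps \<sigma>_fibre_in \<tau>_fibre_in \<tau>_\<sigma> \<sigma>_\<tau> \<sigma>_fibre_linear,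
     simp add: \<tau>_fibre_def)

end

theorem theorem4p4:
  fixes br :: "complex ^ 'n \<Rightarrow> complex ^ 'n \<Rightarrow> complex ^ 'n"
    and h S :: "(complex ^ 'n) set"
    and e :: "complex ^ 'n \<Rightarrow> complex ^ 'n"
    and x :: "'r::finite \<Rightarrow> complex ^ 'n"
    and \<Gamma> :: "(complex ^ 'n) set"
    and \<mu> :: "complex ^ 'n"
    and C :: "'r \<Rightarrow> 'r \<Rightarrow> complex ^ 'n \<Rightarrow> complex"
  assumes "dynamical_r_matrix br h S e x \<Gamma> \<mu> C"
  shows
    "lie_algebroid_iso
       (dynamical_r_matrix.A_trivial br h S e x \<Gamma> \<mu> C)
       (dynamical_r_matrix.A_dynamical br h S e x \<Gamma> \<mu> C)
       (dynamical_r_matrix.\<sigma> br h S e x \<Gamma> \<mu> C)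
     \<and> (\<forall>q \<in> dynamical_r_matrix.U br h S e x \<Gamma> \<mu> C.
         \<forall>Z \<in> h. \<forall>l \<in> h. \<forall>n \<in> dynamical_r_matrix.n br h e.
       inv_into (total_space (dynamical_r_matrix.A_trivial br h S e x \<Gamma> \<mu> C))
           (dynamical_r_matrix.\<sigma> br h S e x \<Gamma> \<mu> C) (q, Z, l + n) =
         (q, l, - dynamical_r_matrix.C_sharp br x C q l - Z
                  + dynamical_r_matrix.\<psi> br h S e \<Gamma> \<mu> q n))"
proof -
  interpret dynamical_r_matrix br h S e x \<Gamma> \<mu> C by (rule assms)
  interpret T: algebroid_transport A_trivial A_dynamical \<sigma>_fibre \<tau>_fibre by (rule transport)
  have \<sigma>: "\<sigma> (q, u) = (q, \<sigma>_fibre q u)" if "q \<in> base A_trivial" for q u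
    using \<sigma>_eq that by (simp add: A_trivial_simps)
  have "inv_into (total_space A_trivial) \<sigma> (q, Z, l + m) = (q, l, - C_sharp q l - Z + \<psi> q m)"
    if q: "q \<in> U" and Z: "Z \<in> h" and l: "l \<in> h" and m: "m \<in> n" for q Z l m
  proof -
    have "\<psi> q (l + m) = \<psi> q m"
      by (rule eqI_cf) (use l in \<open>simp_all add: hp_\<psi> cf_\<psi> cf_linear cf_h\<close>)
    moreover have "hp (l + m) = l" using l m by (simp add: hp_linear hp_h n_iff)
    ultimately show ?thesis
      using T.iso(2)[OF \<sigma>, of q "(Z, l + m)"] q Z
      by (simp add: A_trivial_simps A_dynamical_simps \<tau>_fibre_def)
  qed
  then show ?thesis using T.iso(1)[OF \<sigma>] by blast
qed

end
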